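(* Let $N\ge 1$, let $\phi\in C^1((0,+\infty);(0,+\infty))$ satisfy $(\phi(s)s)'>0$ and $l-1\le \frac{(\phi(s)s)'}{\phi(s)}\le m-1$ for all $s>0$, where $1<l\le m$ are real constants, and let $V\in C^1(\mathbb R^N;\mathbb R)$. Let $c\in\mathbb R$ be such that $\mathcal V_c=\{x\in\mathbb R^N: V(x)\le c\}$ is the union of two nonempty sets $\mathcal V_c^-,\mathcal V_c^+$ with $\operatorname{dist}(\mathcal V_c^-,\mathcal V_c^+)>0$, and suppose that there exists $R>0$ such that $\inf_{q\in\Gamma_c}J_c(q)=\inf\{J_c(q): q\in\Gamma_c,\ \|q\|_{L^\infty(\mathbb R;\mathbb R^N)}\le R\}$. Then the system $(\phi(|\dot q|)\dot q)'=\nabla V(q)$ admits a minimal $c$-connection between $\mathcal V_c^-$ and $\mathcal V_c^+$.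
   Context: Set $\Phi(s)=\int_0^{|s|}\phi(r)r\,dr$ for $s\in\mathbb R$ and $G(s)=\phi(s)s^2-\Phi(s)$ for $s>0$, $G(0)=0$; the expression $\phi(|v|)v$ is read as $0$ when $v=0$. $\operatorname{dist}$ denotes Euclidean distance. For an interval $I$, $L^\Phi(I;\mathbb R^N)$ is the set of $q\in L^1_{loc}(I;\mathbb R^N)$ with $\int_I\Phi(|q|/\lambda)\,dt<\infty$ for some $\lambda>0$ (Luxemburg norm); $W^{1,\Phi}(I;\mathbb R^N)$ is the set of $q\in L^\Phi$ with weak derivative $\dot q\in L^\Phi$; $W^{1,\Phi}_{loc}(\mathbb R;\mathbb R^N)$ consists of functions whose restriction to every compact interval $I$ lies in $W^{1,\Phi}(I;\mathbb R^N)$ (identified with their continuous representatives). For an interval $I\subset\mathbb R$, $J_{c,I}(q)=\int_I\big(\Phi(|\dot q(t)|)+V(q(t))-c\big)\,dt$ and $J_c=J_{c,\mathbb R}$. The admissible class $\Gamma_c$ is the set of $q\in W^{1,\Phi}_{loc}(\mathbb R;\mathbb R^N)$ with $V(q(t))\ge c$ for all $t\in\mathbb R$ and $\liminf_{t\to-\infty}\operatorname{dist}(q(t),\mathcal V_c^-)=\liminf_{t\to+\infty}\operatorname{dist}(q(t),\mathcal V_c^+)=0$. Set $m_c=\inf_{\Gamma_c}J_c$. Let $I=(\alpha,\omega)$ with $-\infty\le\alpha<\omega\le+\infty$, and let $\bar I$ be its closure in $\mathbb R$. A function $q:\bar I\to\mathbb R^N$ is a $c$-connection between $\mathcal V_c^-$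 and $\mathcal V_c^+$ with contact times $\alpha,\omega$ if $q\in L^\infty(I;\mathbb R^N)$ and: (i) $q\in C^1(\bar I;\mathbb R^N)\cap C^2(I;\mathbb R^N)$ and $q$ solves $(\phi(|\dot q|)\dot q)'=\nabla V(q)$ on $I$; (ii) $V(q(t))>c$ and $E_q(t):=G(|\dot q(t)|)-V(q(t))=-c$ for all $t\in I$; (iii) $\lim_{t\to\alpha^+}\operatorname{dist}(q(t),\mathcal V_c^-)=\lim_{t\to\omega^-}\operatorname{dist}(q(t),\mathcal V_c^+)=0$. It is a minimal $c$-connection if moreover (iv) $J_{c,I}(q)=m_c$. *)

theory Defs
  imports "HOL-Analysis.Analysis" "HOL-Probability.Essential_Supremum"
begin

section \<open>The functions generated by \<open>\<phi>\<close>\<close>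

text \<open>Only the values of \<open>\<phi>\<close> on \<open>{0<..}\<close> matter: wherever \<open>\<phi> 0\<close> occurs below (also in
  \<open>\<phi> (norm v) *\<^sub>R v\<close>) it is multiplied by zero. In particular \<open>G_fun \<phi> 0 = 0\<close>.\<close>

definition Phi_fun :: "(real \<Rightarrow> real) \<Rightarrow> real \<Rightarrow> real" where
  "Phi_fun \<phi> s = integral {0..\<bar>s\<bar>} (\<lambda>r. \<phi> r * r)"

definition G_fun :: "(real \<Rightarrow> real) \<Rightarrow> real \<Rightarrow> real" where
  "G_fun \<phi> s = \<phi> s * s\<^sup>2 - Phi_fun \<phi> s"

section \<open>Gradients\<close>

definition gradient :: "('a::real_inner \<Rightarrow> real) \<Rightarrow> 'a \<Rightarrow> 'a" where
  "gradient V x = (THE D. GDERIV V x :> D)"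

definition C1_potential :: "('a::real_inner \<Rightarrow> real) \<Rightarrow> bool" where
  "C1_potential V \<longleftrightarrow> (\<exists>D. (\<forall>x. GDERIV V x :> D x) \<and> continuous_on UNIV D)"

lemma gradient_eqI:
  assumes "GDERIV V x :> D"
  shows "gradient V x = D"
  unfolding gradient_def
proof (rule the_equality[where P = "\<lambda>D. GDERIV V x :> D", OF assms])
  fix E assume "GDERIV V x :> E"
  with assms have "(\<lambda>h. inner h E) = (\<lambda>h. inner h D)"
    unfolding gderiv_def by (rule has_derivative_unique[rotated])
  then have "inner (E - D) E = inner (E - D) D"
    by meson
  then show "E = D"
    by (metis inner_diff_right inner_eq_zero_iff right_minus_eq)
qed

section \<open>Lebesgue, Orlicz and Orlicz--Sobolev classes on an interval\<close>

definition L1_loc :: "real set \<Rightarrow> (real \<Rightarrow> 'a::euclidean_space) \<Rightarrow> bool" where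
  "L1_loc I q \<longleftrightarrow> (\<forall>K. compact K \<and> K \<subseteq> I \<longrightarrow> q absolutely_integrable_on K)"

definition Linf_norm :: "real set \<Rightarrow> (real \<Rightarrow> 'a::euclidean_space) \<Rightarrow> ereal" where
  "Linf_norm I q = esssup (lebesgue_on I) (\<lambda>t. ereal (norm (q t)))"

definition L_inf :: "real set \<Rightarrow> (real \<Rightarrow> 'a::euclidean_space) \<Rightarrow> bool" where
  "L_inf I q \<longleftrightarrow> q \<in> borel_measurable (lebesgue_on I) \<and> Linf_norm I q < \<infinity>"

definition L_Phi :: "(real \<Rightarrow> real) \<Rightarrow> real set \<Rightarrow> (real \<Rightarrow> 'a::euclidean_space) \<Rightarrow> bool" where
  "L_Phi \<phi> I q \<longleftrightarrow> L1_loc I q \<and>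
     (\<exists>k>0. (\<integral>\<^sup>+t\<in>I. ennreal (Phi_fun \<phi> (norm (q t) / k)) \<partial>lebesgue) < \<infinity>)"

text \<open>Smooth functions with compact support contained in \<open>U\<close>.\<close>

definition test_functions :: "real set \<Rightarrow> (real \<Rightarrow> real) set" where
  "test_functions U = {\<psi>. (\<forall>k. (deriv ^^ k) \<psi> differentiable_on UNIV) \<and>
     compact (closure {t. \<psi> t \<noteq> 0}) \<and> closure {t. \<psi> t \<noteq> 0} \<subseteq> U}"

definition has_weak_derivative ::
    "real set \<Rightarrow> (real \<Rightarrow> 'a::euclidean_space) \<Rightarrow> (real \<Rightarrow> 'a) \<Rightarrow> bool" where
  "has_weak_derivative I q p \<longleftrightarrow> L1_loc I q \<and> L1_loc I p \<and>
     (\<forall>\<psi>\<in>test_functions (interior I).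
        (LINT t:I|lebesgue. deriv \<psi> t *\<^sub>R q t) = - (LINT t:I|lebesgue. \<psi> t *\<^sub>R p t))"

text \<open>A representative of the weak derivative, which is unique up to null sets.\<close>

definition weak_derivative :: "real set \<Rightarrow> (real \<Rightarrow> 'a::euclidean_space) \<Rightarrow> real \<Rightarrow> 'a" where
  "weak_derivative I q = (SOME p. has_weak_derivative I q p)"

definition W1_Phi :: "(real \<Rightarrow> real) \<Rightarrow> real set \<Rightarrow> (real \<Rightarrow> 'a::euclidean_space) \<Rightarrow> bool" where
  "W1_Phi \<phi> I q \<longleftrightarrow> L_Phi \<phi> I q \<and> (\<exists>p. has_weak_derivative I q p \<and> L_Phi \<phi> I p)"

text \<open>Elements of the local space on the line are identified with their continuous
  representatives, hence the continuity clause.\<close>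

definition W1_Phi_loc :: "(real \<Rightarrow> real) \<Rightarrow> (real \<Rightarrow> 'a::euclidean_space) \<Rightarrow> bool" where
  "W1_Phi_loc \<phi> q \<longleftrightarrow> continuous_on UNIV q \<and> (\<forall>a b. a < b \<longrightarrow> W1_Phi \<phi> {a..b} q)"

section \<open>The variational problem\<close>

text \<open>The functional is only ever evaluated on curves along which \<open>V \<ge> c\<close>. There the integrand
  is nonnegative, so the value is an element of \<open>[0, \<infinity>]\<close> and \<open>ennreal\<close> truncates nothing.\<close>

definition J_fun :: "(real \<Rightarrow> real) \<Rightarrow> ('a::euclidean_space \<Rightarrow> real) \<Rightarrow> real \<Rightarrow> real set
    \<Rightarrow> (real \<Rightarrow> 'a) \<Rightarrow> ennreal" where
  "J_fun \<phi> V c I q =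
     (\<integral>\<^sup>+t\<in>I. ennreal (Phi_fun \<phi> (norm (weak_derivative I q t)) + V (q t) - c) \<partial>lebesgue)"

definition admissible :: "(real \<Rightarrow> real) \<Rightarrow> ('a::euclidean_space \<Rightarrow> real) \<Rightarrow> real
    \<Rightarrow> 'a set \<Rightarrow> 'a set \<Rightarrow> (real \<Rightarrow> 'a) set" where
  "admissible \<phi> V c Vm Vp = {q. W1_Phi_loc \<phi> q \<and> (\<forall>t. c \<le> V (q t)) \<and>
     Liminf at_bot (\<lambda>t. ereal (infdist (q t) Vm)) = 0 \<and>
     Liminf at_top (\<lambda>t. ereal (infdist (q t) Vp)) = 0}"

definition m_inf :: "(real \<Rightarrow> real) \<Rightarrow> ('a::euclidean_space \<Rightarrow> real) \<Rightarrow> real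
    \<Rightarrow> 'a set \<Rightarrow> 'a set \<Rightarrow> ennreal" where
  "m_inf \<phi> V c Vm Vp = (INF q\<in>admissible \<phi> V c Vm Vp. J_fun \<phi> V c UNIV q)"

section \<open>Connections\<close>

text \<open>Derivatives at finite end points of \<open>S\<close> are one-sided.\<close>

definition C1_on :: "real set \<Rightarrow> (real \<Rightarrow> 'a::real_normed_vector) \<Rightarrow> bool" where
  "C1_on S q \<longleftrightarrow> (\<exists>D. (\<forall>t\<in>S. (q has_vector_derivative D t) (at t within S)) \<and> continuous_on S D)"

definition C2_on_open :: "real set \<Rightarrow> (real \<Rightarrow> 'a::real_normed_vector) \<Rightarrow> bool" where
  "C2_on_open I q \<longleftrightarrow> q C1_differentiable_on I \<and>
     (\<lambda>t. vector_derivative q (at t)) C1_differentiable_on I"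

text \<open>A curve on the closure of the interval \<open>(\<alpha>, \<omega>)\<close> is represented by a total function; no clause
  depends on its values off that closure. The limits at \<open>\<alpha>\<close> and \<open>\<omega>\<close> are taken in the extended
  reals, so that infinite contact times are covered.\<close>

definition c_connection :: "(real \<Rightarrow> real) \<Rightarrow> ('a::euclidean_space \<Rightarrow> real) \<Rightarrow> real
    \<Rightarrow> 'a set \<Rightarrow> 'a set \<Rightarrow> ereal \<Rightarrow> ereal \<Rightarrow> (real \<Rightarrow> 'a) \<Rightarrow> bool" where
  "c_connection \<phi> V c Vm Vp \<alpha> \<omega> q \<longleftrightarrow>
     \<alpha> < \<omega> \<and>
     L_inf (einterval \<alpha> \<omega>) q \<and>
     C1_on (closure (einterval \<alpha> \<omega>)) q \<and>
     C2_on_open (einterval \<alpha> \<omega>) q \<and>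
     (\<forall>t\<in>einterval \<alpha> \<omega>.
        ((\<lambda>s. \<phi> (norm (vector_derivative q (at s))) *\<^sub>R vector_derivative q (at s))
           has_vector_derivative gradient V (q t)) (at t)) \<and>
     (\<forall>t\<in>einterval \<alpha> \<omega>.
        V (q t) > c \<and> G_fun \<phi> (norm (vector_derivative q (at t))) - V (q t) = - c) \<and>
     (((\<lambda>t. infdist (q t) Vm) \<circ> real_of_ereal) \<longlongrightarrow> 0) (at_right \<alpha>) \<and>
     (((\<lambda>t. infdist (q t) Vp) \<circ> real_of_ereal) \<longlongrightarrow> 0) (at_left \<omega>)"

definition minimal_c_connection :: "(real \<Rightarrow> real) \<Rightarrow> ('a::euclidean_space \<Rightarrow> real) \<Rightarrow> real
    \<Rightarrow> 'a set \<Rightarrow> 'a set \<Rightarrow> ereal \<Rightarrow> ereal \<Rightarrow> (real \<Rightarrow> 'a) \<Rightarrow> bool" where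
  "minimal_c_connection \<phi> V c Vm Vp \<alpha> \<omega> q \<longleftrightarrow>
     c_connection \<phi> V c Vm Vp \<alpha> \<omega> q \<and>
     J_fun \<phi> V c (einterval \<alpha> \<omega>) q = m_inf \<phi> V c Vm Vp"

end

theory Submission
  imports Defs "HOL-Complex_Analysis.Great_Picard" "HOL-Real_Asymp.Real_Asymp"
begin

text \<open>Let \<open>q n\<close> be admissible curves of action at most \<open>m\<^sub>c + 1 / (n + 1)\<close>, bounded by \<open>R\<close> and shifted
  in time so that \<open>q n 0\<close> has distance \<open>\<delta> / 2\<close> to \<open>V\<^sub>-\<close>, where \<open>\<delta>\<close> is the distance of the two sublevel
  sets. Superlinearity of \<open>\<Phi>\<close> makes them equicontinuous, so a subsequence converges to a curve \<open>\<gamma>\<close>.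

  No weak compactness is needed: since \<open>q n\<close> is nearly minimal, its action on a short interval is at
  most that of the straight segment with the same end points, while Jensen's inequality on the two
  halves of the interval bounds it from below. Where \<open>V > c\<close> the speeds stay in a compact subset of
  \<open>(0, \<infinity>)\<close>, on which \<open>\<Phi> \<circ> norm\<close> is uniformly convex, so in the limit the second differences of
  \<open>\<gamma>\<close> with step \<open>h\<close> are \<open>O(h powr (3/2))\<close> and \<open>\<gamma>\<close> is \<open>C\<^sup>1\<close> there. Letting the segment take a different
  time \<open>\<mu> h\<close> and differentiating in \<open>\<mu>\<close> gives the energy identity. Lower semicontinuity of the action
  then shows that \<open>\<gamma>\<close> is minimal for fixed end points, and the Euler--Lagrange equation
  follows from du Bois-Reymond's lemma. Together with the energy identity it yields \<open>C\<^sup>2\<close> regularity.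

  Finally \<open>V \<circ> \<gamma> - c\<close> is integrable and uniformly continuous, hence vanishes at \<open>\<plusminus>\<infinity>\<close>, and cutting
  the curves \<open>q n\<close> short near the sublevel sets shows that \<open>\<gamma>\<close> approaches the correct set on each
  side. The contact times are the zeros of \<open>V \<circ> \<gamma> - c\<close> nearest to \<open>0\<close>.\<close>

section \<open>Growth and convexity of \<open>\<Phi>\<close>\<close>

text \<open>The obstacle is that pointwise convergence of \<open>q n\<close> says nothing about the
  derivatives \<open>p n\<close>. They therefore enter only through actions on short intervals,
  which Jensen's inequality bounds in terms of end points alone, and end points converge. The
  constraint \<open>c \<le> V\<close> restricts the competitors: a segment is inserted only inside a
  ball on which \<open>V > c\<close>, or up to its first contact with the sublevel set. The exponent
  3/2 arises because the potential varies by O(h) along a piece of duration h: this is all that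
  near-minimality can gain, so uniform convexity bounds the squared difference of the mean
  velocities of the two halves by O(h), and multiplying their difference by h / 2 gives the second
  difference. The energy identity has two further uses. It determines the speed through the strictly
  increasing function \<open>G\<close>, so the acceleration comes from differentiating a scalar
  relation and the vector-valued momentum map is never inverted. It also forces the velocity to
  vanish at a finite contact time, so that letting the curve rest there keeps it C^1 and turns it
  into a competitor on the whole line.\<close>

locale orlicz_growth =
  fixes \<phi> :: "real \<Rightarrow> real" and l :: real
  assumes l_gt_1: "1 < l"
    and phi_pos: "\<And>s. s > 0 \<Longrightarrow> \<phi> s > 0"
    and phi_C1: "\<phi> C1_differentiable_on {0<..}"
    and growth: "\<And>s. s > 0 \<Longrightarrow> l - 1 \<le> deriv (\<lambda>r. \<phi> r * r) s / \<phi> s"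
begin

text \<open>\<open>A\<close> is the derivative of \<open>\<Phi>\<close> on the half-line, and
  \<open>momentum\<close> is the gradient of \<open>\<Phi> \<circ> norm\<close>.\<close>

definition A :: "real \<Rightarrow> real" where "A s = \<phi> s * s"

definition momentum :: "'a::euclidean_space \<Rightarrow> 'a" where "momentum v = \<phi> (norm v) *\<^sub>R v"

abbreviation "\<Phi> \<equiv> Phi_fun \<phi>"
abbreviation "G \<equiv> G_fun \<phi>"

lemma A_0 [simp]: "A 0 = 0"
  by (simp add: A_def)

lemma A_pos: "s > 0 \<Longrightarrow> A s > 0"
  by (simp add: A_def phi_pos)

lemma phi_derivative:
  obtains d where "\<And>s. s > 0 \<Longrightarrow> (\<phi> has_real_derivative d s) (at s)" "continuous_on {0<..} d"
  using phi_C1 that unfolding C1_differentiable_on_def has_real_derivative_iff_has_vector_derivative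
  by blast

lemma phi_cont: "continuous_on {0<..} \<phi>"
proof -
  obtain d where "\<And>s. s > 0 \<Longrightarrow> (\<phi> has_real_derivative d s) (at s)"
    using phi_derivative by blast
  then show ?thesis
    by (intro continuous_at_imp_continuous_on) (auto intro: DERIV_isCont)
qed

lemma
  shows A_deriv: "s > 0 \<Longrightarrow> (A has_real_derivative deriv A s) (at s)"
    and deriv_A_cont: "continuous_on {0<..} (deriv A)"
proof -
  obtain d where d: "\<And>s. s > 0 \<Longrightarrow> (\<phi> has_real_derivative d s) (at s)" "continuous_on {0<..} d"
    using phi_derivative by blast
  have *: "(A has_real_derivative d s * s + \<phi> s) (at s)" if "s > 0" for s
    unfolding A_def by (rule derivative_eq_intros d(1)[OF that] refl | simp)+
  then have eq: "deriv A s = d s * s + \<phi> s" if "s > 0" for s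
    using that by (simp add: DERIV_imp_deriv)
  show "s > 0 \<Longrightarrow> (A has_real_derivative deriv A s) (at s)"
    using * eq by metis
  have "continuous_on {0<..} (\<lambda>s. d s * s + \<phi> s)"
    by (intro continuous_intros d(2) phi_cont)
  then show "continuous_on {0<..} (deriv A)"
    by (rule continuous_on_eq) (simp add: eq)
qed

lemma deriv_A_ge:
  assumes "s > 0" shows "(l - 1) * \<phi> s \<le> deriv A s"
  using growth[OF assms] phi_pos[OF assms] by (simp add: A_def[abs_def] field_simps)

lemma deriv_A_pos: "s > 0 \<Longrightarrow> deriv A s > 0"
  by (smt (verit) deriv_A_ge l_gt_1 mult_pos_pos phi_pos)

lemma A_strict_mono:
  assumes "0 \<le> s" "s < t" shows "A s < A t"
proof (cases "s = 0")
  case True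
  then show ?thesis using assms A_pos by simp
next
  case False
  show ?thesis
  proof (rule DERIV_pos_imp_increasing[OF assms(2)])
    fix x assume "s \<le> x" "x \<le> t"
    then have "x > 0" using False assms by linarith
    then show "\<exists>y. (A has_real_derivative y) (at x) \<and> 0 < y"
      using A_deriv deriv_A_pos by blast
  qed
qed

lemma A_mono: "0 \<le> s \<Longrightarrow> s \<le> t \<Longrightarrow> A s \<le> A t"
  using A_strict_mono[of s t] by (cases "s = t") auto

text \<open>The growth condition reads \<open>s * deriv A s \<ge> (l - 1) * A s\<close>: the
  logarithmic derivative of \<open>A\<close> dominates that of \<open>s powr (l - 1)\<close>, so the
  quotient increases. Comparison with its value at 1 gives the power bounds that control
  \<open>A\<close> near 0 and at infinity.\<close>

lemma A_powr_mono:
  assumes "0 < s" "s \<le> t" shows "A s * s powr (1 - l) \<le> A t * t powr (1 - l)"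
proof (rule DERIV_nonneg_imp_nondecreasing[OF assms(2)])
  fix x assume "s \<le> x" "x \<le> t"
  then have x: "x > 0" using assms by linarith
  let ?D = "deriv A x * x powr (1 - l) + (1 - l) * x powr (1 - l - 1) * A x"
  have "((\<lambda>x. A x * x powr (1 - l)) has_real_derivative ?D) (at x)"
    by (rule derivative_eq_intros A_deriv[OF x] refl | use x in simp)+
  moreover have "(l - 1) * \<phi> x * x powr (1 - l) \<le> deriv A x * x powr (1 - l)"
    by (intro mult_right_mono deriv_A_ge x) simp
  moreover have "x powr (1 - l - 1) * A x = \<phi> x * x powr (1 - l)"
    using x by (simp add: A_def powr_diff powr_minus field_simps)
  ultimately show "\<exists>y. ((\<lambda>x. A x * x powr (1 - l)) has_real_derivative y) (at x) \<and> 0 \<le> y"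
    by (intro exI[of _ ?D]) (auto simp: algebra_simps)
qed

lemma A_le_powr:
  assumes "0 < s" "s \<le> 1" shows "A s \<le> A 1 * s powr (l - 1)"
proof -
  have "A s * s powr (1 - l) * s powr (l - 1) \<le> A 1 * s powr (l - 1)"
    using A_powr_mono[OF assms] by (intro mult_right_mono) auto
  then show ?thesis using assms by (simp add: mult.assoc flip: powr_add)
qed

lemma A_ge_powr:
  assumes "1 \<le> s" shows "A 1 * s powr (l - 1) \<le> A s"
proof -
  have "A 1 * s powr (l - 1) \<le> A s * s powr (1 - l) * s powr (l - 1)"
    using A_powr_mono[of 1 s] assms by (intro mult_right_mono) auto
  then show ?thesis using assms by (simp add: mult.assoc flip: powr_add)
qed

lemma A_unbounded: "\<exists>s>0. B < A s"
proof -
  have "filterlim (\<lambda>s. A 1 * s powr (l - 1)) at_top at_top"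
  proof -
    have "filterlim (\<lambda>s::real. a * s powr b) at_top at_top" if "a > 0" "b > 0" for a b
      using that by real_asymp
    then show ?thesis using l_gt_1 A_pos[of 1] by simp
  qed
  then have "\<forall>\<^sub>F s in at_top. B < A 1 * s powr (l - 1)"
    by (simp add: filterlim_at_top_dense)
  then have "\<forall>\<^sub>F s in at_top. B < A 1 * s powr (l - 1) \<and> 1 \<le> s"
    using eventually_ge_at_top eventually_conj by blast
  then obtain s where "B < A 1 * s powr (l - 1)" "1 \<le> s"
    using eventually_happens' trivial_limit_at_top_linorder by blast
  then show ?thesis using A_ge_powr[of s] by (intro exI[of _ s]) auto
qed

text \<open>\<open>\<phi>\<close> itself may blow up at 0, but the positive exponent
  \<open>l - 1\<close> still forces \<open>A\<close> to 0. Continuity of \<open>A\<close> and of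
  \<open>momentum\<close> at the origin rests on this.\<close>

lemma A_tendsto_0: "(A \<longlongrightarrow> 0) (at 0 within {0..})"
proof (rule Lim_null_comparison)
  show "\<forall>\<^sub>F s in at 0 within {0..}. norm (A s) \<le> A 1 * s powr (l - 1)"
    unfolding eventually_at using A_le_powr A_pos
    by (intro exI[of _ 1]) (auto simp: dist_real_def abs_of_pos less_le)
  have "((\<lambda>s. A 1 * s powr (l - 1)) \<longlongrightarrow> A 1 * 0 powr (l - 1)) (at 0 within {0..})"
    using l_gt_1 by (intro tendsto_intros) (auto simp: eventually_at_filter)
  then show "((\<lambda>s. A 1 * s powr (l - 1)) \<longlongrightarrow> 0) (at 0 within {0..})" by simp
qed

lemma A_cont: "continuous_on {0..} A"
  unfolding continuous_on_def
proof
  fix s :: real assume "s \<in> {0..}"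
  then consider "s = 0" | "s > 0" by fastforce
  then show "(A \<longlongrightarrow> A s) (at s within {0..})"
  proof cases
    case 2
    then show ?thesis using A_deriv DERIV_isCont isCont_def tendsto_within_subset by (metis subset_UNIV)
  qed (use A_tendsto_0 in simp)
qed

section \<open>The function \<open>\<Phi>\<close> and its Legendre conjugate\<close>

lemma Phi_eq: "\<Phi> s = integral {0..\<bar>s\<bar>} A"
  by (simp add: Phi_fun_def A_def[abs_def])

lemma Phi_0 [simp]: "\<Phi> 0 = 0"
  by (simp add: Phi_eq)

lemma Phi_deriv_within:
  assumes "0 \<le> s" shows "(\<Phi> has_real_derivative A s) (at s within {0..})"
proof -
  have "((\<lambda>u. integral {0..u} A) has_real_derivative A s) (at s within {0..s+1})"
    using assms by (intro integral_has_real_derivative continuous_on_subset[OF A_cont]) auto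
  then have "((\<lambda>u. integral {0..u} A) has_real_derivative A s) (at s within {0..})"
    using at_within_nhd[of s "{..<s+1}" "{0..s+1}" "{0..}"] by force
  then show ?thesis
    by (rule has_field_derivative_transform_within[where d=1]) (use assms in \<open>auto simp: Phi_eq\<close>)
qed

lemma Phi_deriv:
  assumes "0 < s" shows "(\<Phi> has_real_derivative A s) (at s)"
  using Phi_deriv_within[of s] assms at_within_interior[of s "{0..}"] by simp

lemma Phi_cont: "continuous_on UNIV \<Phi>"
proof -
  have "continuous_on {0..} \<Phi>"
    by (rule DERIV_continuous_on) (use Phi_deriv_within in auto)
  then have "continuous_on UNIV (\<lambda>s. \<Phi> \<bar>s\<bar>)"
    by (rule continuous_on_compose2) (auto intro!: continuous_intros)
  then show ?thesis by (simp add: Phi_fun_def)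
qed

lemma Phi_mvt:
  assumes "0 \<le> a" "a < b" obtains x where "a < x" "x < b" "\<Phi> b - \<Phi> a = (b - a) * A x"
proof -
  have "continuous_on {a..b} \<Phi>" using Phi_cont continuous_on_subset by blast
  moreover have "(\<Phi> has_derivative (*) (A x)) (at x)" if "a < x" "x < b" for x
    using Phi_deriv[of x] that assms by (simp add: has_field_derivative_def)
  ultimately obtain x where "a < x" "x < b" "\<Phi> b - \<Phi> a = A x * (b - a)"
    by (rule mvt[OF assms(2)])
  then show ?thesis using that by (simp add: mult.commute)
qed

lemma Phi_convex:
  assumes "0 \<le> a" "0 \<le> b" shows "\<Phi> a + A a * (b - a) \<le> \<Phi> b"
proof (cases a b rule: linorder_cases)
  case less
  obtain x where "a < x" "x < b" "\<Phi> b - \<Phi> a = (b - a) * A x"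
    using Phi_mvt[OF assms(1) less] .
  moreover have "(b - a) * A a \<le> (b - a) * A x"
    using calculation assms by (intro mult_left_mono A_mono) auto
  ultimately show ?thesis by (simp add: algebra_simps)
next
  case greater
  obtain x where "b < x" "x < a" "\<Phi> a - \<Phi> b = (a - b) * A x"
    using Phi_mvt[OF assms(2) greater] .
  moreover have "(a - b) * A x \<le> (a - b) * A a"
    using calculation assms by (intro mult_left_mono A_mono) auto
  ultimately show ?thesis by (simp add: algebra_simps)
qed simp

lemma Phi_nonneg [simp]: "0 \<le> \<Phi> s"
  using Phi_convex[of 0 "\<bar>s\<bar>"] by (simp add: Phi_fun_def)

lemma Phi_mono: "0 \<le> a \<Longrightarrow> a \<le> b \<Longrightarrow> \<Phi> a \<le> \<Phi> b"
  using Phi_convex[of a b] A_mono[of 0 a] by (smt (verit) A_0 mult_nonneg_nonneg)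

text \<open>\<open>G s\<close> is the Legendre conjugate of \<open>\<Phi>\<close> at the slope
  \<open>A s\<close>: the tangent to \<open>\<Phi>\<close> at \<open>s\<close> meets the vertical
  axis at height \<open>- G s\<close>. Hence it occurs both in linear lower bounds for
  \<open>\<Phi>\<close> and as the kinetic part of the energy.\<close>

lemma G_eq: "G s = A s * s - \<Phi> s"
  by (simp add: G_fun_def A_def power2_eq_square)

lemma G_0 [simp]: "G 0 = 0"
  by (simp add: G_eq)

lemma G_strict_mono:
  assumes "0 \<le> a" "a < b" shows "G a < G b"
proof -
  have le: "G a \<le> G b" if "0 \<le> a" "a \<le> b" for a b
  proof -
    have "\<Phi> b \<le> \<Phi> a + A b * (b - a)" using Phi_convex[of b a] that by (simp add: algebra_simps)
    moreover have "a * A a \<le> a * A b" using that by (intro mult_left_mono A_mono) auto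
    ultimately show ?thesis by (simp add: G_eq algebra_simps)
  qed
  \<comment> \<open>The tangent inequalities alone give weak monotonicity. The midpoint is a
    positive abscissa, so multiplying the strict inequality for \<open>A\<close> by it stays strict
    even if \<open>a = 0\<close>.\<close>
  define c where "c = (a + b) / 2"
  have c: "a < c" "c < b" "0 < c" using assms by (auto simp: c_def)
  have "\<Phi> b \<le> \<Phi> c + A b * (b - c)" using Phi_convex[of b c] c by (simp add: algebra_simps)
  moreover have "c * A c < c * A b" using c by (intro mult_strict_left_mono A_strict_mono) auto
  ultimately have "G c < G b" by (simp add: G_eq algebra_simps)
  then show ?thesis using le[of a c] assms c by auto
qed

lemma G_pos: "0 < s \<Longrightarrow> 0 < G s"
  using G_strict_mono[of 0 s] by simp

lemma G_less_iff: "0 \<le> a \<Longrightarrow> 0 \<le> b \<Longrightarrow> G a < G b \<longleftrightarrow> a < b"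
  by (metis G_strict_mono linorder_cases order_less_asym)

lemma G_deriv:
  assumes "0 < s" shows "(G has_real_derivative deriv A s * s) (at s)"
proof -
  have "((\<lambda>s. A s * s - \<Phi> s) has_real_derivative deriv A s * s) (at s)"
    by (rule derivative_eq_intros A_deriv Phi_deriv assms refl | simp)+
  then show ?thesis by (simp add: G_eq[abs_def])
qed

lemma Phi_ge_linear:
  assumes "0 \<le> a" "0 \<le> s" shows "A a * s - G a \<le> \<Phi> s"
  using Phi_convex[OF assms] by (simp add: G_eq algebra_simps)

lemma Phi_superlinear:
  obtains S where "0 < S" "\<And>s. 0 \<le> s \<Longrightarrow> \<Phi> s \<le> C * s \<Longrightarrow> s \<le> S"
proof -
  \<comment> \<open>A tangent of slope above \<open>C + 1\<close> outgrows \<open>C * s\<close> by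
    at least \<open>s\<close>, so its intercept \<open>G a\<close> bounds every such
    \<open>s\<close>.\<close>
  obtain a where a: "a > 0" "C + 1 < A a" using A_unbounded by blast
  show ?thesis
  proof (rule that[of "G a"])
    fix s :: real assume s: "0 \<le> s" "\<Phi> s \<le> C * s"
    have "(C + 1) * s \<le> A a * s" using a s by (intro mult_right_mono) auto
    then show "s \<le> G a" using Phi_ge_linear[of a s] a s by (simp add: algebra_simps)
  qed (use a G_pos in auto)
qed

section \<open>Convexity of \<open>\<Phi> \<circ> norm\<close>\<close>

lemma norm_momentum: "norm (momentum v) = A (norm v)"
  using phi_pos[of "norm v"] by (cases "v = 0") (auto simp: momentum_def A_def abs_of_pos)

lemma momentum_inner: "momentum v \<bullet> v = A (norm v) * norm v"
  by (simp add: momentum_def A_def dot_square_norm power2_eq_square)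

lemma momentum_cont: "continuous_on UNIV (momentum :: 'a::euclidean_space \<Rightarrow> 'a)"
  unfolding continuous_on_def
proof
  fix v :: 'a
  show "(momentum \<longlongrightarrow> momentum v) (at v within UNIV)"
  proof (cases "v = 0")
    case True
    have "continuous_on UNIV (\<lambda>v::'a. A (norm v))"
      by (rule continuous_on_compose2[OF A_cont]) (auto intro!: continuous_intros)
    then have "((\<lambda>v::'a. A (norm v)) \<longlongrightarrow> 0) (at 0)"
      unfolding continuous_on_def by (metis A_0 UNIV_I norm_zero)
    then have "(momentum \<longlongrightarrow> 0) (at (0::'a))"
      by (intro Lim_null_comparison[of momentum "\<lambda>v. A (norm v)"]) (simp_all add: norm_momentum)
    then show ?thesis using True by (simp add: momentum_def)
  next
    case False
    have "continuous_on (- {0}) (\<lambda>v::'a. \<phi> (norm v) *\<^sub>R v)"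
      by (intro continuous_intros continuous_on_compose2[OF phi_cont]) auto
    then show ?thesis
      using False by (simp add: momentum_def[abs_def] continuous_on_eq_continuous_at open_Compl isCont_def)
  qed
qed

lemma Phi_norm_convex:
  fixes v w :: "'a::euclidean_space"
  shows "\<Phi> (norm w) + momentum w \<bullet> (v - w) \<le> \<Phi> (norm v)"
proof -
  have "momentum w \<bullet> v \<le> A (norm w) * norm v"
    using norm_cauchy_schwarz[of "momentum w" v] by (simp add: norm_momentum)
  then show ?thesis
    using Phi_convex[of "norm w" "norm v"] by (simp add: inner_diff_right momentum_inner algebra_simps)
qed

text \<open>Convexity traps the remainder between 0 and
  \<open>(momentum w - momentum v) \<bullet> (w - v)\<close>, so differentiability, also at
  \<open>v = 0\<close>, reduces to continuity of \<open>momentum\<close>.\<close>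

lemma Phi_norm_derivative:
  fixes v :: "'a::euclidean_space"
  shows "((\<lambda>v. \<Phi> (norm v)) has_derivative (\<lambda>h. momentum v \<bullet> h)) (at v)"
proof -
  have "((\<lambda>w. norm (\<Phi> (norm w) - \<Phi> (norm v) - momentum v \<bullet> (w - v)) / norm (w - v)) \<longlongrightarrow> 0) (at v)"
  proof (rule Lim_null_comparison)
    have "norm (\<Phi> (norm w) - \<Phi> (norm v) - momentum v \<bullet> (w - v)) / norm (w - v)
        \<le> norm (momentum w - momentum v)" if "w \<noteq> v" for w
    proof -
      have "\<Phi> (norm w) - \<Phi> (norm v) - momentum v \<bullet> (w - v) \<le> (momentum w - momentum v) \<bullet> (w - v)"
        using Phi_norm_convex[of w v] by (simp add: inner_diff_left inner_diff_right)
      also have "\<dots> \<le> norm (momentum w - momentum v) * norm (w - v)"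
        by (rule norm_cauchy_schwarz)
      finally show ?thesis using Phi_norm_convex[of v w] that by (simp add: field_simps)
    qed
    then show "\<forall>\<^sub>F w in at v. norm (norm (\<Phi> (norm w) - \<Phi> (norm v) - momentum v \<bullet> (w - v)) / norm (w - v))
        \<le> norm (momentum w - momentum v)"
      by (auto simp: eventually_at_filter)
    have "(momentum \<longlongrightarrow> momentum v) (at v)"
      using momentum_cont by (auto simp: continuous_on_def)
    then show "((\<lambda>w. norm (momentum w - momentum v)) \<longlongrightarrow> 0) (at v)"
      by (simp add: LIM_zero_iff tendsto_norm_zero_iff)
  qed
  then show ?thesis
    unfolding has_derivative_iff_norm by (simp add: bounded_linear_inner_right)
qed

text \<open>The convexity defect splits into a radial part, governed by \<open>deriv A\<close>, and
  an angular part \<open>\<phi> s * (s * t - w \<bullet> v)\<close>, governed by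
  \<open>\<phi> s = A s / s \<ge> A a / b\<close>. The constant \<open>\<kappa>\<close> is half the
  smaller of the two lower bounds on the annulus.\<close>

lemma Phi_uniformly_convex:
  assumes "0 < a" "a \<le> b"
  obtains \<kappa> where "0 < \<kappa>"
    "\<And>v w :: 'a::euclidean_space. norm v \<in> {a..b} \<Longrightarrow> norm w \<in> {a..b} \<Longrightarrow>
       \<Phi> (norm w) + momentum w \<bullet> (v - w) + \<kappa> * (norm (v - w))\<^sup>2 \<le> \<Phi> (norm v)"
proof -
  have "continuous_on {a..b} (deriv A)"
    by (rule continuous_on_subset[OF deriv_A_cont]) (use assms in auto)
  then obtain x where x: "x \<in> {a..b}" "\<And>y. y \<in> {a..b} \<Longrightarrow> deriv A x \<le> deriv A y"
    using continuous_attains_inf[of "{a..b}" "deriv A"] assms by auto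
  define \<kappa> where "\<kappa> = min (deriv A x / 2) (A a / (2 * b))"
  have \<kappa>: "0 < \<kappa>" "2 * \<kappa> \<le> deriv A x" "2 * \<kappa> * b \<le> A a"
    using deriv_A_pos[of x] x assms A_pos[of a] by (auto simp: \<kappa>_def min_def field_simps)
  have scalar: "\<Phi> s + A s * (t - s) + \<kappa> * (t - s)\<^sup>2 \<le> \<Phi> t" if st: "s \<in> {a..b}" "t \<in> {a..b}" for s t
  proof -
    \<comment> \<open>Subtracting \<open>\<kappa> * r\<^sup>2\<close> leaves a function that is
      still convex on the interval.\<close>
    have "(A s - 2 * \<kappa> * s) * (t - s) \<le> (\<Phi> t - \<kappa> * t\<^sup>2) - (\<Phi> s - \<kappa> * s\<^sup>2)"
    proof (rule f''_imp_f'[where C = "{a..b}" and f'' = "\<lambda>r. deriv A r - 2 * \<kappa>"])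
      fix r assume "r \<in> {a..b}"
      then have r: "0 < r" "r \<in> {a..b}" using assms by auto
      show "((\<lambda>r. \<Phi> r - \<kappa> * r\<^sup>2) has_real_derivative A r - 2 * \<kappa> * r) (at r)"
        by (rule derivative_eq_intros Phi_deriv r refl | simp)+
      show "((\<lambda>r. A r - 2 * \<kappa> * r) has_real_derivative deriv A r - 2 * \<kappa>) (at r)"
        by (rule derivative_eq_intros A_deriv r refl | simp)+
      show "0 \<le> deriv A r - 2 * \<kappa>" using x(2)[OF r(2)] \<kappa> by simp
    qed (use st in auto)
    then show ?thesis by (simp add: algebra_simps power2_eq_square)
  qed
  show ?thesis
  proof (rule that[OF \<kappa>(1)])
    fix v w :: 'a assume v: "norm v \<in> {a..b}" and w: "norm w \<in> {a..b}"
    define s t where "s = norm w" and "t = norm v"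
    have st: "0 < s" "s \<le> b" "a \<le> s" "0 < t" using v w assms by (auto simp: s_def t_def)
    have "2 * \<kappa> * s \<le> 2 * \<kappa> * b" using st \<kappa> by simp
    also have "\<dots> \<le> A s" using \<kappa> A_mono[of a s] st assms by simp
    finally have "2 * \<kappa> \<le> \<phi> s" using st by (simp add: A_def field_simps)
    moreover have "w \<bullet> v \<le> s * t" unfolding s_def t_def by (rule norm_cauchy_schwarz)
    ultimately have "2 * \<kappa> * (s * t - w \<bullet> v) \<le> \<phi> s * (s * t - w \<bullet> v)"
      by (intro mult_right_mono) auto
    moreover have "\<kappa> * (norm (v - w))\<^sup>2 = \<kappa> * (t - s)\<^sup>2 + 2 * \<kappa> * (s * t - w \<bullet> v)"
    proof -
      have "(norm (v - w))\<^sup>2 = (t - s)\<^sup>2 + 2 * (s * t - w \<bullet> v)"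
      proof -
        have "(norm (v - w))\<^sup>2 = v \<bullet> v - 2 * (w \<bullet> v) + w \<bullet> w"
          by (simp add: power2_norm_eq_inner inner_diff inner_commute algebra_simps)
        then show ?thesis by (simp add: s_def t_def power2_diff dot_square_norm)
      qed
      then show ?thesis by (simp only: distrib_left mult.assoc mult.left_commute)
    qed
    moreover have "momentum w \<bullet> (v - w) = A s * (t - s) - \<phi> s * (s * t - w \<bullet> v)"
      by (simp add: momentum_def inner_diff_right s_def t_def A_def algebra_simps
          dot_square_norm power2_eq_square)
    ultimately show "\<Phi> (norm w) + momentum w \<bullet> (v - w) + \<kappa> * (norm (v - w))\<^sup>2 \<le> \<Phi> (norm v)"
      using scalar[OF w v] unfolding s_def t_def by linarith
  qed
qed

end

section \<open>Smooth cut-off functions\<close>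

text \<open>\<open>flat 0\<close> is the classical smooth function \<open>exp (- inverse t)\<close>
  extended by 0. The extra powers make the span of the family closed under differentiation.\<close>

definition flat :: "nat \<Rightarrow> real \<Rightarrow> real" where
  "flat k t = (if t \<le> 0 then 0 else inverse t ^ k * exp (- inverse t))"

lemma flat_tendsto_0: "(flat k \<longlongrightarrow> 0) (at_right 0)"
proof -
  have "((\<lambda>t. inverse t ^ k / exp (inverse t)) \<longlongrightarrow> 0) (at_right (0::real))"
    by (rule filterlim_compose[OF tendsto_power_div_exp_0 filterlim_inverse_at_top_right])
  then show ?thesis
    by (rule Lim_transform_eventually)
       (auto simp: eventually_at_filter flat_def exp_minus field_simps)
qed

lemma flat_deriv: "(flat k has_real_derivative flat (k + 2) t - k * flat (k + 1) t) (at t)"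
proof (cases t "0::real" rule: linorder_cases)
  case less
  have "((\<lambda>t. 0) has_real_derivative 0) (at t)" by simp
  then have "(flat k has_real_derivative 0) (at t)"
    by (rule has_field_derivative_transform_within[where d="-t"])
       (use less in \<open>auto simp: flat_def dist_real_def\<close>)
  then show ?thesis using less by (simp add: flat_def)
next
  case greater
  have "((\<lambda>t. inverse t ^ k) has_real_derivative - (real k * inverse t ^ (k + 1))) (at t)"
    using DERIV_power[OF DERIV_inverse[of t], of k] greater
    by (cases k) (auto simp: algebra_simps)
  moreover have "((\<lambda>t. exp (- inverse t)) has_real_derivative exp (- inverse t) * inverse t ^ 2) (at t)"
    using greater by (auto intro!: derivative_eq_intros simp: power2_eq_square)
  ultimately have "((\<lambda>t. inverse t ^ k * exp (- inverse t)) has_real_derivative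
      - (real k * inverse t ^ (k + 1)) * exp (- inverse t) + exp (- inverse t) * inverse t ^ 2 * inverse t ^ k) (at t)"
    by (rule DERIV_mult)
  moreover have "- (real k * inverse t ^ (k + 1)) * exp (- inverse t) + exp (- inverse t) * inverse t ^ 2 * inverse t ^ k
      = flat (k + 2) t - k * flat (k + 1) t"
    using greater by (simp add: flat_def power_add power2_eq_square)
  ultimately have "((\<lambda>t. inverse t ^ k * exp (- inverse t)) has_real_derivative
      flat (k + 2) t - k * flat (k + 1) t) (at t)"
    by simp
  then show ?thesis
    by (rule has_field_derivative_transform_within[where d=t])
       (use greater in \<open>auto simp: flat_def dist_real_def\<close>)
next
  case equal
  have "((\<lambda>h. flat k h / h) \<longlongrightarrow> 0) (at 0)"
  proof (rule filterlim_split_at)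
    show "((\<lambda>h. flat k h / h) \<longlongrightarrow> 0) (at_left 0)"
      by (rule Lim_transform_eventually[OF tendsto_const]) (auto simp: eventually_at_filter flat_def)
    \<comment> \<open>To the right of 0 the difference quotient of \<open>flat k\<close> is
      \<open>flat (Suc k)\<close> itself.\<close>
    show "((\<lambda>h. flat k h / h) \<longlongrightarrow> 0) (at_right 0)"
      by (rule Lim_transform_eventually[OF flat_tendsto_0[of "Suc k"]])
         (auto simp: eventually_at_filter flat_def field_simps)
  qed
  then show ?thesis
    using equal by (simp add: DERIV_def flat_def)
qed

text \<open>An algebra of functions that is closed under differentiation, so that smoothness of the cut-off
  functions needs no computation of higher derivatives.\<close>

inductive_set smooth_alg :: "(real \<Rightarrow> real) set" where
  flat: "flat k \<in> smooth_alg"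
| const: "(\<lambda>_. c) \<in> smooth_alg"
| add: "f \<in> smooth_alg \<Longrightarrow> g \<in> smooth_alg \<Longrightarrow> (\<lambda>t. f t + g t) \<in> smooth_alg"
| mult: "f \<in> smooth_alg \<Longrightarrow> g \<in> smooth_alg \<Longrightarrow> (\<lambda>t. f t * g t) \<in> smooth_alg"
| affine: "f \<in> smooth_alg \<Longrightarrow> (\<lambda>t. f (a * t + b)) \<in> smooth_alg"

lemma smooth_alg_derivative:
  "f \<in> smooth_alg \<Longrightarrow> \<exists>f'\<in>smooth_alg. \<forall>t. (f has_real_derivative f' t) (at t)"
proof (induction rule: smooth_alg.induct)
  case (flat k)
  show ?case
  proof (rule bexI[of _ "\<lambda>t. flat (k + 2) t + (- real k) * flat (k + 1) t"])
    show "\<forall>t. (Submission.flat k has_real_derivative Submission.flat (k + 2) t + - real k * Submission.flat (k + 1) t) (at t)"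
      using flat_deriv[of k] by simp
  qed (intro smooth_alg.intros)
next
  case (const c)
  show ?case by (rule bexI[of _ "\<lambda>_. 0"]) (auto intro: smooth_alg.intros)
next
  case (add f g)
  then obtain f' g' where "f' \<in> smooth_alg" "\<forall>t. (f has_real_derivative f' t) (at t)"
    "g' \<in> smooth_alg" "\<forall>t. (g has_real_derivative g' t) (at t)" by blast
  then show ?case
    by (intro bexI[of _ "\<lambda>t. f' t + g' t"]) (auto intro!: derivative_intros smooth_alg.intros)
next
  case (mult f g)
  then obtain f' g' where *: "f' \<in> smooth_alg" "\<And>t. (f has_real_derivative f' t) (at t)"
    "g' \<in> smooth_alg" "\<And>t. (g has_real_derivative g' t) (at t)" by blast
  show ?case
  proof (rule bexI[of _ "\<lambda>t. f' t * g t + g' t * f t"])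
    show "\<forall>t. ((\<lambda>t. f t * g t) has_real_derivative f' t * g t + g' t * f t) (at t)"
      using DERIV_mult[OF *(2,4)] by blast
  qed (use * mult in \<open>auto intro!: smooth_alg.intros\<close>)
next
  case (affine f a b)
  then obtain f' where *: "f' \<in> smooth_alg" "\<And>t. (f has_real_derivative f' t) (at t)" by blast
  have "((\<lambda>t. f (a * t + b)) has_real_derivative f' (a * t + b) * a) (at t)" for t
    by (rule DERIV_chain'[OF _ *(2)]) (auto intro!: derivative_eq_intros)
  then show ?case
    by (intro bexI[of _ "\<lambda>t. f' (a * t + b) * a"]) (auto intro!: smooth_alg.intros *)
qed

lemma smooth_alg_funpow_deriv: "f \<in> smooth_alg \<Longrightarrow> (deriv ^^ k) f \<in> smooth_alg"
proof (induction k)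
  case (Suc k)
  then obtain f' where "f' \<in> smooth_alg" "\<forall>t. ((deriv ^^ k) f has_real_derivative f' t) (at t)"
    using smooth_alg_derivative by blast
  then have "deriv ((deriv ^^ k) f) = f'" by (auto intro: DERIV_imp_deriv)
  then show ?case using \<open>f' \<in> smooth_alg\<close> by simp
qed simp

lemma smooth_alg_differentiable: "f \<in> smooth_alg \<Longrightarrow> f differentiable_on UNIV"
  using smooth_alg_derivative[of f]
  by (auto simp: differentiable_on_def real_differentiable_def)

lemma smooth_alg_continuous: "f \<in> smooth_alg \<Longrightarrow> continuous_on S f"
  using smooth_alg_differentiable differentiable_imp_continuous_on continuous_on_subset by blast

text \<open>An antiderivative of a member of the algebra, such as the step function below, need not
  lie in the algebra; its smoothness is inherited from its derivative.\<close>

lemma smooth_if_derivative_smooth_alg: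
  assumes "\<And>t. (f has_real_derivative f' t) (at t)" "f' \<in> smooth_alg"
  shows "(deriv ^^ k) f differentiable_on UNIV"
proof (cases k)
  case 0
  then show ?thesis using assms(1) by (auto simp: differentiable_on_def real_differentiable_def)
next
  case (Suc n)
  have "deriv f = f'" using assms(1) by (auto intro: DERIV_imp_deriv)
  then have "(deriv ^^ k) f = (deriv ^^ n) f'" by (simp add: Suc funpow_Suc_right del: funpow.simps)
  then show ?thesis by (simp add: smooth_alg_funpow_deriv smooth_alg_differentiable assms(2))
qed

text \<open>\<open>H\<close> is the normalised primitive of a bump supported in the unit interval.
  Both \<open>H\<close> and its derivative \<open>h\<close> are handed out, since \<open>H\<close>
  builds test functions and \<open>h\<close> serves as a mollifier.\<close>

lemma smooth_step:
  obtains H h where "h \<in> smooth_alg" "\<And>t. (H has_real_derivative h t) (at t)"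
    "\<And>t. t \<le> 0 \<Longrightarrow> H t = 0" "\<And>t. t \<ge> 1 \<Longrightarrow> H t = (1::real)" "\<And>t. 0 \<le> h t"
    "\<And>t. t \<notin> {0..1} \<Longrightarrow> h t = 0" "\<And>t. H t \<in> {0..1}"
proof -
  define B where "B t = flat 0 t * flat 0 (-1 * t + 1)" for t
  have B: "B \<in> smooth_alg" unfolding B_def[abs_def] by (intro smooth_alg.intros)
  have B_nonneg: "0 \<le> B t" for t by (auto simp: B_def flat_def)
  have B_0: "B t = 0" if "t \<notin> {0<..<1}" for t using that by (auto simp: B_def flat_def)
  define c where "c = integral {0..1} B"
  have "c \<noteq> 0"
  proof
    assume "c = 0"
    have "(B has_integral 0) {0..1}"
      using integrable_integral[OF integrable_continuous_interval[OF smooth_alg_continuous[OF B]], of 0 1]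
      by (simp add: \<open>c = 0\<close> flip: c_def)
    then have "B (1/2) = 0"
      using has_integral_0_cbox_imp_0[of 0 1 B "1/2"] smooth_alg_continuous[OF B] B_nonneg by auto
    then show False by (simp add: B_def flat_def)
  qed
  moreover have "c \<ge> 0" unfolding c_def by (rule integral_nonneg)
      (auto simp: B_nonneg intro!: integrable_continuous_interval smooth_alg_continuous B)
  ultimately have c: "c > 0" by simp
  \<comment> \<open>Starting at -1 instead of 0 makes every \<open>t > -1\<close> an interior point
    for the fundamental theorem; around smaller \<open>t\<close> the function vanishes.\<close>
  define F where "F t = integral {-1..t} B" for t
  have F_0: "F t = 0" if "t \<le> 0" for t
  proof -
    have "integral {-1..t} B = integral {-1..t} (\<lambda>_. 0)"
      by (rule integral_cong) (use that B_0 in auto)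
    then show ?thesis by (simp add: F_def)
  qed
  have F_deriv: "(F has_real_derivative B t) (at t)" for t
  proof (cases "t > -1")
    case True
    have "(F has_real_derivative B t) (at t within {-1..t+1})"
      unfolding F_def[abs_def] using True
      by (intro integral_has_real_derivative smooth_alg_continuous B) auto
    then show ?thesis using True at_within_interior[of t "{-1..t+1}"] by simp
  next
    case False
    have "((\<lambda>_. 0) has_real_derivative B t) (at t)" using False B_0[of t] by simp
    then show ?thesis
      by (rule has_field_derivative_transform_within[where d=1])
         (use False F_0 in \<open>auto simp: dist_real_def\<close>)
  qed
  have F_split: "F t = c + integral {1..t} B" if "t \<ge> 1" for t
  proof -
    have "F t = integral {-1..0} B + integral {0..t} B"
      unfolding F_def using that
      by (intro Henstock_Kurzweil_Integration.integral_combine[symmetric] integrable_continuous_interval smooth_alg_continuous B) auto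
    also have "integral {0..t} B = c + integral {1..t} B"
      unfolding c_def using that
      by (intro Henstock_Kurzweil_Integration.integral_combine[symmetric] integrable_continuous_interval smooth_alg_continuous B) auto
    finally show ?thesis using F_0[of 0] by (simp add: F_def)
  qed
  have F_1: "F t = c" if "t \<ge> 1" for t
  proof -
    have "integral {1..t} B = integral {1..t} (\<lambda>_. 0)"
      by (rule integral_cong) (use that B_0 in auto)
    then show ?thesis using F_split[OF that] by simp
  qed
  have F_mono: "F s \<le> F t" if "s \<le> t" for s t
    by (rule DERIV_nonneg_imp_nondecreasing[OF that]) (use F_deriv B_nonneg in blast)
  show ?thesis
  proof (rule that[of "\<lambda>t. B t * (1 / c)" "\<lambda>t. F t / c"])
    show "(\<lambda>t. B t * (1 / c)) \<in> smooth_alg" by (intro smooth_alg.intros B)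
    show "((\<lambda>t. F t / c) has_real_derivative B t * (1 / c)) (at t)" for t
      using DERIV_cdivide[OF F_deriv] by simp
    show "F t / c \<in> {0..1}" for t
      using F_mono[of "min 0 t" t] F_mono[of t "max 1 t"] F_0[of "min 0 t"] F_1[of "max 1 t"] c by simp
  qed (use c F_0 F_1 B_nonneg B_0 in auto)
qed

section \<open>Weak derivatives\<close>

text \<open>For open \<open>I\<close> and continuous \<open>q\<close> this is equivalent to \<open>p\<close> being the weak derivative of \<open>q\<close>.\<close>

definition prim :: "real set \<Rightarrow> (real \<Rightarrow> 'a::euclidean_space) \<Rightarrow> (real \<Rightarrow> 'a) \<Rightarrow> bool" where
  "prim I q p \<longleftrightarrow> (\<forall>a b. a \<le> b \<and> {a..b} \<subseteq> I \<longrightarrow>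
     p absolutely_integrable_on {a..b} \<and> integral {a..b} p = q b - q a)"

lemma primD:
  assumes "prim I q p" "a \<le> b" "{a..b} \<subseteq> I"
  shows "p absolutely_integrable_on {a..b}" "p integrable_on {a..b}" "integral {a..b} p = q b - q a"
    "(p has_integral q b - q a) {a..b}"
  using assms unfolding prim_def
  by (auto intro: set_lebesgue_integral_eq_integral(1) simp: has_integral_iff)

lemma prim_subset: "prim I q p \<Longrightarrow> J \<subseteq> I \<Longrightarrow> prim J q p"
  unfolding prim_def by blast

lemma prim_continuous_on:
  assumes "prim I q p" "a \<le> b" "{a..b} \<subseteq> I"
  shows "continuous_on {a..b} q"
proof -
  have "continuous_on {a..b} (\<lambda>t. q a + integral {a..t} p)"
    by (intro continuous_intros indefinite_integral_continuous_1 primD(2)[OF assms])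
  moreover have "q a + integral {a..t} p = q t" if "t \<in> {a..b}" for t
  proof -
    have "{a..t} \<subseteq> I" using that assms(3) by auto
    then show ?thesis using primD(3)[OF assms(1), of a t] that by simp
  qed
  ultimately show ?thesis by (rule continuous_on_eq)
qed

lemma prim_continuous_on_UNIV:
  assumes "prim UNIV q p" shows "continuous_on UNIV q"
proof (intro continuous_at_imp_continuous_on ballI)
  fix t :: real
  have "continuous_on {t-1..t+1} q" by (rule prim_continuous_on[OF assms]) auto
  then show "isCont q t" by (rule continuous_on_interior) auto
qed

lemma prim_of_C1:
  assumes "\<And>t. t \<in> I \<Longrightarrow> (q has_vector_derivative p t) (at t within I)" "continuous_on I p"
  shows "prim I q p"
  unfolding prim_def
proof (intro allI impI)
  fix a b assume ab: "a \<le> b \<and> {a..b} \<subseteq> I"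
  have "p absolutely_integrable_on {a..b}"
    using ab assms(2) continuous_on_subset
    by (intro absolutely_integrable_continuous_real) blast
  moreover have "(p has_integral q b - q a) {a..b}"
    using ab assms(1) has_vector_derivative_within_subset
    by (intro fundamental_theorem_of_calculus) blast+
  ultimately show "p absolutely_integrable_on {a..b} \<and> integral {a..b} p = q b - q a"
    by (simp add: has_integral_iff)
qed

section \<open>Integration by parts against test functions\<close>

lemma absolutely_integrable_scaleR_left:
  fixes \<psi> :: "real \<Rightarrow> real" and p :: "real \<Rightarrow> 'a::euclidean_space"
  assumes "p absolutely_integrable_on {a..b}" "continuous_on {a..b} \<psi>"
  shows "(\<lambda>t. \<psi> t *\<^sub>R p t) absolutely_integrable_on {a..b}"
proof (rule absolutely_integrable_bounded_measurable_product[where h = "(*\<^sub>R)" and f = \<psi>])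
  show "bilinear ((*\<^sub>R) :: real \<Rightarrow> 'a \<Rightarrow> 'a)"
    by (simp add: bilinear_conv_bounded_bilinear bounded_bilinear_scaleR)
  show "\<psi> \<in> borel_measurable (lebesgue_on {a..b})"
    by (rule continuous_imp_measurable_on_sets_lebesgue[OF assms(2)]) simp
  show "bounded (\<psi> ` {a..b})"
    by (intro compact_imp_bounded compact_continuous_image assms(2)) simp
qed (use assms(1) in auto)

text \<open>The error of the product rule on a short interval is small compared with the integral of
  \<open>\<bar>\<psi>'\<bar> + norm p\<close>, so it sums up to zero.\<close>

lemma prim_integration_by_parts:
  fixes q p :: "real \<Rightarrow> 'a::euclidean_space" and \<psi> \<psi>' :: "real \<Rightarrow> real"
  assumes "prim {a..b} q p" "prim {a..b} \<psi> \<psi>'" "a \<le> b"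
    and "continuous_on {a..b} \<psi>'"
  shows "integral {a..b} (\<lambda>t. \<psi>' t *\<^sub>R q t + \<psi> t *\<^sub>R p t) = \<psi> b *\<^sub>R q b - \<psi> a *\<^sub>R q a"
proof -
  define f where "f t = \<psi>' t *\<^sub>R q t + \<psi> t *\<^sub>R p t" for t
  define M where "M t = \<bar>\<psi>' t\<bar> + norm (p t)" for t
  have q: "continuous_on {a..b} q" and \<psi>: "continuous_on {a..b} \<psi>"
    using prim_continuous_on assms(1-3) by blast+
  have p: "p absolutely_integrable_on {a..b}" by (rule primD(1)[OF assms(1,3)]) simp
  have f: "f integrable_on {a..b}"
    unfolding f_def[abs_def]
    by (intro integrable_add integrable_continuous_interval continuous_intros assms q
        set_lebesgue_integral_eq_integral(1) absolutely_integrable_scaleR_left p \<psi>)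
  have M: "M integrable_on {a..b}"
    unfolding M_def[abs_def]
    by (intro integrable_add integrable_continuous_interval continuous_intros assms
        set_lebesgue_integral_eq_integral(1) absolutely_integrable_norm[OF p, unfolded o_def])
  define E where "E u v = norm (\<psi> v *\<^sub>R q v - \<psi> u *\<^sub>R q u - integral {u..v} f)" for u v
  have "E a b \<le> e * integral {a..b} M" if "e > 0" for e
  proof -
    \<comment> \<open>Bisection: the estimate is additive over adjacent intervals and holds on all
      short ones, hence on \<open>{a..b}\<close>.\<close>
    define P where "P u v \<longleftrightarrow> a \<le> u \<and> v \<le> b \<longrightarrow> E u v \<le> e * integral {u..v} M" for u v
    have "P a b"
    proof (rule Bolzano[OF \<open>a \<le> b\<close>, where P=P])
      fix u v w assume uvw: "P u v" "P v w" "u \<le> v" "v \<le> w"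
      show "P u w"
        unfolding P_def
      proof
        assume uw: "a \<le> u \<and> w \<le> b"
        have "f integrable_on {u..w}" "M integrable_on {u..w}"
          by (rule integrable_subinterval_real[OF f] integrable_subinterval_real[OF M], use uw in simp)+
        then have "integral {u..w} f = integral {u..v} f + integral {v..w} f"
          "integral {u..w} M = integral {u..v} M + integral {v..w} M"
          using uvw by (simp_all add: Henstock_Kurzweil_Integration.integral_combine)
        moreover have "E u v \<le> e * integral {u..v} M" "E v w \<le> e * integral {v..w} M"
          using uvw uw by (auto simp: P_def)
        moreover have "E u w \<le> E u v + E v w" if "integral {u..w} f = integral {u..v} f + integral {v..w} f"
          unfolding E_def that
          using norm_triangle_ineq[of "\<psi> v *\<^sub>R q v - \<psi> u *\<^sub>R q u - integral {u..v} f"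
              "\<psi> w *\<^sub>R q w - \<psi> v *\<^sub>R q v - integral {v..w} f"] by (simp add: algebra_simps)
        ultimately show "E u w \<le> e * integral {u..w} M" by (simp add: distrib_left)
      qed
    next
      fix x
      have "uniformly_continuous_on {a..b} q" "uniformly_continuous_on {a..b} \<psi>"
        by (intro compact_uniformly_continuous q \<psi> compact_Icc)+
      then obtain d1 d2 where d: "d1 > 0" "d2 > 0"
        "\<And>s t. s \<in> {a..b} \<Longrightarrow> t \<in> {a..b} \<Longrightarrow> dist s t < d1 \<Longrightarrow> dist (q s) (q t) < e"
        "\<And>s t. s \<in> {a..b} \<Longrightarrow> t \<in> {a..b} \<Longrightarrow> dist s t < d2 \<Longrightarrow> dist (\<psi> s) (\<psi> t) < e"
        unfolding uniformly_continuous_on_def using \<open>e > 0\<close> by metis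
      show "\<exists>d>0. \<forall>u v. u \<le> x \<and> x \<le> v \<and> v - u < d \<longrightarrow> P u v"
      proof (intro exI[of _ "min d1 d2"] conjI allI impI)
        fix u v assume uv: "u \<le> x \<and> x \<le> v \<and> v - u < min d1 d2"
        show "P u v"
          unfolding P_def
        proof
          assume uv': "a \<le> u \<and> v \<le> b"
          have sub: "{u..v} \<subseteq> {a..b}" using uv' by auto
          have i: "p integrable_on {u..v}" "\<psi>' integrable_on {u..v}" "f integrable_on {u..v}" "M integrable_on {u..v}"
            using primD(2)[OF assms(1) _ sub] primD(2)[OF assms(2) _ sub] uv
              integrable_on_subinterval[OF f sub] integrable_on_subinterval[OF M sub] by auto
          have "\<psi> v *\<^sub>R q v - \<psi> u *\<^sub>R q u = \<psi> v *\<^sub>R (q v - q u) + (\<psi> v - \<psi> u) *\<^sub>R q u"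
            by (simp add: algebra_simps)
          also have "\<dots> = \<psi> v *\<^sub>R integral {u..v} p + integral {u..v} \<psi>' *\<^sub>R q u"
            using primD(3)[OF assms(1) _ sub] primD(3)[OF assms(2) _ sub] uv by simp
          also have "\<dots> = integral {u..v} (\<lambda>t. \<psi> v *\<^sub>R p t + \<psi>' t *\<^sub>R q u)"
            using i integral_unique[OF has_integral_scaleR_left[OF integrable_integral[OF i(2)], of "q u"]]
            by (simp add: integral_add integrable_cmul integrable_on_scaleR_left)
          finally have "\<psi> v *\<^sub>R q v - \<psi> u *\<^sub>R q u - integral {u..v} f
              = integral {u..v} (\<lambda>t. (\<psi> v *\<^sub>R p t + \<psi>' t *\<^sub>R q u) - f t)"
            using i by (simp add: integral_diff integrable_add integrable_cmul integrable_on_scaleR_left)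
          moreover have "norm (integral {u..v} (\<lambda>t. (\<psi> v *\<^sub>R p t + \<psi>' t *\<^sub>R q u) - f t))
              \<le> integral {u..v} (\<lambda>t. e * M t)"
          proof (rule integral_norm_bound_integral)
            show "(\<lambda>t. (\<psi> v *\<^sub>R p t + \<psi>' t *\<^sub>R q u) - f t) integrable_on {u..v}"
              using i by (intro integrable_diff integrable_add integrable_cmul integrable_on_scaleR_left)
            show "(\<lambda>t. e * M t) integrable_on {u..v}" using i integrable_cmul[OF i(4), of e] by simp
            fix t assume t: "t \<in> {u..v}"
            have "dist (q u) (q t) < e" "dist (\<psi> v) (\<psi> t) < e"
              by (rule d; use t uv sub in \<open>auto simp: dist_real_def\<close>)+
            then have "norm ((\<psi> v - \<psi> t) *\<^sub>R p t) \<le> e * norm (p t)"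
              "norm (\<psi>' t *\<^sub>R (q u - q t)) \<le> \<bar>\<psi>' t\<bar> * e"
              by (simp_all add: dist_norm mult_right_mono mult_left_mono)
            moreover have "(\<psi> v *\<^sub>R p t + \<psi>' t *\<^sub>R q u) - f t
                = (\<psi> v - \<psi> t) *\<^sub>R p t + \<psi>' t *\<^sub>R (q u - q t)"
              by (simp add: f_def algebra_simps)
            ultimately show "norm ((\<psi> v *\<^sub>R p t + \<psi>' t *\<^sub>R q u) - f t) \<le> e * M t"
              unfolding M_def using norm_triangle_ineq[of "(\<psi> v - \<psi> t) *\<^sub>R p t" "\<psi>' t *\<^sub>R (q u - q t)"]
              by (simp add: distrib_left mult.commute)
          qed
          ultimately show "E u v \<le> e * integral {u..v} M"
            unfolding E_def by simp
        qed
      qed (use d in auto)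
    qed
    then show ?thesis by (simp add: P_def)
  qed
  then have "E a b \<le> 0 + e" if "e > 0" for e
  proof -
    have "0 \<le> integral {a..b} M" by (rule integral_nonneg[OF M]) (simp add: M_def)
    then have "e / (integral {a..b} M + 1) * integral {a..b} M \<le> e"
      using that by (simp add: field_simps)
    then show ?thesis
      using \<open>\<And>e. e > 0 \<Longrightarrow> E a b \<le> e * integral {a..b} M\<close>[of "e / (integral {a..b} M + 1)"]
        that \<open>0 \<le> integral {a..b} M\<close> by fastforce
  qed
  then have "E a b \<le> 0" by (rule field_le_epsilon)
  then show ?thesis by (simp add: E_def f_def[abs_def])
qed

lemma LINT_supported:
  fixes f :: "real \<Rightarrow> 'a::euclidean_space"
  assumes "f absolutely_integrable_on {a..b}" "{a..b} \<subseteq> I" "\<And>t. t \<notin> {a..b} \<Longrightarrow> f t = 0"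
  shows "(LINT t:I|lebesgue. f t) = integral {a..b} f"
proof -
  have "(\<lambda>t. indicat_real I t *\<^sub>R f t) = (\<lambda>t. indicat_real {a..b} t *\<^sub>R f t)"
  proof
    fix t show "indicat_real I t *\<^sub>R f t = indicat_real {a..b} t *\<^sub>R f t"
      using assms(2) assms(3)[of t] by (cases "t \<in> {a..b}") (auto simp: indicator_def)
  qed
  then have "(LINT t:I|lebesgue. f t) = (LINT t:{a..b}|lebesgue. f t)"
    by (simp add: set_lebesgue_integral_def)
  then show ?thesis using set_lebesgue_integral_eq_integral(2)[OF assms(1)] by simp
qed

lemma test_function_derivative:
  assumes "\<psi> \<in> test_functions U"
  shows "(\<psi> has_real_derivative deriv \<psi> t) (at t)" "continuous_on S (deriv \<psi>)"
    "t \<notin> closure {t. \<psi> t \<noteq> 0} \<Longrightarrow> deriv \<psi> t = 0"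
proof -
  have 0: "(deriv ^^ 0) \<psi> differentiable_on UNIV" and 1: "(deriv ^^ 1) \<psi> differentiable_on UNIV"
    using assms unfolding test_functions_def by blast+
  show "(\<psi> has_real_derivative deriv \<psi> t) (at t)"
    using 0 by (auto simp: differentiable_on_def DERIV_deriv_iff_real_differentiable)
  show "continuous_on S (deriv \<psi>)"
    using 1 differentiable_imp_continuous_on continuous_on_subset by fastforce
  assume t: "t \<notin> closure {t. \<psi> t \<noteq> 0}"
  have "((\<lambda>_. 0) has_real_derivative 0) (at t)" by simp
  then have "(\<psi> has_real_derivative 0) (at t)"
    by (rule has_field_derivative_transform_within_open[where S="- closure {t. \<psi> t \<noteq> 0}"])
       (use t closure_subset in force)+
  then show "deriv \<psi> t = 0" by (rule DERIV_imp_deriv)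
qed

lemma interval_cover:
  fixes I :: "real set"
  assumes "is_interval I" "compact K" "K \<subseteq> I" "K \<noteq> {}"
  shows "Inf K \<le> Sup K" "{Inf K..Sup K} \<subseteq> I" "K \<subseteq> {Inf K..Sup K}"
proof -
  have *: "Inf K \<in> K" "Sup K \<in> K" "bdd_above K" "bdd_below K"
    using closed_contains_Inf[of K] closed_contains_Sup[of K] compact_imp_closed[OF assms(2)] assms(4)
      compact_imp_bounded[OF assms(2), THEN bounded_imp_bdd_above]
      compact_imp_bounded[OF assms(2), THEN bounded_imp_bdd_below] by auto
  then show "Inf K \<le> Sup K" "K \<subseteq> {Inf K..Sup K}" by (auto intro: cInf_lower cSup_upper)
  show "{Inf K..Sup K} \<subseteq> I"
  proof
    fix t assume "t \<in> {Inf K..Sup K}"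
    moreover have "Inf K \<in> I" "Sup K \<in> I" using * assms by auto
    ultimately show "t \<in> I" using mem_is_interval_1_I[OF assms(1), of "Inf K" "Sup K" t] by simp
  qed
qed

lemma prim_imp_L1_loc:
  fixes q p :: "real \<Rightarrow> 'a::euclidean_space"
  assumes "prim I q p" "is_interval I"
  shows "L1_loc I q" "L1_loc I p"
proof -
  have "q absolutely_integrable_on K \<and> p absolutely_integrable_on K" if "compact K" "K \<subseteq> I" for K
  proof (cases "K = {}")
    case False
    note ic = interval_cover[OF assms(2) that False]
    have "q absolutely_integrable_on {Inf K..Sup K}" "p absolutely_integrable_on {Inf K..Sup K}"
      using primD(1)[OF assms(1) ic(1,2)] prim_continuous_on[OF assms(1) ic(1,2)]
      by (auto intro: absolutely_integrable_continuous_real)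
    then show ?thesis
      using set_integrable_subset ic(3) lmeasurable_compact[OF that(1)] by (metis fmeasurableD)
  qed auto
  then show "L1_loc I q" "L1_loc I p" by (auto simp: L1_loc_def)
qed

lemma prim_imp_weak_derivative:
  fixes q p :: "real \<Rightarrow> 'a::euclidean_space"
  assumes "prim I q p" "is_interval I"
  shows "has_weak_derivative I q p"
  unfolding has_weak_derivative_def
proof (intro conjI ballI prim_imp_L1_loc[OF assms])
  fix \<psi> assume \<psi>: "\<psi> \<in> test_functions (interior I)"
  note d = test_function_derivative[OF \<psi>]
  define K where "K = closure {t. \<psi> t \<noteq> 0}"
  have K: "compact K" "K \<subseteq> interior I" using \<psi> by (auto simp: test_functions_def K_def)
  have K0: "\<psi> t = 0" "deriv \<psi> t = 0" if "t \<notin> K" for t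
    using that d(3)[of t] closure_subset[of "{t. \<psi> t \<noteq> 0}"] by (auto simp: K_def)
  show "(LINT t:I|lebesgue. deriv \<psi> t *\<^sub>R q t) = - (LINT t:I|lebesgue. \<psi> t *\<^sub>R p t)"
  proof (cases "K = {}")
    case True
    then show ?thesis using K0 by (simp add: set_lebesgue_integral_def)
  next
    case False
    have "is_interval (interior I)"
      using assms(2) by (simp add: is_interval_convex_1 convex_interior)
    note ic = interval_cover[OF this K False]
    have "Inf K \<in> interior I" "Sup K \<in> interior I" using ic(1,2) by auto
    then obtain e1 e2 where e: "e1 > 0" "e2 > 0" "ball (Inf K) e1 \<subseteq> I" "ball (Sup K) e2 \<subseteq> I"
      using mem_interior by metis
    \<comment> \<open>The half radii push \<open>a\<close> and \<open>b\<close> strictly beyond the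
      support while keeping them in \<open>I\<close>, so the boundary terms vanish.\<close>
    define a b where "a = Inf K - e1 / 2" and "b = Sup K + e2 / 2"
    have "a \<in> ball (Inf K) e1" "b \<in> ball (Sup K) e2"
      using e by (auto simp: a_def b_def dist_real_def)
    then have "a \<in> I" "b \<in> I" using e by blast+
    then have ab: "{a..b} \<subseteq> I" using mem_is_interval_1_I[OF assms(2), of a b] by (simp add: subset_iff)
    have lt: "a < Inf K" "Sup K < b" "a \<le> b" using e ic(1) by (auto simp: a_def b_def)
    have Kab: "K \<subseteq> {a..b}" "a \<notin> K" "b \<notin> K" using ic(3) lt by force+
    note pr = prim_subset[OF assms(1) ab]
    have \<psi>c: "continuous_on {a..b} \<psi>"
      using d(1) by (auto intro!: continuous_at_imp_continuous_on DERIV_isCont)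
    have q: "(\<lambda>t. deriv \<psi> t *\<^sub>R q t) absolutely_integrable_on {a..b}"
      by (intro absolutely_integrable_scaleR_left absolutely_integrable_continuous_real d prim_continuous_on[OF pr] lt) auto
    have p: "(\<lambda>t. \<psi> t *\<^sub>R p t) absolutely_integrable_on {a..b}"
      by (intro absolutely_integrable_scaleR_left primD(1)[OF pr] lt \<psi>c) auto
    have "prim {a..b} \<psi> (deriv \<psi>)"
      using d(1,2) by (intro prim_of_C1)
        (auto intro: has_field_derivative_at_within simp flip: has_real_derivative_iff_has_vector_derivative)
    from prim_integration_by_parts[OF pr this lt(3) d(2)]
    have "integral {a..b} (\<lambda>t. deriv \<psi> t *\<^sub>R q t + \<psi> t *\<^sub>R p t) = 0"
      using K0 Kab by simp
    then have "integral {a..b} (\<lambda>t. deriv \<psi> t *\<^sub>R q t) = - integral {a..b} (\<lambda>t. \<psi> t *\<^sub>R p t)"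
      using set_lebesgue_integral_eq_integral(1)[OF q] set_lebesgue_integral_eq_integral(1)[OF p]
      by (simp add: integral_add eq_neg_iff_add_eq_0)
    moreover have "deriv \<psi> t *\<^sub>R q t = 0" "\<psi> t *\<^sub>R p t = 0" if "t \<notin> {a..b}" for t
    proof -
      have "t \<notin> K" using Kab that by blast
      then show "deriv \<psi> t *\<^sub>R q t = 0" "\<psi> t *\<^sub>R p t = 0" using K0 by simp_all
    qed
    ultimately show ?thesis
      using LINT_supported[OF q ab] LINT_supported[OF p ab] by presburger
  qed
qed

text \<open>The weight \<open>h (k * t + c) * k\<close> is the derivative of
  \<open>H (k * t + c)\<close>. It is therefore nonnegative with total mass 1 on
  \<open>{u..v}\<close>, and it lives where \<open>k * t + c\<close> lies in the unit
  interval.\<close>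

lemma mollifier_bound:
  fixes q :: "real \<Rightarrow> 'a::euclidean_space"
  assumes H: "h \<in> smooth_alg" "\<And>t. (H has_real_derivative h t) (at t)"
      "\<And>t. t \<le> 0 \<Longrightarrow> H t = 0" "\<And>t. t \<ge> 1 \<Longrightarrow> H t = 1" "\<And>t. 0 \<le> h t" "\<And>t. t \<notin> {0..1} \<Longrightarrow> h t = 0"
    and k: "k > 0" "k * u + c \<le> 0" "1 \<le> k * v + c" "u \<le> v"
    and q: "continuous_on {u..v} q" "\<And>t. t \<in> {u..v} \<Longrightarrow> k * t + c \<in> {0..1} \<Longrightarrow> norm (q t - y) \<le> \<eta>"
  shows "norm (integral {u..v} (\<lambda>t. (h (k * t + c) * k) *\<^sub>R q t) - y) \<le> \<eta>"
proof -
  define \<rho> where "\<rho> t = h (k * t + c) * k" for t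
  have \<rho>c: "continuous_on {u..v} \<rho>"
    unfolding \<rho>_def[abs_def]
    by (intro continuous_intros continuous_on_compose2[OF smooth_alg_continuous[OF H(1), of UNIV]]) auto
  have "((\<lambda>t. H (k * t + c)) has_real_derivative \<rho> t) (at t)" for t
    unfolding \<rho>_def by (rule DERIV_chain'[OF _ H(2)]) (auto intro!: derivative_eq_intros)
  then have "(\<rho> has_integral H (k * v + c) - H (k * u + c)) {u..v}"
    by (intro fundamental_theorem_of_calculus k)
       (auto intro: has_vector_derivative_at_within simp: has_real_derivative_iff_has_vector_derivative)
  then have \<rho>1: "(\<rho> has_integral 1) {u..v}" using H(3)[OF k(2)] H(4)[OF k(3)] by simp
  have iq: "(\<lambda>t. \<rho> t *\<^sub>R q t) integrable_on {u..v}"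
    by (intro integrable_continuous_interval continuous_intros \<rho>c q)
  have iy: "((\<lambda>t. \<rho> t *\<^sub>R y) has_integral y) {u..v}"
    using has_integral_scaleR_left[OF \<rho>1, of y] by simp
  have "integral {u..v} (\<lambda>t. \<rho> t *\<^sub>R q t) - y = integral {u..v} (\<lambda>t. \<rho> t *\<^sub>R q t - \<rho> t *\<^sub>R y)"
    using integral_diff[OF iq] iy by (auto simp: has_integral_iff)
  also have "norm \<dots> \<le> integral {u..v} (\<lambda>t. \<eta> * \<rho> t)"
  proof (rule integral_norm_bound_integral)
    show "(\<lambda>t. \<rho> t *\<^sub>R q t - \<rho> t *\<^sub>R y) integrable_on {u..v}"
      using iq iy by (auto intro: integrable_diff)
    show "(\<lambda>t. \<eta> * \<rho> t) integrable_on {u..v}"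
      by (intro integrable_continuous_interval continuous_intros \<rho>c)
    fix t assume t: "t \<in> {u..v}"
    show "norm (\<rho> t *\<^sub>R q t - \<rho> t *\<^sub>R y) \<le> \<eta> * \<rho> t"
    proof (cases "k * t + c \<in> {0..1}")
      case True
      have "\<rho> t \<ge> 0" using H(5) k by (simp add: \<rho>_def)
      then have "\<rho> t * norm (q t - y) \<le> \<rho> t * \<eta>" using q(2)[OF t True] by (intro mult_left_mono)
      then show ?thesis using \<open>\<rho> t \<ge> 0\<close> by (simp add: mult.commute flip: scaleR_diff_right)
    next
      case False
      then show ?thesis using H(6) by (simp add: \<rho>_def)
    qed
  qed
  also have "\<dots> = \<eta>" using has_integral_mult_right[OF \<rho>1, of \<eta>] by (auto simp: has_integral_iff)
  finally show ?thesis by (simp add: \<rho>_def)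
qed

text \<open>Plateau functions approximating the indicator of \<open>{a..b}\<close> serve as test
  functions. On the side of \<open>p\<close> dominated convergence yields the integral over
  \<open>{a..b}\<close>; on the side of \<open>q\<close> the derivative of the plateau averages
  \<open>q\<close> near \<open>a\<close> and near \<open>b\<close>, and continuity turns the
  averages into values.\<close>

lemma weak_derivative_imp_prim:
  fixes q p :: "real \<Rightarrow> 'a::euclidean_space"
  assumes "has_weak_derivative I q p" "continuous_on I q"
  shows "prim (interior I) q p"
  unfolding prim_def
proof (intro allI impI)
  fix a b assume ab: "a \<le> b \<and> {a..b} \<subseteq> interior I"
  have L1: "p absolutely_integrable_on K" if "compact K" "K \<subseteq> I" for K
    using assms(1) that by (auto simp: has_weak_derivative_def L1_loc_def)
  obtain e1 e2 where e: "e1 > 0" "e2 > 0" "ball a e1 \<subseteq> interior I" "ball b e2 \<subseteq> interior I"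
    using ab open_interior[of I] unfolding open_contains_ball by (metis atLeastAtMost_iff order_refl subsetD)
  define e0 where "e0 = min e1 e2 / 2"
  have e0: "e0 > 0" "e0 < e1" "e0 < e2" using e by (auto simp: e0_def min_def)
  define u v where "u = a - e0" and "v = b + e0"
  have J: "{u..v} \<subseteq> interior I"
  proof
    fix t assume t: "t \<in> {u..v}"
    consider "t \<in> {a..b}" | "t \<in> ball a e1" | "t \<in> ball b e2"
      using t e0 by (force simp: u_def v_def dist_real_def)
    then show "t \<in> interior I" using ab e by cases auto
  qed
  have JI: "{u..v} \<subseteq> I" using J interior_subset by blast
  have uv: "u < a" "b < v" "u \<le> v" using ab e0 by (auto simp: u_def v_def)
  have qc: "continuous_on {u..v} q" using assms(2) JI continuous_on_subset by blast
  have pa: "p absolutely_integrable_on {u..v}" by (rule L1[OF _ JI]) simp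
  obtain H h where H: "h \<in> smooth_alg" "\<And>t. (H has_real_derivative h t) (at t)"
    "\<And>t. t \<le> 0 \<Longrightarrow> H t = 0" "\<And>t. t \<ge> 1 \<Longrightarrow> H t = (1::real)" "\<And>t. 0 \<le> h t"
    "\<And>t. t \<notin> {0..1} \<Longrightarrow> h t = 0" "\<And>t. H t \<in> {0..1}"
    using smooth_step by metis
  define k where "k n = real (Suc n) / e0" for n
  have k: "k n > 0" "k n * e0 \<ge> 1" "1 / k n = e0 / Suc n" for n
    using e0 by (auto simp: k_def field_simps)
  \<comment> \<open>The plateau rises on the interval of length \<open>1 / k n\<close> that ends at
    \<open>a\<close> and falls on the one that starts at \<open>b\<close>; since
    \<open>1 / k n \<le> e0\<close>, its support stays in \<open>{u..v}\<close>.\<close>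
  define \<psi> where "\<psi> n t = H (k n * t + (1 - k n * a)) - H (k n * t + (- k n * b))" for n t
  define \<psi>' where "\<psi>' n t = h (k n * t + (1 - k n * a)) * k n + (- k n) * h (k n * t + (- k n * b))" for n t
  have d\<psi>: "(\<psi> n has_real_derivative \<psi>' n t) (at t)" for n t
  proof -
    have "((\<lambda>t. H (k n * t + c)) has_real_derivative h (k n * t + c) * k n) (at t)" for c
      by (rule DERIV_chain'[OF _ H(2)]) (auto intro!: derivative_eq_intros)
    from DERIV_diff[OF this[of "1 - k n * a"] this[of "- k n * b"]]
    show ?thesis unfolding \<psi>_def[abs_def] \<psi>'_def by (simp add: mult.commute)
  qed
  have \<psi>'_smooth: "\<psi>' n \<in> smooth_alg" for n
    unfolding \<psi>'_def[abs_def] by (intro smooth_alg.intros H(1))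
  note sm = smooth_if_derivative_smooth_alg[OF d\<psi> \<psi>'_smooth]
  have out: "\<psi> n t = 0 \<and> \<psi>' n t = 0" if t: "t \<notin> {u..v}" for n t
  proof -
    consider "t < u" | "t > v" using t by (metis atLeastAtMost_iff not_le)
    then show ?thesis
    proof cases
      case 1
      then have "k n * (t - a) < k n * (- e0)"
        by (intro mult_strict_left_mono k(1)) (simp add: u_def)
      moreover have "k n * (t - b) \<le> k n * (t - a)" by (intro mult_left_mono) (use ab k(1)[of n] in auto)
      ultimately show ?thesis
        using k(2)[of n] H(3) H(6) by (simp add: \<psi>_def \<psi>'_def algebra_simps)
    next
      case 2
      then have "k n * e0 < k n * (t - b)"
        by (intro mult_strict_left_mono k(1)) (simp add: v_def)
      moreover have "k n * (t - b) \<le> k n * (t - a)" by (intro mult_left_mono) (use ab k(1)[of n] in auto)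
      ultimately show ?thesis
        using k(2)[of n] H(4) H(6) by (simp add: \<psi>_def \<psi>'_def algebra_simps)
    qed
  qed
  have "{t. \<psi> n t \<noteq> 0} \<subseteq> {u..v}" for n using out by blast
  then have cl: "closure {t. \<psi> n t \<noteq> 0} \<subseteq> {u..v}" for n by (intro closure_minimal) auto
  then have "compact (closure {t. \<psi> n t \<noteq> 0})" for n
    by (meson bounded_closed_interval bounded_subset closed_closure compact_eq_bounded_closed)
  then have test: "\<psi> n \<in> test_functions (interior I)" for n
    unfolding test_functions_def using sm order_trans[OF cl J] by blast
  have deriv: "deriv (\<psi> n) = \<psi>' n" for n using d\<psi> by (auto intro: DERIV_imp_deriv)
  have \<psi>c: "continuous_on {u..v} (\<psi> n)" for n
    using d\<psi> by (auto intro!: continuous_at_imp_continuous_on DERIV_isCont)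
  have \<psi>'c: "continuous_on {u..v} (\<psi>' n)" for n
    by (rule smooth_alg_continuous[OF \<psi>'_smooth])
  have ip: "(\<lambda>t. \<psi> n t *\<^sub>R p t) absolutely_integrable_on {u..v}"
    and iq: "(\<lambda>t. \<psi>' n t *\<^sub>R q t) absolutely_integrable_on {u..v}" for n
    by (intro absolutely_integrable_scaleR_left pa \<psi>c \<psi>'c absolutely_integrable_continuous_real qc)+
  have eq: "integral {u..v} (\<lambda>t. \<psi>' n t *\<^sub>R q t) = - integral {u..v} (\<lambda>t. \<psi> n t *\<^sub>R p t)" for n
  proof -
    have "(LINT t:I|lebesgue. deriv (\<psi> n) t *\<^sub>R q t) = - (LINT t:I|lebesgue. \<psi> n t *\<^sub>R p t)"
      using assms(1) test[of n] by (auto simp: has_weak_derivative_def)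
    then show ?thesis
      unfolding deriv using LINT_supported[OF ip[of n] JI] LINT_supported[OF iq[of n] JI] out[of _ n] by simp
  qed
  have lim_p: "(\<lambda>n. integral {u..v} (\<lambda>t. \<psi> n t *\<^sub>R p t)) \<longlonglongrightarrow> integral {a..b} p"
  proof -
    have "(\<lambda>n. integral {u..v} (\<lambda>t. \<psi> n t *\<^sub>R p t))
        \<longlonglongrightarrow> integral {u..v} (\<lambda>t. if t \<in> {a..b} then p t else 0)"
    proof (rule dominated_convergence(2)[where h="\<lambda>t. norm (p t)"])
      show "(\<lambda>t. \<psi> n t *\<^sub>R p t) integrable_on {u..v}" for n
        using ip set_lebesgue_integral_eq_integral(1) by blast
      show "(\<lambda>t. norm (p t)) integrable_on {u..v}"
        using pa absolutely_integrable_on_def by blast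
      show "norm (\<psi> n t *\<^sub>R p t) \<le> norm (p t)" for n t
      proof -
        have "\<bar>\<psi> n t\<bar> \<le> 1"
          using H(7)[of "k n * t + (1 - k n * a)"] H(7)[of "k n * t + (- k n * b)"] by (auto simp: \<psi>_def)
        then show ?thesis by (simp add: mult_left_le_one_le)
      qed
      fix t
      have "\<forall>\<^sub>F n in sequentially. \<psi> n t = (if t \<in> {a..b} then 1 else 0)"
      proof -
        have big: "\<forall>\<^sub>F n in sequentially. 1 \<le> k n * d" if "d > 0" for d
          using that e0 unfolding k_def by real_asymp
        consider "t \<in> {a..b}" | "t < a" | "b < t" by (metis atLeastAtMost_iff not_le)
        then show ?thesis
        proof cases
          case 1
          have "\<psi> n t = 1" for n
          proof -
            have "0 \<le> k n * (t - a)" "k n * (t - b) \<le> 0"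
              using 1 k(1)[of n] by (auto simp: mult_nonneg_nonpos)
            then show ?thesis using H(3,4) by (simp add: \<psi>_def algebra_simps)
          qed
          then show ?thesis using 1 by simp
        next
          case 2
          have "0 < a - t" using 2 by simp
          from big[OF this] show ?thesis
          proof eventually_elim
            case (elim n)
            have "k n * (t - b) \<le> k n * (t - a)" by (intro mult_left_mono) (use ab k(1)[of n] in auto)
            then show ?case using 2 elim H(3) by (simp add: \<psi>_def algebra_simps)
          qed
        next
          case 3
          have "0 < t - b" using 3 by simp
          from big[OF this] show ?thesis
          proof eventually_elim
            case (elim n)
            have "k n * (t - b) \<le> k n * (t - a)" by (intro mult_left_mono) (use ab k(1)[of n] in auto)
            then show ?case using 3 elim H(4) by (simp add: \<psi>_def algebra_simps)
          qed
        qed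
      qed
      then show "(\<lambda>n. \<psi> n t *\<^sub>R p t) \<longlonglongrightarrow> (if t \<in> {a..b} then p t else 0)"
        by (intro tendsto_eventually) (auto elim!: eventually_mono)
    qed
    moreover have "{a..b} \<subseteq> {u..v}" using uv by auto
    moreover have "integral {u..v} (\<lambda>t. if t \<in> {a..b} then p t else 0) = integral {a..b} p"
      unfolding Henstock_Kurzweil_Integration.integral_restrict_Int
      by (rule arg_cong[where f="\<lambda>S. integral S p"]) (use uv in auto)
    ultimately show ?thesis by simp
  qed
  have moll: "(\<lambda>n. integral {u..v} (\<lambda>t. (h (k n * t + c n) * k n) *\<^sub>R q t)) \<longlonglongrightarrow> q y"
    if y: "y \<in> {a..b}"
      and c: "\<And>n t. k n * t + c n \<in> {0..1} \<Longrightarrow> \<bar>k n * t - k n * y\<bar> \<le> 1"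
      and c': "\<And>n. k n * u + c n \<le> 0" "\<And>n. 1 \<le> k n * v + c n" for c y
  proof (rule LIMSEQ_I)
    fix r :: real assume "r > 0"
    have "y \<in> {u..v}" using y uv by auto
    then obtain d where d: "d > 0" "\<And>t. t \<in> {u..v} \<Longrightarrow> dist t y < d \<Longrightarrow> dist (q t) (q y) < r / 2"
      using qc \<open>r > 0\<close> unfolding continuous_on_iff by (metis half_gt_zero)
    have "\<forall>\<^sub>F n in sequentially. e0 / Suc n < d"
      using d(1) by real_asymp
    then obtain n0 where n0: "\<And>n. n \<ge> n0 \<Longrightarrow> e0 / Suc n < d" by (auto simp: eventually_sequentially)
    show "\<exists>n0. \<forall>n\<ge>n0. norm (integral {u..v} (\<lambda>t. (h (k n * t + c n) * k n) *\<^sub>R q t) - q y) < r"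
    proof (intro exI allI impI)
      fix n assume n: "n \<ge> n0"
      have "norm (integral {u..v} (\<lambda>t. (h (k n * t + c n) * k n) *\<^sub>R q t) - q y) \<le> r / 2"
      proof (rule mollifier_bound[OF H(1-6) k(1) c' uv(3) qc])
        fix t assume "t \<in> {u..v}" "k n * t + c n \<in> {0..1}"
        moreover from this have "k n * \<bar>t - y\<bar> \<le> 1"
          using c[of n t] k(1)[of n] by (simp add: abs_mult flip: right_diff_distrib)
        then have "\<bar>t - y\<bar> \<le> 1 / k n" using k(1)[of n] by (simp add: field_simps)
        ultimately show "norm (q t - q y) \<le> r / 2"
          using d(2)[of t] n0[OF n] k(3)[of n] by (simp add: dist_norm)
      qed
      then show "norm (integral {u..v} (\<lambda>t. (h (k n * t + c n) * k n) *\<^sub>R q t) - q y) < r"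
        using \<open>r > 0\<close> by simp
    qed
  qed
  have ku: "k n * u + (1 - k n * a) \<le> 0" "k n * u + (- k n * b) \<le> 0"
    "1 \<le> k n * v + (1 - k n * a)" "1 \<le> k n * v + (- k n * b)" for n
  proof -
    have "0 \<le> k n * (b - a)" using ab k(1)[of n] by simp
    moreover have "0 \<le> k n * e0" using k(2)[of n] by simp
    ultimately show "k n * u + (1 - k n * a) \<le> 0" "k n * u + (- k n * b) \<le> 0"
      "1 \<le> k n * v + (1 - k n * a)" "1 \<le> k n * v + (- k n * b)"
      using k(2)[of n] by (auto simp: u_def v_def algebra_simps)
  qed
  have "(\<lambda>n. integral {u..v} (\<lambda>t. (h (k n * t + (1 - k n * a)) * k n) *\<^sub>R q t)) \<longlonglongrightarrow> q a"
    by (rule moll) (use ab ku in \<open>auto simp: abs_le_iff\<close>)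
  moreover have "(\<lambda>n. integral {u..v} (\<lambda>t. (h (k n * t + (- k n * b)) * k n) *\<^sub>R q t)) \<longlonglongrightarrow> q b"
    by (rule moll) (use ab ku in \<open>auto simp: abs_le_iff\<close>)
  ultimately have "(\<lambda>n. integral {u..v} (\<lambda>t. (h (k n * t + (1 - k n * a)) * k n) *\<^sub>R q t)
      - integral {u..v} (\<lambda>t. (h (k n * t + (- k n * b)) * k n) *\<^sub>R q t)) \<longlonglongrightarrow> q a - q b"
    by (rule tendsto_diff)
  moreover have "integral {u..v} (\<lambda>t. (h (k n * t + (1 - k n * a)) * k n) *\<^sub>R q t)
      - integral {u..v} (\<lambda>t. (h (k n * t + (- k n * b)) * k n) *\<^sub>R q t)
    = integral {u..v} (\<lambda>t. \<psi>' n t *\<^sub>R q t)" for n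
  proof -
    have "(\<lambda>t. (h (k n * t + c) * k n) *\<^sub>R q t) integrable_on {u..v}" for c
      by (intro integrable_continuous_interval continuous_intros qc
          continuous_on_compose2[OF smooth_alg_continuous[OF H(1), of UNIV]]) auto
    from integral_diff[OF this[of "1 - k n * a"] this[of "- k n * b"]] show ?thesis
      by (simp add: \<psi>'_def scaleR_diff_left[symmetric] mult.commute)
  qed
  ultimately have "(\<lambda>n. - integral {u..v} (\<lambda>t. \<psi> n t *\<^sub>R p t)) \<longlonglongrightarrow> q a - q b"
    by (simp add: eq)
  then have "- integral {a..b} p = q a - q b"
    using tendsto_minus[OF lim_p] LIMSEQ_unique by blast
  then have "integral {a..b} p = q b - q a" by (metis minus_diff_eq minus_minus)
  moreover have "p absolutely_integrable_on {a..b}"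
    using L1 ab interior_subset by (metis compact_Icc order_trans)
  ultimately show "p absolutely_integrable_on {a..b} \<and> integral {a..b} p = q b - q a" by simp
qed

text \<open>The integrals of \<open>f\<close>, cut off outside \<open>{a..b}\<close>, vanish over
  all half-lines \<open>{..x}\<close>. These form an intersection-stable generator of the Borel
  sets, and a Lebesgue set is Borel up to a null set, so the integral over every measurable set is
  zero.\<close>

lemma AE_zero_if_integrals_zero:
  fixes f :: "real \<Rightarrow> 'a::euclidean_space"
  assumes f: "f absolutely_integrable_on {a..b}"
    and zero: "\<And>u v. a \<le> u \<Longrightarrow> u \<le> v \<Longrightarrow> v \<le> b \<Longrightarrow> integral {u..v} f = 0"
  shows "AE t in lebesgue. t \<in> {a..b} \<longrightarrow> f t = 0"
proof -
  define g where "g t = indicat_real {a..b} t *\<^sub>R f t" for t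
  have g: "integrable lebesgue g" using f by (simp add: set_integrable_def g_def[abs_def])
  have gA: "set_integrable lebesgue A g" if "A \<in> sets lebesgue" for A
    unfolding set_integrable_def by (rule integrable_mult_indicator[OF that g])
  have bor: "(LINT t:A|lebesgue. g t) = 0" if "A \<in> sets borel" for A
  proof -
    have Int: "Int_stable (range (\<lambda>x::real. {..x}))"
      by (auto simp: Int_stable_def)
    have "A \<in> sigma_sets UNIV (range (\<lambda>x::real. {..x}))"
      using that by (simp add: borel_eq_atMost)
    with Int have "Int_stable (range (\<lambda>x::real. {..x}))" "range (\<lambda>x::real. {..x}) \<subseteq> Pow UNIV"
      "A \<in> sigma_sets UNIV (range (\<lambda>x::real. {..x}))" by auto
    then show ?thesis
    proof (induction rule: sigma_sets_induct_disjoint)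
      case (basic A)
      then obtain x where x: "A = {..x}" by auto
      have "(LINT t:A|lebesgue. g t) = (LINT t:{a..min b x}|lebesgue. f t)"
        unfolding set_lebesgue_integral_def g_def x
        by (rule Bochner_Integration.integral_cong) (auto simp: indicator_def)
      also have "\<dots> = integral {a..min b x} f"
        by (rule set_lebesgue_integral_eq_integral(2), rule set_integrable_subset[OF f]) auto
      also have "\<dots> = 0" using zero[of a "min b x"] by (cases "a \<le> min b x") auto
      finally show ?case .
    next
      case empty
      then show ?case by (simp add: set_lebesgue_integral_def)
    next
      case (compl A)
      then have "A \<in> sets borel" unfolding borel_eq_atMost by simp
      then have A: "A \<in> sets lebesgue" by simp
      have "(LINT t:UNIV|lebesgue. g t) = (LINT t:{a..b}|lebesgue. f t)"
        unfolding set_lebesgue_integral_def g_def by (rule Bochner_Integration.integral_cong) auto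
      also have "\<dots> = integral {a..b} f" by (rule set_lebesgue_integral_eq_integral(2)[OF f])
      also have "\<dots> = 0" using zero[of a b] by (cases "a \<le> b") auto
      finally have U: "(LINT t:UNIV|lebesgue. g t) = 0" .
      have "(LINT t:A \<union> (UNIV - A)|lebesgue. g t) = (LINT t:A|lebesgue. g t) + (LINT t:UNIV - A|lebesgue. g t)"
        by (rule set_integral_Un) (use A sets.compl_sets[OF A] in \<open>auto intro!: gA\<close>)
      then show ?case using U compl by simp
    next
      case (union A)
      then have "A i \<in> sets borel" for i unfolding borel_eq_atMost by auto
      then have A: "\<And>i. A i \<in> sets lebesgue" by simp
      have "(LINT t:(\<Union>i. A i)|lebesgue. g t) = (\<Sum>i. (LINT t:(A i)|lebesgue. g t))"
        by (rule lebesgue_integral_countable_add)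
           (use A union(1) gA in \<open>auto simp: disjoint_family_on_def\<close>)
      then show ?case using union by simp
    qed
  qed
  have "AE t in lebesgue. g t = 0"
  proof (rule sigma_finite_measure.density_zero[OF _ g])
    show "sigma_finite_measure (lebesgue :: real measure)"
    proof (unfold_locales, intro exI conjI)
      show "(\<Union>n::nat. {- real n..real n}) = space lebesgue"
        by auto (metis abs_le_iff minus_le_iff real_arch_simple)
    qed auto
  next
    fix A :: "real set" assume "A \<in> sets lebesgue"
    then obtain S N N' where S: "A = S \<union> N" "N \<subseteq> N'" "N' \<in> null_sets lborel" "S \<in> sets lborel"
      by (rule sets_completionE)
    have "AE t in lebesgue. t \<notin> N'"
      using S(3) AE_not_in null_sets_completionI by blast
    then have "(LINT t:A|lebesgue. g t) = (LINT t:S|lebesgue. g t)"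
      unfolding set_lebesgue_integral_def
    proof (intro integral_cong_AE)
      show "(\<lambda>t. indicat_real A t *\<^sub>R g t) \<in> borel_measurable lebesgue"
        "(\<lambda>t. indicat_real S t *\<^sub>R g t) \<in> borel_measurable lebesgue"
        using gA[of A] gA[of S] S \<open>A \<in> sets lebesgue\<close> by (auto simp: set_integrable_def)
    next
      assume "AE t in lebesgue. t \<notin> N'"
      then show "AE t in lebesgue. indicat_real A t *\<^sub>R g t = indicat_real S t *\<^sub>R g t"
        by eventually_elim (use S in \<open>auto simp: indicator_def\<close>)
    qed
    then show "(LINT t:A|lebesgue. g t) = 0" using bor S(4) by simp
  qed
  then show ?thesis by eventually_elim (auto simp: g_def indicator_def)
qed

text \<open>Compact intervals with rational end points cover the open set and reduce the claim to
  countably many null sets.\<close>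

lemma prim_unique:
  fixes p p' :: "real \<Rightarrow> 'a::euclidean_space"
  assumes "prim I q p" "prim I q p'" "open I"
  shows "AE t in lebesgue. t \<in> I \<longrightarrow> p t = p' t"
proof -
  have *: "AE t in lebesgue. t \<in> {a..b} \<longrightarrow> p t = p' t" if "{a..b} \<subseteq> I" for a b
  proof (cases "a \<le> b")
    case True
    have "AE t in lebesgue. t \<in> {a..b} \<longrightarrow> p t - p' t = 0"
    proof (rule AE_zero_if_integrals_zero)
      show "(\<lambda>t. p t - p' t) absolutely_integrable_on {a..b}"
        using primD(1)[OF assms(1) True that] primD(1)[OF assms(2) True that] by (rule set_integral_diff(1))
      fix u v assume uv: "a \<le> u" "u \<le> v" "v \<le> b"
      then have "{u..v} \<subseteq> I" using that by auto
      then show "integral {u..v} (\<lambda>t. p t - p' t) = 0"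
        using primD[OF assms(1) uv(2)] primD[OF assms(2) uv(2)] by (simp add: integral_diff)
    qed
    then show ?thesis by simp
  qed auto
  have "AE t in lebesgue. \<forall>z\<in>{z \<in> \<rat> \<times> \<rat>. {fst z..snd z} \<subseteq> I}. t \<in> {fst z..snd z} \<longrightarrow> p t = p' t"
    using * by (intro AE_ball_countable[THEN iffD2] ballI countable_subset[OF _ countable_SIGMA[OF countable_rat countable_rat]]) auto
  then show ?thesis
  proof eventually_elim
    case (elim t)
    show ?case
    proof
      assume "t \<in> I"
      then obtain e where e: "e > 0" "ball t e \<subseteq> I" using assms(3) open_contains_ball by blast
      obtain a b where ab: "a \<in> \<rat>" "b \<in> \<rat>" "t - e < a" "a < t" "t < b" "b < t + e"
        using Rats_dense_in_real[of "t - e" t] Rats_dense_in_real[of t "t + e"] e(1) by auto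
      then have "{a..b} \<subseteq> ball t e" by (auto simp: dist_real_def)
      then have "(a, b) \<in> {z \<in> \<rat> \<times> \<rat>. {fst z..snd z} \<subseteq> I}" using ab e by auto
      moreover have "t \<in> {fst (a, b)..snd (a, b)}" using ab by simp
      ultimately show "p t = p' t" using elim by blast
    qed
  qed
qed

section \<open>Translating and gluing curves\<close>

lemma has_integral_shift_real:
  fixes f :: "real \<Rightarrow> 'a::euclidean_space"
  assumes "(f has_integral i) {a + r..b + r}"
  shows "((\<lambda>t. f (t + r)) has_integral i) {a..b}"
  using has_integral_affinity[of f i "a + r" "b + r" 1 r] assms
  by (cases "a \<le> b") auto

lemma prim_shift:
  fixes q p :: "real \<Rightarrow> 'a::euclidean_space"
  assumes "prim I q p" "\<And>t. t \<in> J \<Longrightarrow> t + r \<in> I"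
  shows "prim J (\<lambda>t. q (t + r)) (\<lambda>t. p (t + r))"
  unfolding prim_def
proof (intro allI impI)
  fix a b assume ab: "a \<le> b \<and> {a..b} \<subseteq> J"
  have "{a + r..b + r} \<subseteq> I"
  proof
    fix t assume "t \<in> {a + r..b + r}"
    then have "t - r \<in> J" using ab by auto
    then show "t \<in> I" using assms(2)[of "t - r"] by simp
  qed
  note pr = primD[OF assms(1) _ this]
  have "(\<lambda>t. p (t + r)) integrable_on {a..b}" "((\<lambda>t. p (t + r)) has_integral q (b + r) - q (a + r)) {a..b}"
    using has_integral_shift_real[OF pr(4)] ab by (auto simp: integrable_on_def)
  moreover have "(\<lambda>t. norm (p (t + r))) integrable_on {a..b}"
  proof -
    have "(\<lambda>t. norm (p t)) integrable_on {a + r..b + r}"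
      using pr(1) ab by (simp add: absolutely_integrable_on_def)
    then show ?thesis
      using has_integral_shift_real[of "\<lambda>t. norm (p t)"] unfolding integrable_on_def by blast
  qed
  ultimately show "(\<lambda>t. p (t + r)) absolutely_integrable_on {a..b} \<and>
      integral {a..b} (\<lambda>t. p (t + r)) = q (b + r) - q (a + r)"
    by (simp add: absolutely_integrable_on_def integral_unique)
qed

lemma prim_glue:
  fixes q p :: "real \<Rightarrow> 'a::euclidean_space"
  assumes q: "prim (I \<inter> {..s}) q p" and q': "prim (I \<inter> {s..}) q' p'" and eq: "q s = q' s"
  shows "prim I (\<lambda>t. if t \<le> s then q t else q' t) (\<lambda>t. if t \<le> s then p t else p' t)"
    (is "prim I ?q ?p")
proof -
  have left: "?p absolutely_integrable_on {a..b} \<and> integral {a..b} ?p = ?q b - ?q a"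
    if "a \<le> b" "{a..b} \<subseteq> I" "b \<le> s" for a b
  proof -
    have "{a..b} \<subseteq> I \<inter> {..s}" using that by auto
    note pr = primD[OF q that(1) this]
    have "?p absolutely_integrable_on {a..b}"
      by (rule absolutely_integrable_spike[OF pr(1), of "{}"]) (use that in auto)
    moreover have "integral {a..b} ?p = integral {a..b} p"
      by (rule integral_cong) (use that in auto)
    ultimately show ?thesis using pr that by simp
  qed
  have right: "?p absolutely_integrable_on {a..b} \<and> integral {a..b} ?p = ?q b - ?q a"
    if "a \<le> b" "{a..b} \<subseteq> I" "s \<le> a" for a b
  proof -
    have "{a..b} \<subseteq> I \<inter> {s..}" using that by auto
    note pr = primD[OF q' that(1) this]
    have "?p absolutely_integrable_on {a..b}"
      by (rule absolutely_integrable_spike[OF pr(1), of "{s}"]) (use that in auto)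
    moreover have "integral {a..b} ?p = integral {a..b} p'"
      by (rule integral_spike[of "{s}"]) (use that in auto)
    moreover have "?q b = q' b" "?q a = q' a"
      using that eq by (cases "b = s"; cases "a = s"; force)+
    ultimately show ?thesis using pr that by simp
  qed
  show ?thesis
    unfolding prim_def
  proof (intro allI impI)
    fix a b assume ab: "a \<le> b \<and> {a..b} \<subseteq> I"
    consider "b \<le> s" | "s \<le> a" | "a \<le> s" "s \<le> b" by linarith
    then show "?p absolutely_integrable_on {a..b} \<and> integral {a..b} ?p = ?q b - ?q a"
    proof cases
      case 3
      have sub: "{a..s} \<subseteq> I" "{s..b} \<subseteq> I" using ab 3 by auto
      have l: "?p absolutely_integrable_on {a..s}" "integral {a..s} ?p = ?q s - ?q a"
        using left[OF 3(1) sub(1)] by auto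
      have r: "?p absolutely_integrable_on {s..b}" "integral {s..b} ?p = ?q b - ?q s"
        using right[OF 3(2) sub(2)] by auto
      have "{a..s} \<union> {s..b} = {a..b}" using 3 by auto
      then have "?p absolutely_integrable_on {a..b}"
        using absolutely_integrable_Un[OF l(1) r(1)] by simp
      moreover have "integral {a..s} ?p + integral {s..b} ?p = integral {a..b} ?p"
        by (rule Henstock_Kurzweil_Integration.integral_combine[OF 3])
           (use calculation set_lebesgue_integral_eq_integral(1) in blast)
      ultimately show ?thesis using l(2) r(2) by simp
    qed (use left right ab in blast)+
  qed
qed

lemma prim_const: "prim I (\<lambda>_. x) (\<lambda>_. 0)"
  by (auto simp: prim_def)

lemma prim_measurable:
  fixes q p :: "real \<Rightarrow> 'a::euclidean_space"
  assumes "prim UNIV q p"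
  shows "p \<in> borel_measurable lebesgue" "q \<in> borel_measurable lebesgue"
proof -
  have "(\<lambda>t. indicat_real {- real n..real n} t *\<^sub>R p t) \<in> borel_measurable lebesgue" for n
    using primD(1)[OF assms, of "- real n" "real n"] by (auto simp: set_integrable_def)
  moreover have "(\<lambda>n. indicat_real {- real n..real n} t *\<^sub>R p t) \<longlonglongrightarrow> p t" for t
  proof (rule tendsto_eventually)
    have "\<forall>\<^sub>F n in sequentially. \<bar>t\<bar> \<le> real n" by real_asymp
    then show "\<forall>\<^sub>F n in sequentially. indicat_real {- real n..real n} t *\<^sub>R p t = p t"
      by eventually_elim (auto simp: indicator_def)
  qed
  ultimately show "p \<in> borel_measurable lebesgue" by (rule borel_measurable_LIMSEQ_metric)
  show "q \<in> borel_measurable lebesgue"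
    using borel_measurable_continuous_onI[OF prim_continuous_on_UNIV[OF assms]]
    by (simp add: measurable_completion)
qed

lemma Liminf_nonneg_eq_0_iff:
  fixes f :: "'b \<Rightarrow> real"
  assumes "\<And>t. 0 \<le> f t"
  shows "Liminf F (\<lambda>t. ereal (f t)) = 0 \<longleftrightarrow> (\<forall>e>0. frequently (\<lambda>t. f t < e) F)"
proof
  assume L: "Liminf F (\<lambda>t. ereal (f t)) = 0"
  show "\<forall>e>0. frequently (\<lambda>t. f t < e) F"
  proof (intro allI impI, rule ccontr)
    fix e :: real assume e: "e > 0" "\<not> frequently (\<lambda>t. f t < e) F"
    then have "\<forall>\<^sub>F t in F. ereal e \<le> ereal (f t)"
      by (simp add: not_frequently not_less)
    then have "ereal e \<le> Liminf F (\<lambda>t. ereal (f t))" by (rule Liminf_bounded)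
    then show False using L e by (simp add: zero_ereal_def)
  qed
next
  assume fr: "\<forall>e>0. frequently (\<lambda>t. f t < e) F"
  have "0 \<le> Liminf F (\<lambda>t. ereal (f t))"
    by (rule Liminf_bounded) (simp add: assms)
  moreover have "\<not> 0 < Liminf F (\<lambda>t. ereal (f t))"
  proof
    assume "0 < Liminf F (\<lambda>t. ereal (f t))"
    then obtain e where e: "0 < ereal e" "ereal e < Liminf F (\<lambda>t. ereal (f t))"
      using ereal_dense2 by blast
    then have "\<forall>\<^sub>F t in F. ereal e < ereal (f t)" using less_LiminfD by blast
    then have "\<not> frequently (\<lambda>t. f t < e) F"
      unfolding not_frequently by eventually_elim simp
    then show False using fr e by simp
  qed
  ultimately show "Liminf F (\<lambda>t. ereal (f t)) = 0" by (metis order_le_imp_less_or_eq)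
qed

lemma frequently_at_top_iff: "frequently P (at_top :: real filter) \<longleftrightarrow> (\<forall>T. \<exists>t\<ge>T. P t)"
  by (auto simp: frequently_def eventually_at_top_linorder)

lemma frequently_at_bot_iff: "frequently P (at_bot :: real filter) \<longleftrightarrow> (\<forall>T. \<exists>t\<le>T. P t)"
  by (auto simp: frequently_def eventually_at_bot_linorder)

text \<open>The local class provides an unrelated weak derivative for each compact interval. On the
  intervals from \<open>- real (Suc k)\<close> to \<open>real (Suc k)\<close> they agree outside one
  common null set, which allows them to be merged into a single \<open>p\<close>.\<close>

lemma W1_Phi_loc_imp_prim:
  fixes q :: "real \<Rightarrow> 'a::euclidean_space"
  assumes "W1_Phi_loc \<phi> q"
  obtains p where "prim UNIV q p"
proof -
  have "\<exists>p. has_weak_derivative {- real (Suc k)..real (Suc k)} q p" for k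
  proof -
    have "- real (Suc k) < real (Suc k)" by simp
    then have "W1_Phi \<phi> {- real (Suc k)..real (Suc k)} q"
      using assms unfolding W1_Phi_loc_def by blast
    then show ?thesis unfolding W1_Phi_def by blast
  qed
  then obtain P where P: "\<And>k. has_weak_derivative {- real (Suc k)..real (Suc k)} q (P k)" by metis
  have prP: "prim {- real (Suc k)<..<real (Suc k)} q (P k)" for k
  proof -
    have "continuous_on {- real (Suc k)..real (Suc k)} q"
      using assms continuous_on_subset unfolding W1_Phi_loc_def by blast
    from weak_derivative_imp_prim[OF P this] show ?thesis by simp
  qed
  have *: "AE t in lebesgue. t \<in> {- real (Suc j)<..<real (Suc j)} \<longrightarrow> P j t = P k t" if "j \<le> k" for j k
  proof (rule prim_unique[OF prP])
    show "prim {- real (Suc j)<..<real (Suc j)} q (P k)"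
      by (rule prim_subset[OF prP]) (use that in auto)
  qed simp
  have "AE t in lebesgue. \<forall>j k. j \<le> k \<longrightarrow> t \<in> {- real (Suc j)<..<real (Suc j)} \<longrightarrow> P j t = P k t"
    unfolding AE_all_countable
  proof (intro allI)
    fix j k
    show "AE t in lebesgue. j \<le> k \<longrightarrow> t \<in> {- real (Suc j)<..<real (Suc j)} \<longrightarrow> P j t = P k t"
      using *[of j k] by (cases "j \<le> k") simp_all
  qed
  then obtain N where N: "negligible N"
    "\<And>t j k. t \<notin> N \<Longrightarrow> j \<le> k \<Longrightarrow> t \<in> {- real (Suc j)<..<real (Suc j)} \<Longrightarrow> P j t = P k t"
    unfolding eventually_ae_filter_negligible subset_iff mem_Collect_eq by metis
  \<comment> \<open>The index is at least \<open>\<bar>t\<bar>\<close>, so the successor in the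
    interval bounds puts \<open>t\<close> strictly inside.\<close>
  define p where "p t = P (nat \<lceil>\<bar>t\<bar>\<rceil>) t" for t
  have pP: "p t = P k t" if "t \<notin> N" "t \<in> {- real (Suc k)<..<real (Suc k)}" for t k
  proof -
    define j where "j = nat \<lceil>\<bar>t\<bar>\<rceil>"
    have "\<bar>t\<bar> \<le> real j" unfolding j_def by (rule real_nat_ceiling_ge)
    then have "t \<in> {- real (Suc j)<..<real (Suc j)}" by (auto simp: abs_le_iff)
    then have "P j t = P k t"
      using N(2)[OF that(1), of j k] N(2)[OF that(1), of k j] that(2) by (metis linear)
    then show ?thesis by (simp add: p_def j_def)
  qed
  have "prim UNIV q p"
    unfolding prim_def
  proof (intro allI impI)
    fix a b :: real assume ab: "a \<le> b \<and> {a..b} \<subseteq> UNIV"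
    obtain k :: nat where k: "\<bar>a\<bar> + \<bar>b\<bar> \<le> real k"
      using real_arch_simple[of "\<bar>a\<bar> + \<bar>b\<bar>"] by blast
    have sub: "t \<in> {- real (Suc k)<..<real (Suc k)}" if "t \<in> {a..b}" for t
      using k that by (auto simp: abs_le_iff)
    then have "{a..b} \<subseteq> {- real (Suc k)<..<real (Suc k)}" by blast
    then have pr: "P k absolutely_integrable_on {a..b}" "integral {a..b} (P k) = q b - q a"
      using primD(1,3)[OF prP[of k], of a b] ab by auto
    have eq: "p t = P k t" if "t \<in> {a..b} - N" for t
      using pP[of t k] sub[of t] that by auto
    have "p absolutely_integrable_on {a..b}"
      by (rule absolutely_integrable_spike[OF pr(1) N(1)]) (rule eq)
    moreover have "integral {a..b} p = integral {a..b} (P k)"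
      by (rule integral_spike[OF N(1)]) (simp add: eq)
    ultimately show "p absolutely_integrable_on {a..b} \<and> integral {a..b} p = q b - q a"
      using pr ab by simp
  qed
  then show ?thesis by (rule that)
qed

section \<open>Action and competitors\<close>

locale connection_problem = orlicz_growth \<phi> l for \<phi> l +
  fixes V :: "'a::euclidean_space \<Rightarrow> real" and c :: real and Vm Vp :: "'a set"
  assumes V_C1: "C1_potential V"
    and sublevel: "{x. V x \<le> c} = Vm \<union> Vp"
    and Vm_ne: "Vm \<noteq> {}" and Vp_ne: "Vp \<noteq> {}" and setdist_pos: "setdist Vm Vp > 0"
begin

abbreviation "m\<^sub>c \<equiv> m_inf \<phi> V c Vm Vp"

lemma V_gderiv: "GDERIV V x :> gradient V x"
  using V_C1 gradient_eqI unfolding C1_potential_def by metis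

lemma gradient_cont: "continuous_on UNIV (gradient V)"
proof -
  obtain D where D: "\<And>x. GDERIV V x :> D x" "continuous_on UNIV D"
    using V_C1 unfolding C1_potential_def by blast
  have "gradient V = D" using gradient_eqI[OF D(1)] by blast
  then show ?thesis using D by simp
qed

lemma V_derivative: "(V has_derivative (\<lambda>h. gradient V x \<bullet> h)) (at x)"
  using V_gderiv[of x] by (simp add: gderiv_def inner_commute)

lemma V_cont: "continuous_on S V"
  using V_derivative by (meson continuous_at_imp_continuous_on has_derivative_continuous)

text \<open>Carrying the derivative \<open>p\<close> as an argument avoids the arbitrary
  representative chosen in \<open>J_fun\<close>; \<open>J_fun_eq_act\<close> translates
  back.\<close>

definition lagr :: "(real \<Rightarrow> 'a) \<Rightarrow> (real \<Rightarrow> 'a) \<Rightarrow> real \<Rightarrow> real" where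
  "lagr q p t = \<Phi> (norm (p t)) + V (q t) - c"

definition act :: "real set \<Rightarrow> (real \<Rightarrow> 'a) \<Rightarrow> (real \<Rightarrow> 'a) \<Rightarrow> ennreal" where
  "act S q p = (\<integral>\<^sup>+t\<in>S. ennreal (lagr q p t) \<partial>lebesgue)"

text \<open>The Orlicz--Sobolev condition can be dispensed with here: finite action implies it
  (\<open>curve_finite_action_W1\<close>), and with infinite action the lower bound
  \<open>m_le_act\<close> is trivial. Glued curves are therefore easy to recognise as
  competitors.\<close>

definition curve :: "(real \<Rightarrow> 'a) \<Rightarrow> (real \<Rightarrow> 'a) \<Rightarrow> bool" where
  "curve q p \<longleftrightarrow> prim UNIV q p \<and> (\<forall>t. c \<le> V (q t))"

definition starts :: "(real \<Rightarrow> 'a) \<Rightarrow> bool" where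
  "starts q \<longleftrightarrow> (\<forall>e>0. \<forall>T. \<exists>t\<le>T. infdist (q t) Vm < e)"

definition ends :: "(real \<Rightarrow> 'a) \<Rightarrow> bool" where
  "ends q \<longleftrightarrow> (\<forall>e>0. \<forall>T. \<exists>t\<ge>T. infdist (q t) Vp < e)"

lemma admissible_iff:
  "q \<in> admissible \<phi> V c Vm Vp \<longleftrightarrow> W1_Phi_loc \<phi> q \<and> (\<forall>t. c \<le> V (q t)) \<and> starts q \<and> ends q"
  by (auto simp: admissible_def starts_def ends_def Liminf_nonneg_eq_0_iff infdist_nonneg
      frequently_at_top_iff frequently_at_bot_iff)

section \<open>The action as a set function\<close>

lemma Phi_measurable: "\<Phi> \<in> borel_measurable borel"
  by (rule borel_measurable_continuous_onI[OF Phi_cont])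

lemma lagr_measurable:
  assumes "prim UNIV q p" shows "lagr q p \<in> borel_measurable lebesgue"
proof -
  note [measurable] = prim_measurable[OF assms] Phi_measurable
    borel_measurable_continuous_onI[OF V_cont]
  show ?thesis unfolding lagr_def[abs_def] by measurable
qed

lemma lagr_nonneg: "c \<le> V (q t) \<Longrightarrow> 0 \<le> lagr q p t"
  by (simp add: lagr_def add_increasing)

lemma act_Un:
  assumes "prim UNIV q p" "S \<in> sets lebesgue" "T \<in> sets lebesgue" "S \<inter> T = {}"
  shows "act (S \<union> T) q p = act S q p + act T q p"
  unfolding act_def using lagr_measurable[OF assms(1)] assms
  by (intro nn_integral_disjoint_pair) auto

lemma act_cong: "(\<And>t. t \<in> S \<Longrightarrow> q t = q' t \<and> p t = p' t) \<Longrightarrow> act S q p = act S q' p'"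
  unfolding act_def by (rule nn_integral_cong) (auto simp: lagr_def indicator_def)

lemma act_mono: "S \<subseteq> T \<Longrightarrow> act S q p \<le> act T q p"
  unfolding act_def by (rule nn_integral_mono) (auto simp: indicator_def)

lemma act_AE: "(AE t in lebesgue. t \<in> S \<longleftrightarrow> t \<in> T) \<Longrightarrow> act S q p = act T q p"
  unfolding act_def by (rule nn_integral_cong_AE) (auto elim!: eventually_mono simp: indicator_def)

lemma AE_neq: "AE t in lebesgue. t \<noteq> (s::real)"
  using AE_not_in[of "{s}" lebesgue] by simp

lemma act_shift:
  assumes "prim UNIV q p" "S \<in> sets lebesgue"
  shows "act {t. t + r \<in> S} (\<lambda>t. q (t + r)) (\<lambda>t. p (t + r)) = act S q p"
proof -
  let ?f = "\<lambda>t. ennreal (lagr q p t) * indicator S t"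
  have "?f \<in> borel_measurable lebesgue" using lagr_measurable[OF assms(1)] assms(2) by simp
  from nn_integral_real_affine_lebesgue[OF this, of 1 r]
  have "act S q p = (\<integral>\<^sup>+t. ?f (r + t) \<partial>lebesgue)" by (simp add: act_def)
  also have "\<dots> = act {t. t + r \<in> S} (\<lambda>t. q (t + r)) (\<lambda>t. p (t + r))"
    unfolding act_def by (rule nn_integral_cong) (simp add: lagr_def indicator_def add.commute)
  finally show ?thesis by simp
qed

lemma act_eq_integral:
  assumes "lagr q p integrable_on {a..b}" "\<And>t. t \<in> {a..b} \<Longrightarrow> c \<le> V (q t)"
  shows "act {a..b} q p = ennreal (integral {a..b} (lagr q p))"
proof -
  have "(lagr q p has_integral integral {a..b} (lagr q p)) {a..b}"
    using assms(1) by (rule integrable_integral)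
  then have "integral\<^sup>N lborel (\<lambda>x. ennreal (lagr q p x) * indicator {a..b} x) = ennreal (integral {a..b} (lagr q p))"
    by (intro nn_integral_has_integral_lebesgue') (auto intro!: lagr_nonneg assms)
  then show ?thesis by (simp add: act_def nn_integral_completion)
qed

lemma lagr_integrable_if_act_finite:
  assumes "prim UNIV q p" "\<And>t. t \<in> {a..b} \<Longrightarrow> c \<le> V (q t)" "act {a..b} q p < \<infinity>"
  shows "lagr q p integrable_on {a..b}"
proof -
  let ?f = "\<lambda>t. lagr q p t * indicator {a..b} t"
  have "(\<integral>\<^sup>+t. ennreal (?f t) \<partial>lebesgue) = act {a..b} q p"
    unfolding act_def by (rule nn_integral_cong) (auto simp: indicator_def)
  moreover obtain r where "act {a..b} q p = ennreal r" "0 \<le> r"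
    using assms(3) by (cases "act {a..b} q p") auto
  moreover have "?f \<in> borel_measurable lebesgue"
    by (intro borel_measurable_times lagr_measurable[OF assms(1)] borel_measurable_indicator) simp
  moreover have "0 \<le> ?f t" for t
    using lagr_nonneg assms(2) by (auto simp: indicator_def)
  ultimately have "(?f has_integral r) UNIV"
    by (subst has_integral_iff_nn_integral_lebesgue) auto
  moreover have "?f = (\<lambda>t. if t \<in> {a..b} then lagr q p t else 0)" by (auto simp: indicator_def)
  ultimately show ?thesis by (metis has_integral_restrict_UNIV integrable_on_def)
qed

text \<open>\<open>weak_derivative\<close> is an arbitrary choice, but on an open interval
  \<open>prim_unique\<close> makes it agree with \<open>p\<close> almost everywhere.\<close>

lemma J_fun_eq_act:
  assumes "prim I q p" "continuous_on I q" "open I" "is_interval I"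
  shows "J_fun \<phi> V c I q = act I q p"
proof -
  have "has_weak_derivative I q (weak_derivative I q)"
    unfolding weak_derivative_def by (rule someI[of "has_weak_derivative I q"]) (rule prim_imp_weak_derivative[OF assms(1,4)])
  from weak_derivative_imp_prim[OF this assms(2)]
  have "prim I q (weak_derivative I q)" by (simp add: interior_open assms(3))
  from prim_unique[OF this assms(1,3)] show ?thesis
    unfolding J_fun_def act_def lagr_def
    by (intro nn_integral_cong_AE) (auto elim!: eventually_mono simp: indicator_def)
qed

text \<open>Along the curve \<open>c \<le> V\<close>, so the action dominates the integral of
  \<open>\<Phi> (norm (p t))\<close>, and the scale 1 works in the Luxemburg condition. For
  \<open>q\<close> itself continuity on compact intervals is enough.\<close>

lemma curve_finite_action_W1:
  assumes "curve q p" "act UNIV q p < \<infinity>"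
  shows "W1_Phi_loc \<phi> q"
  unfolding W1_Phi_loc_def
proof (intro conjI allI impI)
  have pr: "prim UNIV q p" and Vq: "\<And>t. c \<le> V (q t)" using assms by (auto simp: curve_def)
  show "continuous_on UNIV q" by (rule prim_continuous_on_UNIV[OF pr])
  fix a b :: real assume "a < b"
  have pab: "prim {a..b} q p" using prim_subset[OF pr] by blast
  have int: "is_interval {a..b}" by (rule is_interval_cc)
  have "(\<integral>\<^sup>+t\<in>{a..b}. ennreal (\<Phi> (norm (p t) / 1)) \<partial>lebesgue) \<le> act UNIV q p"
    unfolding act_def
    by (rule nn_integral_mono) (use Vq in \<open>auto simp: indicator_def lagr_def intro!: ennreal_leI\<close>)
  then have "L_Phi \<phi> {a..b} p"
    unfolding L_Phi_def using prim_imp_L1_loc[OF pab int] assms(2)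
    by (intro conjI exI[of _ 1]) (auto intro: le_less_trans)
  moreover have "L_Phi \<phi> {a..b} q"
  proof -
    have "continuous_on {a..b} (\<lambda>t. \<Phi> (norm (q t)))"
      using prim_continuous_on_UNIV[OF pr] continuous_on_subset
      by (intro continuous_on_compose2[OF Phi_cont] continuous_intros) auto
    then have "((\<lambda>t. \<Phi> (norm (q t))) has_integral integral {a..b} (\<lambda>t. \<Phi> (norm (q t)))) {a..b}"
      by (intro integrable_integral integrable_continuous_interval)
    then have "(\<integral>\<^sup>+t\<in>{a..b}. ennreal (\<Phi> (norm (q t) / 1)) \<partial>lebesgue) < \<infinity>"
      using nn_integral_has_integral_lebesgue'[of "{a..b}" "\<lambda>t. \<Phi> (norm (q t))"]
      by (simp add: nn_integral_completion)
    then show ?thesis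
      unfolding L_Phi_def using prim_imp_L1_loc[OF pab int] by (intro conjI exI[of _ 1]) auto
  qed
  ultimately show "W1_Phi \<phi> {a..b} q"
    unfolding W1_Phi_def using prim_imp_weak_derivative[OF pab int] by blast
qed

lemma m_le_act:
  assumes "curve q p" "starts q" "ends q"
  shows "m\<^sub>c \<le> act UNIV q p"
proof (cases "act UNIV q p < \<infinity>")
  case True
  have pr: "prim UNIV q p" using assms(1) by (simp add: curve_def)
  have "q \<in> admissible \<phi> V c Vm Vp"
    using curve_finite_action_W1[OF assms(1) True] assms by (simp add: admissible_iff curve_def)
  then have "m\<^sub>c \<le> J_fun \<phi> V c UNIV q" unfolding m_inf_def by (rule INF_lower)
  also have "\<dots> = act UNIV q p"
    by (rule J_fun_eq_act[OF pr prim_continuous_on_UNIV[OF pr]]) auto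
  finally show ?thesis .
next
  case False
  then show ?thesis by (simp add: not_less top_unique)
qed

lemma admissible_curve:
  assumes "q \<in> admissible \<phi> V c Vm Vp"
  obtains p where "curve q p" "starts q" "ends q" "J_fun \<phi> V c UNIV q = act UNIV q p"
proof -
  have *: "W1_Phi_loc \<phi> q" "\<And>t. c \<le> V (q t)" "starts q" "ends q"
    using assms by (auto simp: admissible_iff)
  obtain p where p: "prim UNIV q p" using W1_Phi_loc_imp_prim[OF *(1)] .
  have "J_fun \<phi> V c UNIV q = act UNIV q p"
    by (rule J_fun_eq_act[OF p prim_continuous_on_UNIV[OF p]]) auto
  then show ?thesis using that p * by (simp add: curve_def)
qed

section \<open>Competitors obtained by gluing\<close>

lemma lagr_continuous:
  assumes "prim {a..b} q p" "continuous_on {a..b} p" "a \<le> b"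
  shows "continuous_on {a..b} (lagr q p)"
proof -
  have "continuous_on {a..b} q" using prim_continuous_on[OF assms(1,3)] by simp
  then show ?thesis
    unfolding lagr_def[abs_def]
    by (intro continuous_intros continuous_on_compose2[OF Phi_cont]
        continuous_on_compose2[OF V_cont[of UNIV]] assms) auto
qed

lemma curve_const: "V x = c \<Longrightarrow> curve (\<lambda>_. x) (\<lambda>_. 0)"
  by (simp add: curve_def prim_const)

lemma starts_const: "x \<in> Vm \<Longrightarrow> starts (\<lambda>_. x)"
  by (auto simp: starts_def)

lemma ends_const: "x \<in> Vp \<Longrightarrow> ends (\<lambda>_. x)"
  by (auto simp: ends_def)

lemma act_const: "V x = c \<Longrightarrow> act S (\<lambda>_. x) (\<lambda>_. 0) = 0"
  by (simp add: act_def lagr_def)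

text \<open>The traversal time \<open>\<tau>\<close> of the inserted piece is free; this freedom is what later yields the
  energy identity.\<close>

lemma glue_bound:
  assumes q1: "curve q1 p1" "starts q1" and q2: "curve q2 p2" "ends q2"
    and \<sigma>: "prim {0..\<tau>} \<sigma> \<sigma>'" "continuous_on {0..\<tau>} \<sigma>'" "0 \<le> \<tau>"
      "\<And>r. r \<in> {0..\<tau>} \<Longrightarrow> c \<le> V (\<sigma> r)" "\<sigma> 0 = q1 s" "\<sigma> \<tau> = q2 u"
  shows "m\<^sub>c \<le> act {..s} q1 p1 + ennreal (integral {0..\<tau>} (lagr \<sigma> \<sigma>')) + act {u..} q2 p2"
proof -
  \<comment> \<open>After the inserted piece \<open>q2\<close> is run with the time shift that takes
    \<open>s + \<tau>\<close> to \<open>u\<close>.\<close>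
  define r where "r = u - (s + \<tau>)"
  define Q2 where "Q2 t = (if t \<le> s + \<tau> then \<sigma> (t + - s) else q2 (t + r))" for t
  define P2 where "P2 t = (if t \<le> s + \<tau> then \<sigma>' (t + - s) else p2 (t + r))" for t
  define Q where "Q t = (if t \<le> s then q1 t else Q2 t)" for t
  define P where "P t = (if t \<le> s then p1 t else P2 t)" for t
  have pr1: "prim UNIV q1 p1" and pr2: "prim UNIV q2 p2"
    and V1: "\<And>t. c \<le> V (q1 t)" and V2: "\<And>t. c \<le> V (q2 t)"
    using q1 q2 by (auto simp: curve_def)
  have pr\<sigma>: "prim {s..s + \<tau>} (\<lambda>t. \<sigma> (t + - s)) (\<lambda>t. \<sigma>' (t + - s))"
    by (rule prim_shift[OF \<sigma>(1)]) auto
  have "prim {s..} Q2 P2"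
    unfolding Q2_def[abs_def] P2_def[abs_def]
  proof (rule prim_glue)
    show "prim ({s..} \<inter> {..s + \<tau>}) (\<lambda>t. \<sigma> (t + - s)) (\<lambda>t. \<sigma>' (t + - s))"
      by (rule prim_subset[OF pr\<sigma>]) auto
    show "prim ({s..} \<inter> {s + \<tau>..}) (\<lambda>t. q2 (t + r)) (\<lambda>t. p2 (t + r))"
      by (rule prim_shift[OF pr2]) simp
    show "\<sigma> (s + \<tau> + - s) = q2 (s + \<tau> + r)" using \<sigma>(6) by (simp add: r_def)
  qed
  moreover have "q1 s = Q2 s" using \<sigma>(3,5) by (simp add: Q2_def)
  ultimately have pr: "prim UNIV Q P"
    unfolding Q_def[abs_def] P_def[abs_def]
    by (intro prim_glue) (auto intro: prim_subset[OF pr1])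
  have VQ: "c \<le> V (Q t)" for t
    using V1 V2 \<sigma>(4)[of "t + - s"] by (auto simp: Q_def Q2_def)
  have "starts Q"
    unfolding starts_def
  proof (intro allI impI)
    fix e T :: real assume "e > 0"
    then obtain t where "t \<le> min T s" "infdist (q1 t) Vm < e"
      using q1(2) unfolding starts_def by blast
    then show "\<exists>t\<le>T. infdist (Q t) Vm < e" by (intro exI[of _ t]) (simp add: Q_def)
  qed
  moreover have "ends Q"
    unfolding ends_def
  proof (intro allI impI)
    fix e T :: real assume "e > 0"
    then obtain t where t: "max (T + r) (s + \<tau> + r + 1) \<le> t" "infdist (q2 t) Vp < e"
      using q2(2) unfolding ends_def by blast
    then have "\<not> t - r \<le> s" "\<not> t - r \<le> s + \<tau>" using \<sigma>(3) by auto
    then have "Q (t - r) = q2 t" by (simp add: Q_def Q2_def)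
    then show "\<exists>t\<ge>T. infdist (Q t) Vp < e" using t by (intro exI[of _ "t - r"]) simp
  qed
  ultimately have "m\<^sub>c \<le> act UNIV Q P"
    using m_le_act pr VQ by (simp add: curve_def)
  also have "UNIV = {..s} \<union> ({s<..s + \<tau>} \<union> {s + \<tau><..})"
    using \<sigma>(3) by auto
  also have "act ({..s} \<union> ({s<..s + \<tau>} \<union> {s + \<tau><..})) Q P
      = act {..s} Q P + (act {s<..s + \<tau>} Q P + act {s + \<tau><..} Q P)"
    using \<sigma>(3) by (subst act_Un[OF pr], simp, simp, force, subst act_Un[OF pr]) auto
  also have "act {..s} Q P = act {..s} q1 p1"
    by (rule act_cong) (simp add: Q_def P_def)
  also have "act {s<..s + \<tau>} Q P \<le> ennreal (integral {0..\<tau>} (lagr \<sigma> \<sigma>'))"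
  proof -
    have "act {s<..s + \<tau>} Q P = act {s<..s + \<tau>} (\<lambda>t. \<sigma> (t + - s)) (\<lambda>t. \<sigma>' (t + - s))"
      by (rule act_cong) (auto simp: Q_def P_def Q2_def P2_def)
    also have "\<dots> \<le> act {s..s + \<tau>} (\<lambda>t. \<sigma> (t + - s)) (\<lambda>t. \<sigma>' (t + - s))"
      by (rule act_mono) auto
    also have "\<dots> = ennreal (integral {0..\<tau>} (lagr \<sigma> \<sigma>'))"
    proof -
      have "lagr (\<lambda>t. \<sigma> (t + - s)) (\<lambda>t. \<sigma>' (t + - s)) = (\<lambda>t. lagr \<sigma> \<sigma>' (t + - s))"
        by (auto simp: lagr_def)
      moreover have "(lagr \<sigma> \<sigma>' has_integral integral {0..\<tau>} (lagr \<sigma> \<sigma>')) {s + - s..s + \<tau> + - s}"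
        using integrable_continuous_interval[OF lagr_continuous[OF \<sigma>(1,2,3)]]
        by (simp add: has_integral_integral)
      ultimately have "(lagr (\<lambda>t. \<sigma> (t + - s)) (\<lambda>t. \<sigma>' (t + - s))
          has_integral integral {0..\<tau>} (lagr \<sigma> \<sigma>')) {s..s + \<tau>}"
        using has_integral_shift_real by metis
      then show ?thesis
        using act_eq_integral[of "\<lambda>t. \<sigma> (t + - s)" "\<lambda>t. \<sigma>' (t + - s)" s "s + \<tau>"] \<sigma>(4)
        by (auto simp: has_integral_iff)
    qed
    finally show ?thesis .
  qed
  also have "act {s + \<tau><..} Q P \<le> act {u..} q2 p2"
  proof -
    have "act {s + \<tau><..} Q P = act {t. t + r \<in> {u<..}} (\<lambda>t. q2 (t + r)) (\<lambda>t. p2 (t + r))"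
    proof -
      have "{s + \<tau><..} = {t. t + r \<in> {u<..}}" by (auto simp: r_def)
      moreover have "act {s + \<tau><..} Q P = act {s + \<tau><..} (\<lambda>t. q2 (t + r)) (\<lambda>t. p2 (t + r))"
        by (rule act_cong) (use \<sigma>(3) in \<open>auto simp: Q_def P_def Q2_def P2_def\<close>)
      ultimately show ?thesis by simp
    qed
    also have "\<dots> = act {u<..} q2 p2" by (rule act_shift[OF pr2]) simp
    also have "\<dots> \<le> act {u..} q2 p2" by (rule act_mono) auto
    finally show ?thesis .
  qed
  finally show ?thesis by (simp add: add.assoc add_mono)
qed

section \<open>Near-minimizers\<close>

definition near_min :: "real \<Rightarrow> (real \<Rightarrow> 'a) \<Rightarrow> (real \<Rightarrow> 'a) \<Rightarrow> bool" where
  "near_min \<epsilon> q p \<longleftrightarrow> curve q p \<and> starts q \<and> ends q \<and> act UNIV q p \<le> m\<^sub>c + ennreal \<epsilon> \<and>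
     m\<^sub>c < \<infinity> \<and> 0 \<le> \<epsilon>"

lemma near_min_basic:
  assumes "near_min \<epsilon> q p"
  shows "prim UNIV q p" "c \<le> V (q t)" "lagr q p integrable_on {s..t}"
    "act {s..t} q p = ennreal (integral {s..t} (lagr q p))"
    "0 \<le> integral {s..t} (lagr q p)"
    "act UNIV q p < \<infinity>"
proof -
  show pr: "prim UNIV q p" and V: "c \<le> V (q t)" for t using assms by (auto simp: near_min_def curve_def)
  have "m\<^sub>c + ennreal \<epsilon> < \<infinity>" using assms by (simp add: near_min_def)
  then show fin: "act UNIV q p < \<infinity>" using assms by (auto simp: near_min_def intro: le_less_trans)
  then have "act {s..t} q p < \<infinity>" by (rule le_less_trans[rotated]) (rule act_mono, simp)
  then show int: "lagr q p integrable_on {s..t}"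
    by (rule lagr_integrable_if_act_finite[OF pr V])
  show "act {s..t} q p = ennreal (integral {s..t} (lagr q p))"
    by (rule act_eq_integral[OF int V])
  show "0 \<le> integral {s..t} (lagr q p)"
    by (rule integral_nonneg[OF int]) (rule lagr_nonneg[OF V])
qed

lemma near_min_total:
  assumes "near_min \<epsilon> q p"
  shows "integral {s..t} (lagr q p) \<le> enn2real m\<^sub>c + \<epsilon>"
proof -
  have *: "m\<^sub>c < \<infinity>" "0 \<le> \<epsilon>" using assms by (auto simp: near_min_def)
  have "ennreal (integral {s..t} (lagr q p)) \<le> act UNIV q p"
    using near_min_basic(4)[OF assms, of s t] act_mono[of "{s..t}" UNIV q p] by simp
  also have "\<dots> \<le> ennreal (enn2real m\<^sub>c + \<epsilon>)"
  proof -
    have "ennreal (enn2real m\<^sub>c + \<epsilon>) = m\<^sub>c + ennreal \<epsilon>"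
      using * by (simp add: ennreal_plus)
    then show ?thesis using assms by (simp add: near_min_def)
  qed
  finally show ?thesis using *(2) by (subst (asm) ennreal_le_iff) auto
qed

lemma act_split:
  assumes "prim UNIV q p" "s \<le> t"
  shows "act UNIV q p = act {..s} q p + act {s..t} q p + act {t..} q p"
proof -
  have 1: "act {..s} q p = act {..<s} q p"
    by (rule act_AE) (use AE_neq[of s] in \<open>auto elim!: eventually_mono\<close>)
  have 2: "act {t..} q p = act {t<..} q p"
    by (rule act_AE) (use AE_neq[of t] in \<open>auto elim!: eventually_mono\<close>)
  have "UNIV = {..<s} \<union> ({s..t} \<union> {t<..})" using assms(2) by auto
  then have "act UNIV q p = act ({..<s} \<union> ({s..t} \<union> {t<..})) q p" by simp
  also have "\<dots> = act {..<s} q p + (act {s..t} q p + act {t<..} q p)"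
    using assms(2) by (subst act_Un[OF assms(1)], simp, simp, force, subst act_Un[OF assms(1)]) auto
  finally show ?thesis by (simp add: 1 2 add.assoc)
qed

text \<open>Outside \<open>{s..t}\<close> the competitor follows \<open>q\<close>, so these parts
  occur on both sides and cancel, their action being finite. At a contact point it may instead rest
  forever at zero cost, which only lowers its action.\<close>

lemma near_min_competitor:
  assumes nm: "near_min \<epsilon> q p" and st: "s \<le> t"
    and \<sigma>: "prim {0..\<tau>} \<sigma> \<sigma>'" "continuous_on {0..\<tau>} \<sigma>'" "0 \<le> \<tau>"
      "\<And>r. r \<in> {0..\<tau>} \<Longrightarrow> c \<le> V (\<sigma> r)"
    and start: "\<sigma> 0 = q s \<or> (\<sigma> 0 \<in> Vm \<and> V (\<sigma> 0) = c)"
    and finish: "\<sigma> \<tau> = q t \<or> (\<sigma> \<tau> \<in> Vp \<and> V (\<sigma> \<tau>) = c)"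
  shows "integral {s..t} (lagr q p) \<le> integral {0..\<tau>} (lagr \<sigma> \<sigma>') + \<epsilon>"
proof -
  note b = near_min_basic[OF nm]
  define S where "S = integral {0..\<tau>} (lagr \<sigma> \<sigma>')"
  have S: "0 \<le> S" unfolding S_def
    by (rule integral_nonneg[OF integrable_continuous_interval[OF lagr_continuous[OF \<sigma>(1-3)]]])
       (use lagr_nonneg \<sigma>(4) in auto)
  have *: "m\<^sub>c < \<infinity>" "0 \<le> \<epsilon>" "act UNIV q p \<le> m\<^sub>c + ennreal \<epsilon>" "curve q p" "starts q" "ends q"
    using nm by (auto simp: near_min_def)
  have "m\<^sub>c \<le> act {..s} q p + ennreal S + act {t..} q p"
  proof -
    obtain q1 p1 where q1: "curve q1 p1" "starts q1" "\<sigma> 0 = q1 s" "act {..s} q1 p1 \<le> act {..s} q p"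
      using start
    proof
      assume "\<sigma> 0 \<in> Vm \<and> V (\<sigma> 0) = c"
      then show ?thesis
        by (intro that[of "\<lambda>_. \<sigma> 0" "\<lambda>_. 0"]) (auto simp: curve_const starts_const act_const)
    qed (use that * in blast)
    obtain q2 p2 where q2: "curve q2 p2" "ends q2" "\<sigma> \<tau> = q2 t" "act {t..} q2 p2 \<le> act {t..} q p"
      using finish
    proof
      assume "\<sigma> \<tau> \<in> Vp \<and> V (\<sigma> \<tau>) = c"
      then show ?thesis
        by (intro that[of "\<lambda>_. \<sigma> \<tau>" "\<lambda>_. 0"]) (auto simp: curve_const ends_const act_const)
    qed (use that * in blast)
    have "m\<^sub>c \<le> act {..s} q1 p1 + ennreal S + act {t..} q2 p2"
      unfolding S_def by (rule glue_bound[OF q1(1,2) q2(1,2) \<sigma> q1(3) q2(3)])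
    then show ?thesis using q1(4) q2(4) by (meson add_mono order_refl order_trans)
  qed
  then have "act UNIV q p \<le> (act {..s} q p + ennreal S + act {t..} q p) + ennreal \<epsilon>"
    using *(3) by (meson add_mono order_refl order_trans)
  then have "act {..s} q p + act {t..} q p + act {s..t} q p
      \<le> act {..s} q p + act {t..} q p + (ennreal S + ennreal \<epsilon>)"
    unfolding act_split[OF b(1) st] by (simp add: ac_simps)
  moreover have "act {..s} q p + act {t..} q p \<noteq> \<infinity>"
  proof -
    have "act {..s} q p \<noteq> \<infinity>" "act {t..} q p \<noteq> \<infinity>"
      using b(6) act_mono[of "{..s}" UNIV q p] act_mono[of "{t..}" UNIV q p] by (auto simp: top_unique)
    then show ?thesis by simp
  qed
  ultimately have "act {s..t} q p \<le> ennreal S + ennreal \<epsilon>"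
    by (simp add: ennreal_add_left_cancel_le)
  then have "ennreal (integral {s..t} (lagr q p)) \<le> ennreal (S + \<epsilon>)"
    using S *(2) by (simp add: b(4))
  then have "integral {s..t} (lagr q p) \<le> S + \<epsilon>"
    by (subst (asm) ennreal_le_iff) (use S *(2) in auto)
  then show ?thesis by (simp add: S_def)
qed

section \<open>Straight segments as competitors and Jensen's inequality\<close>

definition seg :: "'a \<Rightarrow> 'a \<Rightarrow> real \<Rightarrow> real \<Rightarrow> 'a" where
  "seg x y \<tau> r = x + (r / \<tau>) *\<^sub>R (y - x)"

definition seg' :: "'a \<Rightarrow> 'a \<Rightarrow> real \<Rightarrow> real \<Rightarrow> 'a" where
  "seg' x y \<tau> r = (1 / \<tau>) *\<^sub>R (y - x)"

lemma seg_ends [simp]: "seg x y \<tau> 0 = x" "\<tau> \<noteq> 0 \<Longrightarrow> seg x y \<tau> \<tau> = y"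
  by (simp_all add: seg_def)

lemma seg_derivative: "(seg x y \<tau> has_vector_derivative seg' x y \<tau> r) (at r within S)"
  unfolding seg_def[abs_def] seg'_def divide_inverse by (auto intro!: derivative_eq_intros)

lemma seg'_continuous: "continuous_on S (seg' x y \<tau>)"
  unfolding seg'_def[abs_def] by (intro continuous_intros)

lemma prim_seg: "prim I (seg x y \<tau>) (seg' x y \<tau>)"
  by (rule prim_of_C1[OF seg_derivative seg'_continuous])

lemma seg_in_segment:
  assumes "0 < \<tau>" "r \<in> {0..\<tau>}" shows "seg x y \<tau> r \<in> closed_segment x y"
proof -
  have "0 \<le> r / \<tau>" "r / \<tau> \<le> 1" using assms by auto
  then show ?thesis
    unfolding seg_def closed_segment_def by (auto intro!: exI[of _ "r / \<tau>"] simp: algebra_simps)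
qed

lemma lagr_seg:
  assumes "0 < \<tau>" "\<And>z. z \<in> closed_segment x y \<Longrightarrow> V z - c \<le> B"
  shows "integral {0..\<tau>} (lagr (seg x y \<tau>) (seg' x y \<tau>)) \<le> \<tau> * (\<Phi> (norm (y - x) / \<tau>) + B)"
proof -
  have "lagr (seg x y \<tau>) (seg' x y \<tau>) r \<le> \<Phi> (norm (y - x) / \<tau>) + B" if "r \<in> {0..\<tau>}" for r
    using assms(2)[OF seg_in_segment[OF assms(1) that]] assms(1) by (simp add: lagr_def seg'_def)
  then have "integral {0..\<tau>} (lagr (seg x y \<tau>) (seg' x y \<tau>)) \<le> integral {0..\<tau>} (\<lambda>_. \<Phi> (norm (y - x) / \<tau>) + B)"
    using assms(1)
    by (intro integral_le integrable_continuous_interval lagr_continuous prim_seg seg'_continuous continuous_intros) auto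
  then show ?thesis using assms(1) by simp
qed

lemma near_min_segment_competitor:
  assumes "near_min \<epsilon> q p" "s \<le> t" "0 < \<tau>"
    and "\<And>z. z \<in> closed_segment x y \<Longrightarrow> c \<le> V z"
    and "\<And>z. z \<in> closed_segment x y \<Longrightarrow> V z - c \<le> B"
    and "x = q s \<or> (x \<in> Vm \<and> V x = c)" "y = q t \<or> (y \<in> Vp \<and> V y = c)"
  shows "integral {s..t} (lagr q p) \<le> \<tau> * (\<Phi> (norm (y - x) / \<tau>) + B) + \<epsilon>"
proof -
  have "integral {s..t} (lagr q p) \<le> integral {0..\<tau>} (lagr (seg x y \<tau>) (seg' x y \<tau>)) + \<epsilon>"
    using assms(3-) by (intro near_min_competitor[OF assms(1,2)] prim_seg seg'_continuous)
      (auto intro!: assms(4) seg_in_segment)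
  moreover have "integral {0..\<tau>} (lagr (seg x y \<tau>) (seg' x y \<tau>)) \<le> \<tau> * (\<Phi> (norm (y - x) / \<tau>) + B)"
    by (rule lagr_seg[OF assms(3)]) (rule assms(5))
  ultimately show ?thesis by linarith
qed

lemma near_min_segment:
  assumes "near_min \<epsilon> q p" "s \<le> t" "0 < \<tau>"
    and "\<And>z. z \<in> closed_segment (q s) (q t) \<Longrightarrow> c \<le> V z"
    and "\<And>z. z \<in> closed_segment (q s) (q t) \<Longrightarrow> V z - c \<le> B"
  shows "integral {s..t} (lagr q p) \<le> \<tau> * (\<Phi> (norm (q t - q s) / \<tau>) + B) + \<epsilon>"
  by (rule near_min_segment_competitor[OF assms]) auto

text \<open>Integrate the tangent inequality for \<open>\<Phi> \<circ> norm\<close> at the mean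
  velocity \<open>w\<close>; the linear term depends on the end points only.\<close>

lemma lagr_Jensen:
  assumes "prim UNIV q p" "lagr q p integrable_on {s..t}" "s < t"
  shows "(t - s) * \<Phi> (norm (q t - q s) / (t - s)) + integral {s..t} (\<lambda>r. V (q r) - c)
    \<le> integral {s..t} (lagr q p)"
proof -
  define w where "w = (1 / (t - s)) *\<^sub>R (q t - q s)"
  have nw: "norm w = norm (q t - q s) / (t - s)" using assms(3) by (simp add: w_def)
  have Vi: "(\<lambda>r. V (q r) - c) integrable_on {s..t}"
    by (intro integrable_continuous_interval continuous_intros continuous_on_compose2[OF V_cont[of UNIV]]
        continuous_on_subset[OF prim_continuous_on_UNIV[OF assms(1)]]) auto
  have p: "(p has_integral q t - q s) {s..t}" using primD(4)[OF assms(1), of s t] assms(3) by simp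
  have "((\<lambda>r. momentum w \<bullet> p r) has_integral momentum w \<bullet> (q t - q s)) {s..t}"
    using has_integral_linear[OF p bounded_linear_inner_right[of "momentum w"]] by (simp add: o_def)
  moreover have "((\<lambda>r. \<Phi> (norm w) - momentum w \<bullet> w) has_integral (t - s) * (\<Phi> (norm w) - momentum w \<bullet> w)) {s..t}"
    using has_integral_const_real[of "\<Phi> (norm w) - momentum w \<bullet> w" s t] assms(3) by simp
  ultimately have "((\<lambda>r. (\<Phi> (norm w) - momentum w \<bullet> w) + momentum w \<bullet> p r) has_integral
      (t - s) * (\<Phi> (norm w) - momentum w \<bullet> w) + momentum w \<bullet> (q t - q s)) {s..t}"
    by (intro has_integral_add)
  moreover have "momentum w \<bullet> (q t - q s) = (t - s) * (momentum w \<bullet> w)"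
    using assms(3) by (simp add: w_def)
  ultimately have h: "((\<lambda>r. (\<Phi> (norm w) - momentum w \<bullet> w) + momentum w \<bullet> p r) has_integral (t - s) * \<Phi> (norm w)) {s..t}"
    by (simp add: algebra_simps)
  from has_integral_add[OF h integrable_integral[OF Vi]]
  have "((\<lambda>r. ((\<Phi> (norm w) - momentum w \<bullet> w) + momentum w \<bullet> p r) + (V (q r) - c)) has_integral
      (t - s) * \<Phi> (norm w) + integral {s..t} (\<lambda>r. V (q r) - c)) {s..t}" .
  moreover have "((\<Phi> (norm w) - momentum w \<bullet> w) + momentum w \<bullet> p r) + (V (q r) - c) \<le> lagr q p r" for r
    using Phi_norm_convex[of w "p r"] by (simp add: lagr_def inner_diff_right)
  ultimately show ?thesis
    using has_integral_le[OF _ integrable_integral[OF assms(2)]] by (simp add: nw)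
qed

text \<open>Combining Jensen's inequality with the tangent bound \<open>Phi_ge_linear\<close> gives
  one estimate for each slope parameter \<open>a\<close>. The curve enters only through
  \<open>\<epsilon>\<close>, so the family of estimates is an equicontinuity statement.\<close>

lemma near_min_modulus:
  assumes "near_min \<epsilon> q p" "s \<le> t" "0 \<le> a"
  shows "A a * norm (q t - q s) \<le> enn2real m\<^sub>c + \<epsilon> + G a * (t - s)"
proof (cases "s = t")
  case True
  then show ?thesis using assms(1) by (simp add: near_min_def)
next
  case False
  then have st: "s < t" using assms(2) by simp
  note b = near_min_basic[OF assms(1)]
  have "0 \<le> integral {s..t} (\<lambda>r. V (q r) - c)"
    by (intro integral_nonneg integrable_continuous_interval continuous_intros continuous_on_compose2[OF V_cont[of UNIV]]
        continuous_on_subset[OF prim_continuous_on_UNIV[OF b(1)]]) (auto simp: b(2))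
  then have "(t - s) * \<Phi> (norm (q t - q s) / (t - s)) \<le> enn2real m\<^sub>c + \<epsilon>"
    using lagr_Jensen[OF b(1,3) st] near_min_total[OF assms(1), of s t] by linarith
  moreover have "(t - s) * (A a * (norm (q t - q s) / (t - s)) - G a)
      \<le> (t - s) * \<Phi> (norm (q t - q s) / (t - s))"
    by (intro mult_left_mono Phi_ge_linear) (use assms st in auto)
  moreover have "(t - s) * (A a * (norm (q t - q s) / (t - s)) - G a) = A a * norm (q t - q s) - G a * (t - s)"
    using st by (simp add: field_simps)
  ultimately show ?thesis by linarith
qed

section \<open>Geometry of the two sublevel sets\<close>

definition \<delta> :: real where "\<delta> = setdist Vm Vp"

lemma delta_pos: "0 < \<delta>"
  using setdist_pos by (simp add: \<delta>_def)

lemma delta_le_dist: "x \<in> Vm \<Longrightarrow> y \<in> Vp \<Longrightarrow> \<delta> \<le> dist x y"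
  unfolding \<delta>_def by (rule setdist_le_dist)

lemma delta_le_infdist_Vp:
  assumes "x \<in> Vm" shows "\<delta> \<le> infdist x Vp"
  using setdist_subset_left[of "{x}" Vm Vp] assms by (simp add: \<delta>_def infdist_eq_setdist)

lemma delta_le_infdist_Vm:
  assumes "x \<in> Vp" shows "\<delta> \<le> infdist x Vm"
  using setdist_subset_left[of "{x}" Vp Vm] assms by (simp add: \<delta>_def infdist_eq_setdist setdist_sym)

lemma delta_le_infdist_sum: "\<delta> \<le> infdist x Vm + infdist x Vp"
proof -
  have "\<delta> - infdist x Vp \<le> infdist x Vm"
    unfolding infdist_notempty[OF Vm_ne]
  proof (rule cINF_greatest[OF Vm_ne])
    fix a assume "a \<in> Vm"
    then show "\<delta> - infdist x Vp \<le> dist x a"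
      using delta_le_infdist_Vp[of a] infdist_triangle[of a Vp x] by (simp add: dist_commute)
  qed
  then show ?thesis by simp
qed

lemma closed_sublevel: "closed {x. V x \<le> c}"
  using continuous_closed_preimage[OF V_cont[of UNIV] closed_UNIV closed_atMost[of c]]
  by (simp add: vimage_def)

text \<open>The positive gap identifies this set as the part of the closed sublevel set at distance
  at least \<open>\<delta>\<close> from \<open>Vp\<close>, a closed condition.\<close>

lemma closed_Vm: "closed Vm"
proof -
  have "Vm = {x. V x \<le> c} \<inter> {x. \<delta> \<le> infdist x Vp}"
    using delta_le_infdist_Vp delta_pos sublevel by (auto simp: not_le)
  moreover have "closed {x. \<delta> \<le> infdist x Vp}"
    by (intro closed_Collect_le continuous_intros)
  ultimately show ?thesis using closed_sublevel by (metis closed_Int)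
qed

lemma closed_Vp: "closed Vp"
proof -
  have "Vp = {x. V x \<le> c} \<inter> {x. \<delta> \<le> infdist x Vm}"
    using delta_le_infdist_Vm delta_pos sublevel by (auto simp: not_le)
  moreover have "closed {x. \<delta> \<le> infdist x Vm}"
    by (intro closed_Collect_le continuous_intros)
  ultimately show ?thesis using closed_sublevel by (metis closed_Int)
qed

lemma segment_above:
  assumes "\<And>z. z \<in> open_segment x y \<Longrightarrow> c < V z" "x \<noteq> y" "z \<in> closed_segment x y"
  shows "c \<le> V z"
proof -
  have "closed {z. c \<le> V z}"
    using continuous_closed_preimage[OF V_cont[of UNIV] closed_UNIV closed_atLeast[of c]]
    by (simp add: vimage_def)
  then have "closure (open_segment x y) \<subseteq> {z. c \<le> V z}"
    using assms(1) by (intro closure_minimal) (auto simp: less_imp_le)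
  then show ?thesis using assms(2,3) by auto
qed

text \<open>The witness is the point of the sublevel set on the segment that is nearest to
  \<open>x\<close>, that is, the first contact. Stopping there keeps a competitor in the region
  \<open>c \<le> V\<close>.\<close>

lemma reach_sublevel:
  assumes "c \<le> V x" "V y0 \<le> c"
  obtains y where "y \<in> closed_segment x y0" "V y = c" "\<And>z. z \<in> closed_segment x y \<Longrightarrow> c \<le> V z"
proof -
  have "compact (closed_segment x y0 \<inter> {z. V z \<le> c})"
    by (intro compact_Int_closed closed_sublevel compact_segment)
  moreover have "closed_segment x y0 \<inter> {z. V z \<le> c} \<noteq> {}" using assms(2) by auto
  moreover have "continuous_on (closed_segment x y0 \<inter> {z. V z \<le> c}) (dist x)"
    by (intro continuous_intros)
  ultimately obtain y where "y \<in> closed_segment x y0 \<inter> {z. V z \<le> c}"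
    "\<forall>z\<in>closed_segment x y0 \<inter> {z. V z \<le> c}. dist x y \<le> dist x z"
    using continuous_attains_inf by blast
  then have y: "y \<in> closed_segment x y0" "V y \<le> c"
    "\<And>z. z \<in> closed_segment x y0 \<Longrightarrow> V z \<le> c \<Longrightarrow> dist x y \<le> dist x z"
    by auto
  have above: "c \<le> V z" if "z \<in> closed_segment x y" for z
  proof (cases "x = y")
    case False
    show ?thesis
    proof (rule segment_above[OF _ False that])
      fix z assume z: "z \<in> open_segment x y"
      then have "z \<in> closed_segment x y0"
        using y(1) by (meson closed_segment_subset convex_closed_segment ends_in_segment(1) open_closed_segment subsetD)
      moreover have "dist x z < dist x y"
        using dist_in_open_segment[OF z] by (simp add: dist_commute)
      ultimately show "c < V z" using y(3)[of z] by force
    qed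
  qed (use that assms(1) in simp)
  show ?thesis
  proof (rule that[OF y(1) _ above])
    show "V y = c" using y(2) above[of y] by (intro antisym) auto
  qed
qed

text \<open>On a segment joining the two sets, take a closest pair of points of \<open>Vm\<close>
  and \<open>Vp\<close>: a point of the sublevel set strictly between them would produce a closer
  pair. The result makes \<open>m\<^sub>c\<close> finite.\<close>

lemma crossing_segment:
  obtains x y where "x \<in> Vm" "y \<in> Vp" "V x = c" "V y = c" "\<And>z. z \<in> closed_segment x y \<Longrightarrow> c \<le> V z"
proof -
  obtain x0 y0 where "x0 \<in> Vm" "y0 \<in> Vp" using Vm_ne Vp_ne by blast
  define S where "S = closed_segment x0 y0"
  have "compact ((S \<inter> Vm) \<times> (S \<inter> Vp))"
    unfolding S_def by (intro compact_Times compact_Int_closed closed_Vm closed_Vp compact_segment)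
  moreover have "(S \<inter> Vm) \<times> (S \<inter> Vp) \<noteq> {}" using \<open>x0 \<in> Vm\<close> \<open>y0 \<in> Vp\<close> by (auto simp: S_def)
  moreover have "continuous_on ((S \<inter> Vm) \<times> (S \<inter> Vp)) (\<lambda>z. dist (fst z) (snd z))"
    by (intro continuous_intros)
  ultimately obtain w where w: "w \<in> (S \<inter> Vm) \<times> (S \<inter> Vp)"
    "\<forall>z\<in>(S \<inter> Vm) \<times> (S \<inter> Vp). dist (fst w) (snd w) \<le> dist (fst z) (snd z)"
    using continuous_attains_inf[of "(S \<inter> Vm) \<times> (S \<inter> Vp)" "\<lambda>z. dist (fst z) (snd z)"] by metis
  define x y where "x = fst w" and "y = snd w"
  have xy: "x \<in> S" "x \<in> Vm" "y \<in> S" "y \<in> Vp" using w(1) by (auto simp: x_def y_def)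
  have min: "dist x y \<le> dist u v" if "u \<in> S" "u \<in> Vm" "v \<in> S" "v \<in> Vp" for u v
    using w(2) that unfolding x_def y_def by force
  have "x \<noteq> y" using delta_le_dist[OF xy(2,4)] delta_pos by auto
  have above: "c \<le> V z" if "z \<in> closed_segment x y" for z
  proof (rule segment_above[OF _ \<open>x \<noteq> y\<close> that])
    fix z assume z: "z \<in> open_segment x y"
    then have zS: "z \<in> S"
      using xy(1,3) unfolding S_def
      by (meson closed_segment_subset convex_closed_segment open_closed_segment subsetD)
    have "dist z y < dist x y" "dist x z < dist x y"
      using dist_in_open_segment[OF z] by (auto simp: dist_commute)
    then have "z \<notin> Vm" "z \<notin> Vp" using min[OF zS _ xy(3,4)] min[OF xy(1,2) zS] by (meson not_le)+
    then show "c < V z" using sublevel by (metis Un_iff mem_Collect_eq not_le)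
  qed
  moreover have "V x \<le> c" "V y \<le> c" using xy(2,4) sublevel by auto
  ultimately have "V x = c" "V y = c" by (auto intro: antisym)
  then show ?thesis using that xy(2,4) above by blast
qed

lemma m_finite: "m\<^sub>c < \<infinity>"
proof -
  obtain x y where xy: "x \<in> Vm" "y \<in> Vp" "V x = c" "V y = c" "\<And>z. z \<in> closed_segment x y \<Longrightarrow> c \<le> V z"
    using crossing_segment by metis
  have "m\<^sub>c \<le> act {..0} (\<lambda>_. x) (\<lambda>_. 0) + ennreal (integral {0..1} (lagr (seg x y 1) (seg' x y 1)))
      + act {0..} (\<lambda>_. y) (\<lambda>_. 0)"
  proof (intro glue_bound prim_seg seg'_continuous)
    show "c \<le> V (seg x y 1 r)" if "r \<in> {0..1}" for r
      by (rule xy(5)[OF seg_in_segment[OF zero_less_one that]])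
  qed (use xy in \<open>simp_all add: curve_const starts_const ends_const\<close>)
  also have "\<dots> < \<infinity>" using xy by (simp add: act_const)
  finally show ?thesis .
qed

text \<open>Close to \<open>Vp\<close> the rest of the curve can be replaced by a segment of length
  below \<open>d\<close>, traversed in time \<open>d\<close> and hence with speed at most 1,
  followed by rest at the contact point. The bound does not depend on \<open>t\<close>.\<close>

lemma near_min_right_tail:
  assumes nm: "near_min \<epsilon> q p" and st: "s \<le> t" and d: "0 < d" "d \<le> \<delta>"
    and B: "\<And>z. z \<in> ball (q s) d \<Longrightarrow> V z - c \<le> B" and near: "infdist (q s) Vp < d"
  shows "integral {s..t} (lagr q p) \<le> d * (\<Phi> 1 + B) + \<epsilon>"
proof -
  obtain y0 where y0: "y0 \<in> Vp" "infdist (q s) Vp = dist (q s) y0"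
    using infdist_attains_inf[OF closed_Vp Vp_ne] by blast
  have "V y0 \<le> c" using y0 sublevel by auto
  from reach_sublevel[OF near_min_basic(2)[OF nm] this]
  obtain y where y: "y \<in> closed_segment (q s) y0" "V y = c" "\<And>z. z \<in> closed_segment (q s) y \<Longrightarrow> c \<le> V z"
    by blast
  have dy: "dist (q s) y < d" "dist y y0 < d"
    using dist_in_closed_segment[OF y(1)] y0 near by (auto simp: dist_commute)
  \<comment> \<open>The contact point lies within \<open>d \<le> \<delta>\<close> of a point of
    \<open>Vp\<close>, too close to belong to the other set.\<close>
  have "y \<notin> Vm" using delta_le_dist[of y y0] y0(1) dy(2) d by auto
  then have "y \<in> Vp" using y(2) sublevel by auto
  have ball: "z \<in> ball (q s) d" if "z \<in> closed_segment (q s) y" for z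
    using dist_in_closed_segment[OF that] dy(1) by (simp add: dist_commute)
  have "integral {s..t} (lagr q p) \<le> d * (\<Phi> (norm (y - q s) / d) + B) + \<epsilon>"
    using y \<open>y \<in> Vp\<close>
    by (intro near_min_segment_competitor[OF nm st d(1)] B ball) (auto simp: closed_segment_commute)
  also have "\<dots> \<le> d * (\<Phi> 1 + B) + \<epsilon>"
    using dy d by (intro add_right_mono mult_left_mono Phi_mono) (auto simp: dist_norm norm_minus_commute)
  finally show ?thesis .
qed

lemma near_min_left_tail:
  assumes nm: "near_min \<epsilon> q p" and st: "s \<le> t" and d: "0 < d" "d \<le> \<delta>"
    and B: "\<And>z. z \<in> ball (q t) d \<Longrightarrow> V z - c \<le> B" and near: "infdist (q t) Vm < d"
  shows "integral {s..t} (lagr q p) \<le> d * (\<Phi> 1 + B) + \<epsilon>"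
proof -
  obtain y0 where y0: "y0 \<in> Vm" "infdist (q t) Vm = dist (q t) y0"
    using infdist_attains_inf[OF closed_Vm Vm_ne] by blast
  have "V y0 \<le> c" using y0 sublevel by auto
  from reach_sublevel[OF near_min_basic(2)[OF nm] this]
  obtain y where y: "y \<in> closed_segment (q t) y0" "V y = c" "\<And>z. z \<in> closed_segment (q t) y \<Longrightarrow> c \<le> V z"
    by blast
  have dy: "dist (q t) y < d" "dist y y0 < d"
    using dist_in_closed_segment[OF y(1)] y0 near by (auto simp: dist_commute)
  have "y \<notin> Vp" using delta_le_dist[of y0 y] y0(1) dy(2) d by (auto simp: dist_commute)
  then have "y \<in> Vm" using y(2) sublevel by auto
  have ball: "z \<in> ball (q t) d" if "z \<in> closed_segment y (q t)" for z
    using dist_in_closed_segment[of z "q t" y] that dy(1)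
    by (simp add: dist_commute closed_segment_commute)
  have "integral {s..t} (lagr q p) \<le> d * (\<Phi> (norm (q t - y) / d) + B) + \<epsilon>"
    using y \<open>y \<in> Vm\<close>
    by (intro near_min_segment_competitor[OF nm st d(1)] B ball) (auto simp: closed_segment_commute)
  also have "\<dots> \<le> d * (\<Phi> 1 + B) + \<epsilon>"
    using dy d by (intro add_right_mono mult_left_mono Phi_mono) (auto simp: dist_norm norm_minus_commute)
  finally show ?thesis .
qed

end

section \<open>Regularity and energy of the limit curve\<close>

lemma average_tendsto:
  fixes f :: "real \<Rightarrow> 'a::euclidean_space"
  assumes f: "continuous_on {a..b} f" and t: "a \<le> t" "t < b"
    and h: "\<And>k. 0 < h k" "h \<longlonglongrightarrow> 0"
  shows "(\<lambda>k. (1 / h k) *\<^sub>R integral {t..t + h k} f) \<longlonglongrightarrow> f t"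
proof (rule LIMSEQ_I)
  fix r :: real assume "r > 0"
  have "t \<in> {a..b}" using t by simp
  then obtain d where d: "d > 0" "\<And>s. s \<in> {a..b} \<Longrightarrow> dist s t < d \<Longrightarrow> dist (f s) (f t) < r / 2"
    using f \<open>r > 0\<close> unfolding continuous_on_iff by (metis half_gt_zero)
  have "\<forall>\<^sub>F k in sequentially. h k < min d (b - t)"
    using h(2) d(1) t by (intro order_tendstoD) auto
  then obtain n0 where n0: "\<And>k. k \<ge> n0 \<Longrightarrow> h k < min d (b - t)" by (auto simp: eventually_sequentially)
  show "\<exists>n0. \<forall>k\<ge>n0. norm ((1 / h k) *\<^sub>R integral {t..t + h k} f - f t) < r"
  proof (intro exI allI impI)
    fix k assume k: "k \<ge> n0"
    have sub: "{t..t + h k} \<subseteq> {a..b}" using n0[OF k] t by auto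
    have fi: "f integrable_on {t..t + h k}"
      by (intro integrable_continuous_interval continuous_on_subset[OF f sub])
    have "norm (integral {t..t + h k} f - h k *\<^sub>R f t) = norm (integral {t..t + h k} (\<lambda>s. f s - f t))"
      using integral_diff[OF fi integrable_const_ivl[of "f t"]] h(1)[of k] by simp
    also have "\<dots> \<le> integral {t..t + h k} (\<lambda>_. r / 2)"
    proof (rule integral_norm_bound_integral)
      fix s assume s: "s \<in> {t..t + h k}"
      have "dist (f s) (f t) < r / 2"
        by (rule d(2)) (use s sub n0[OF k] in \<open>auto simp: dist_real_def\<close>)
      then show "norm (f s - f t) \<le> r / 2" by (simp add: dist_norm)
    qed (use fi in \<open>auto intro: integrable_diff\<close>)
    also have "\<dots> = h k * (r / 2)" using h(1)[of k] by simp
    finally have "norm (integral {t..t + h k} f - h k *\<^sub>R f t) \<le> h k * (r / 2)" .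
    then have "(1 / h k) * norm (integral {t..t + h k} f - h k *\<^sub>R f t) \<le> r / 2"
      using h(1)[of k] by (simp add: field_simps)
    moreover have "(1 / h k) *\<^sub>R integral {t..t + h k} f - f t = (1 / h k) *\<^sub>R (integral {t..t + h k} f - h k *\<^sub>R f t)"
      using h(1)[of k] by (simp add: scaleR_diff_right)
    then have "norm ((1 / h k) *\<^sub>R integral {t..t + h k} f - f t) = (1 / h k) * norm (integral {t..t + h k} f - h k *\<^sub>R f t)"
      using h(1)[of k] by (metis abs_of_pos divide_pos_pos norm_scaleR zero_less_one)
    ultimately have "norm ((1 / h k) *\<^sub>R integral {t..t + h k} f - f t) \<le> r / 2" by simp
    then show "norm ((1 / h k) *\<^sub>R integral {t..t + h k} f - f t) < r" using \<open>r > 0\<close> by simp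
  qed
qed

text \<open>Dyadic difference quotients form a geometrically convergent sequence.\<close>

lemma second_difference_imp_C1:
  fixes f :: "real \<Rightarrow> 'a::euclidean_space"
  assumes f: "continuous_on {a..b} f" and ab: "a < b'" "b' < b" and h0: "0 < h0" and K: "0 \<le> K"
    and sd: "\<And>s h. a \<le> s \<Longrightarrow> s + h \<le> b \<Longrightarrow> 0 < h \<Longrightarrow> h < h0 \<Longrightarrow>
      norm (f (s + h) - 2 *\<^sub>R f (s + h / 2) + f s) \<le> K * h * sqrt h"
  obtains p where "continuous_on {a..b'} p"
    "\<And>t. t \<in> {a<..<b'} \<Longrightarrow> (f has_vector_derivative p t) (at t)"
proof -
  \<comment> \<open>The step stays below \<open>b - b'\<close>, so that forward quotients from any
    point of \<open>{a..b'}\<close> remain in \<open>{a..b}\<close>.\<close>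
  define h1 where "h1 = min h0 (b - b') / 2"
  have h1: "0 < h1" "h1 < h0" "h1 < b - b'" using h0 ab by (auto simp: h1_def min_def)
  define h where "h k = h1 * (1 / 2) ^ k" for k :: nat
  have h: "0 < h k" "h k \<le> h1" "h (Suc k) = h k / 2" for k
    using h1 by (auto simp: h_def mult_le_cancel_left1 power_le_one)
  have h_lim: "h \<longlonglongrightarrow> 0"
    unfolding h_def[abs_def] by (intro tendsto_mult_right_zero LIMSEQ_power_zero) simp
  define g where "g k t = (1 / h k) *\<^sub>R (f (t + h k) - f t)" for k t
  have g_cont: "continuous_on {a..b'} (g k)" for k
    unfolding g_def[abs_def] using h[of k] h1 ab
    by (intro continuous_intros continuous_on_compose2[OF f]) auto
  have step: "norm (g (Suc k) t - g k t) \<le> (K * sqrt h1) * (sqrt (1 / 2)) ^ k" if t: "t \<in> {a..b'}" for k t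
  proof -
    have "g (Suc k) t - g k t = (- (1 / h k)) *\<^sub>R (f (t + h k) - 2 *\<^sub>R f (t + h k / 2) + f t)"
    proof -
      have "(2 * e) *\<^sub>R (y - x) - e *\<^sub>R (z - x) = (- e) *\<^sub>R (z - 2 *\<^sub>R y + x)" for e and x y z :: 'a
      proof -
        have "(2 * e) *\<^sub>R x = e *\<^sub>R x + e *\<^sub>R x" by (simp flip: scaleR_left_distrib)
        then show ?thesis by (simp add: scaleR_diff_right scaleR_add_right mult.commute)
      qed
      from this[of "1 / h k" "f (t + h k / 2)" "f t" "f (t + h k)"] show ?thesis
        by (simp add: g_def h(3))
    qed
    then have "norm (g (Suc k) t - g k t) = (1 / h k) * norm (f (t + h k) - 2 *\<^sub>R f (t + h k / 2) + f t)"
      using h(1)[of k] by simp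
    also have "\<dots> \<le> (1 / h k) * (K * h k * sqrt (h k))"
      using t h[of k] h1 by (intro mult_left_mono sd) auto
    also have "\<dots> = K * sqrt (h k)" using h(1)[of k] by simp
    also have "\<dots> = (K * sqrt h1) * (sqrt (1 / 2)) ^ k"
      by (simp add: h_def real_sqrt_mult real_sqrt_power)
    finally show ?thesis .
  qed
  define p where "p t = g 0 t + suminf (\<lambda>k. g (Suc k) t - g k t)" for t
  have "uniform_limit {a..b'} (\<lambda>n t. \<Sum>k<n. g (Suc k) t - g k t) (\<lambda>t. suminf (\<lambda>k. g (Suc k) t - g k t)) sequentially"
  proof (rule Weierstrass_m_test[OF step])
    show "summable (\<lambda>k. K * sqrt h1 * sqrt (1 / 2) ^ k)"
      by (intro summable_mult summable_geometric) (simp add: real_sqrt_divide)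
  qed
  then have "uniform_limit {a..b'} (\<lambda>n t. g 0 t + (\<Sum>k<n. g (Suc k) t - g k t)) p sequentially"
    unfolding p_def by (intro uniform_limit_intros)
  moreover have "g 0 t + (\<Sum>k<n. g (Suc k) t - g k t) = g n t" for n t
    using sum_lessThan_telescope[of "\<lambda>k. g k t" n] by simp
  ultimately have ul: "uniform_limit {a..b'} g p sequentially" by simp
  have p_cont: "continuous_on {a..b'} p"
    by (rule uniform_limit_theorem[OF _ ul]) (auto simp: g_cont)
  \<comment> \<open>The quotients are one-sided and use dyadic steps only, so \<open>p\<close> is
    not yet known to be the derivative. Showing that \<open>p\<close> integrates to the increments
    of \<open>f\<close> settles this.\<close>
  have ftc: "integral {s..t} p = f t - f s" if st: "a \<le> s" "s \<le> t" "t \<le> b'" for s t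
  proof -
    have sub: "{s..t} \<subseteq> {a..b'}" using st by auto
    have "uniform_limit {s..t} g p sequentially" by (rule uniform_limit_on_subset[OF ul sub])
    from uniform_limit_integral[OF this continuous_on_subset[OF g_cont sub]]
    obtain I J where IJ: "\<And>n. (g n has_integral I n) {s..t}" "(p has_integral J) {s..t}" "I \<longlonglongrightarrow> J"
      by auto
    \<comment> \<open>Integrating a difference quotient telescopes to two short averages of
      \<open>f\<close>, one at each end of the interval.\<close>
    have "I n = (1 / h n) *\<^sub>R integral {t..t + h n} f - (1 / h n) *\<^sub>R integral {s..s + h n} f" for n
    proof -
      have fi: "f integrable_on {u..v}" if "a \<le> u" "v \<le> b" for u v
        by (rule integrable_continuous_interval[OF continuous_on_subset[OF f]]) (use that in auto)
      have le: "t + h n \<le> b" using h[of n] h1 st by simp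
      have "(f has_integral integral {s + h n..t + h n} f) {s + h n..t + h n}"
        using h[of n] st le by (intro integrable_integral fi) auto
      then have "((\<lambda>x. f (x + h n)) has_integral integral {s + h n..t + h n} f) {s..t}"
        by (rule has_integral_shift_real)
      then have "(g n has_integral (1 / h n) *\<^sub>R (integral {s + h n..t + h n} f - integral {s..t} f)) {s..t}"
        unfolding g_def[abs_def] using st ab
        by (intro has_integral_cmul has_integral_diff integrable_integral fi) auto
      then have "I n = (1 / h n) *\<^sub>R (integral {s + h n..t + h n} f - integral {s..t} f)"
        using IJ(1) has_integral_unique by blast
      moreover have "integral {s..t} f + integral {t..t + h n} f = integral {s..s + h n} f + integral {s + h n..t + h n} f"
      proof -
        have "f integrable_on {s..t + h n}" by (rule fi) (use st le in auto)
        then show ?thesis using h(1)[of n] st by (simp add: Henstock_Kurzweil_Integration.integral_combine)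
      qed
      then have "integral {s + h n..t + h n} f - integral {s..t} f
          = integral {t..t + h n} f - integral {s..s + h n} f"
        by (simp add: algebra_simps)
      ultimately show ?thesis by (simp add: scaleR_diff_right)
    qed
    moreover have "(\<lambda>n. (1 / h n) *\<^sub>R integral {t..t + h n} f - (1 / h n) *\<^sub>R integral {s..s + h n} f) \<longlonglongrightarrow> f t - f s"
      using st ab by (intro tendsto_diff average_tendsto[OF f] h h_lim) auto
    ultimately have "I \<longlonglongrightarrow> f t - f s" by presburger
    then show ?thesis using IJ(2,3) LIMSEQ_unique by (metis integral_unique)
  qed
  show ?thesis
  proof (rule that[OF p_cont])
    fix t assume t: "t \<in> {a<..<b'}"
    have "((\<lambda>u. f a + integral {a..u} p) has_vector_derivative 0 + p t) (at t within {a..b'})"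
      using t by (intro has_vector_derivative_add integral_has_vector_derivative p_cont) auto
    then have "((\<lambda>u. f a + integral {a..u} p) has_vector_derivative p t) (at t)"
      using t at_within_interior[of t "{a..b'}"] by simp
    then show "(f has_vector_derivative p t) (at t)"
    proof (rule has_vector_derivative_transform_within_open[where S="{a<..<b'}"])
      show "f a + integral {a..u} p = f u" if "u \<in> {a<..<b'}" for u
        using ftc[of a u] that by simp
    qed (use t in auto)
  qed
qed

context connection_problem
begin

text \<open>The inequality is assumed for every \<open>a\<close>, which permits two successive
  choices: \<open>a\<close> so large that \<open>A a\<close> beats the constant \<open>K\<close>,
  and then \<open>h\<close> small in proportion to \<open>A a / G a\<close>.\<close>

lemma modulus_small:
  assumes "0 < e" "0 \<le> K"
  obtains d where "0 < d"
    "\<And>r h. 0 \<le> h \<Longrightarrow> h < d \<Longrightarrow> (\<And>a. 0 \<le> a \<Longrightarrow> A a * r \<le> K + G a * h) \<Longrightarrow> r < e"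
proof -
  obtain a where a: "a > 0" "2 * K / e < A a" using A_unbounded by blast
  have Aa: "A a > 0" "G a > 0" using a A_pos G_pos by auto
  show ?thesis
  proof (rule that[of "A a * e / (2 * G a)"])
    show "0 < A a * e / (2 * G a)" using Aa assms by simp
    fix r h assume h: "0 \<le> h" "h < A a * e / (2 * G a)" and *: "\<And>a. 0 \<le> a \<Longrightarrow> A a * r \<le> K + G a * h"
    have "G a * h < A a * e / 2" using h Aa by (simp add: field_simps)
    moreover have "K < A a * e / 2" using a assms by (simp add: field_simps)
    ultimately have "A a * r < A a * e" using *[of a] a by simp
    then show "r < e" using Aa by simp
  qed
qed

lemma V_Lipschitz:
  obtains L where "0 < L" "\<And>x y. norm x \<le> B \<Longrightarrow> norm y \<le> B \<Longrightarrow> \<bar>V x - V y\<bar> \<le> L * norm (x - y)"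
proof -
  have "compact (gradient V ` cball 0 B)"
    by (intro compact_continuous_image continuous_on_subset[OF gradient_cont] compact_cball) simp
  from compact_imp_bounded[OF this]
  obtain L where L: "0 < L" "\<And>x. x \<in> cball 0 B \<Longrightarrow> norm (gradient V x) \<le> L"
    unfolding bounded_pos by blast
  show ?thesis
  proof (rule that[OF L(1)])
    fix x y :: 'a assume xy: "norm x \<le> B" "norm y \<le> B"
    have "norm (V x - V y) \<le> L * norm (x - y)"
    proof (rule differentiable_bound[of "cball 0 B" V "\<lambda>x h. gradient V x \<bullet> h" L])
      show "(V has_derivative (\<bullet>) (gradient V x)) (at x within cball 0 B)" for x
        using V_derivative has_derivative_at_withinI by blast
      show "onorm ((\<bullet>) (gradient V x)) \<le> L" if "x \<in> cball 0 B" for x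
      proof (rule onorm_le)
        fix h
        have "norm (gradient V x \<bullet> h) \<le> norm (gradient V x) * norm h" by (simp add: Cauchy_Schwarz_ineq2)
        also have "\<dots> \<le> L * norm h" using L(2)[OF that] by (intro mult_right_mono) auto
        finally show "norm (gradient V x \<bullet> h) \<le> L * norm h" .
      qed
    qed (use xy in auto)
    then show "\<bar>V x - V y\<bar> \<le> L * norm (x - y)" by simp
  qed
qed

end

text \<open>The situation after a convergent subsequence has been extracted; convergence is only
  pointwise. The condition \<open>middle\<close> keeps \<open>\<gamma> 0\<close> off both sublevel
  sets, so the limit is not trivial.\<close>

locale limit_curve = connection_problem \<phi> l V c Vm Vp
  for \<phi> l and V :: "'a::euclidean_space \<Rightarrow> real" and c Vm Vp +
  fixes q p :: "nat \<Rightarrow> real \<Rightarrow> 'a" and \<epsilon> :: "nat \<Rightarrow> real" and \<gamma> :: "real \<Rightarrow> 'a" and R :: real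
  assumes nm: "\<And>n. near_min (\<epsilon> n) (q n) (p n)"
    and eps: "\<epsilon> \<longlonglongrightarrow> 0" "\<And>n. \<epsilon> n \<le> 1"
    and q_bound: "\<And>n t. norm (q n t) \<le> R"
    and conv: "\<And>t. (\<lambda>n. q n t) \<longlonglongrightarrow> \<gamma> t"
    and middle: "\<And>n. infdist (q n 0) Vm = \<delta> / 2"
begin

section \<open>Elementary properties of the limit curve\<close>

lemma q_cont: "continuous_on S (q n)"
  using prim_continuous_on_UNIV[OF near_min_basic(1)[OF nm]] continuous_on_subset by blast

lemma gamma_bound: "norm (\<gamma> t) \<le> R"
  by (rule LIMSEQ_le_const2[OF tendsto_norm[OF conv]]) (use q_bound in auto)

lemma V_q_tendsto: "(\<lambda>n. V (q n t)) \<longlonglongrightarrow> V (\<gamma> t)"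
  using V_cont[of UNIV] conv by (auto intro: continuous_on_tendsto_compose)

lemma gamma_above: "c \<le> V (\<gamma> t)"
  by (rule LIMSEQ_le_const[OF V_q_tendsto]) (use near_min_basic(2)[OF nm] in auto)

lemma gamma_modulus:
  assumes "s \<le> t" "0 \<le> a"
  shows "A a * norm (\<gamma> t - \<gamma> s) \<le> enn2real m\<^sub>c + 1 + G a * (t - s)"
proof (rule LIMSEQ_le_const2)
  show "(\<lambda>n. A a * norm (q n t - q n s)) \<longlonglongrightarrow> A a * norm (\<gamma> t - \<gamma> s)"
    by (intro tendsto_intros conv)
  show "\<exists>N. \<forall>n\<ge>N. A a * norm (q n t - q n s) \<le> enn2real m\<^sub>c + 1 + G a * (t - s)"
  proof (intro exI allI impI)
    fix n
    show "A a * norm (q n t - q n s) \<le> enn2real m\<^sub>c + 1 + G a * (t - s)"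
      using near_min_modulus[OF nm[of n] assms] eps(2)[of n] by linarith
  qed
qed

lemma gamma_uniformly_continuous:
  assumes "0 < e"
  obtains d where "0 < d" "\<And>s t. \<bar>s - t\<bar> < d \<Longrightarrow> norm (\<gamma> t - \<gamma> s) < e"
proof -
  have "0 \<le> enn2real m\<^sub>c + 1" by (simp add: add_nonneg_nonneg)
  from modulus_small[OF assms this] obtain d where d: "0 < d"
    "\<And>r h. 0 \<le> h \<Longrightarrow> h < d \<Longrightarrow> (\<And>a. 0 \<le> a \<Longrightarrow> A a * r \<le> enn2real m\<^sub>c + 1 + G a * h) \<Longrightarrow> r < e"
    by blast
  have *: "norm (\<gamma> t - \<gamma> s) < e" if "s \<le> t" "t - s < d" for s t
    by (rule d(2)[OF _ that(2)]) (use that gamma_modulus in auto)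
  show ?thesis
  proof (rule that[OF d(1)])
    fix s t :: real assume "\<bar>s - t\<bar> < d"
    then show "norm (\<gamma> t - \<gamma> s) < e"
      using *[of s t] *[of t s] by (cases "s \<le> t") (auto simp: norm_minus_commute)
  qed
qed

lemma gamma_cont: "continuous_on S \<gamma>"
  unfolding continuous_on_iff dist_norm
proof (intro ballI allI impI)
  fix x and e :: real assume "0 < e"
  then obtain d where "0 < d" "\<And>s t. \<bar>s - t\<bar> < d \<Longrightarrow> norm (\<gamma> t - \<gamma> s) < e"
    using gamma_uniformly_continuous by blast
  then show "\<exists>d>0. \<forall>x'\<in>S. norm (x' - x) < d \<longrightarrow> norm (\<gamma> x' - \<gamma> x) < e"
    by (intro exI[of _ d]) (auto simp: abs_minus_commute)
qed

lemma V_gamma_cont: "continuous_on S (\<lambda>t. V (\<gamma> t))"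
  by (rule continuous_on_compose2[OF V_cont[of UNIV] gamma_cont]) simp

lemma V_bounded: obtains M where "0 < M" "\<And>x. norm x \<le> R + 1 \<Longrightarrow> \<bar>V x - c\<bar> \<le> M"
proof -
  have "compact ((\<lambda>x. V x - c) ` cball 0 (R + 1))"
    by (intro compact_continuous_image continuous_intros V_cont compact_cball)
  from compact_imp_bounded[OF this]
  obtain M where "0 < M" "\<And>x. x \<in> cball 0 (R + 1) \<Longrightarrow> norm (V x - c) \<le> M"
    unfolding bounded_pos by blast
  then show ?thesis using that by auto
qed

lemma V_integral_tendsto:
  "(\<lambda>n. integral {s..t} (\<lambda>r. V (q n r) - c)) \<longlonglongrightarrow> integral {s..t} (\<lambda>r. V (\<gamma> r) - c)"
proof -
  obtain M where M: "0 < M" "\<And>x. norm x \<le> R + 1 \<Longrightarrow> \<bar>V x - c\<bar> \<le> M" using V_bounded by blast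
  show ?thesis
  proof (rule dominated_convergence(2)[where h = "\<lambda>_. M"])
    show "(\<lambda>r. V (q n r) - c) integrable_on {s..t}" for n
      by (intro integrable_continuous_interval continuous_intros
          continuous_on_compose2[OF V_cont[of UNIV] q_cont]) auto
    show "norm (V (q n r) - c) \<le> M" for n r
      using M(2)[of "q n r"] q_bound[of n r] by simp
    show "(\<lambda>n. V (q n r) - c) \<longlonglongrightarrow> V (\<gamma> r) - c" for r
      by (intro tendsto_intros V_q_tendsto)
  qed auto
qed

text \<open>Jensen's lower bound for the action of \<open>q n\<close> between \<open>s\<close> and
  \<open>t\<close>. It contains no derivative and thus converges along with
  \<open>q n\<close>.\<close>

definition Jensen :: "nat \<Rightarrow> real \<Rightarrow> real \<Rightarrow> real" where
  "Jensen n s t = (t - s) * \<Phi> (norm (q n t - q n s) / (t - s)) + integral {s..t} (\<lambda>r. V (q n r) - c)"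

lemma Jensen_le: "s < t \<Longrightarrow> Jensen n s t \<le> integral {s..t} (lagr (q n) (p n))"
  unfolding Jensen_def by (rule lagr_Jensen) (use near_min_basic[OF nm] in auto)

lemma Jensen_tendsto:
  assumes "s < t"
  shows "(\<lambda>n. Jensen n s t) \<longlonglongrightarrow> (t - s) * \<Phi> (norm (\<gamma> t - \<gamma> s) / (t - s)) + integral {s..t} (\<lambda>r. V (\<gamma> r) - c)"
proof -
  have "(\<lambda>n. \<Phi> (norm (q n t - q n s) / (t - s))) \<longlonglongrightarrow> \<Phi> (norm (\<gamma> t - \<gamma> s) / (t - s))"
    by (rule continuous_on_tendsto_compose[OF Phi_cont]) (use assms in \<open>auto intro!: tendsto_intros conv\<close>)
  then show ?thesis
    unfolding Jensen_def by (intro tendsto_intros V_integral_tendsto)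
qed

text \<open>\<open>X\<close> is an arbitrary lower bound for the actions; later it is one Jensen
  term or a sum of two. The ball is open and convex, so for large \<open>n\<close> it contains the
  whole segment from \<open>q n s\<close> to \<open>q n t\<close>, which is then a legal
  competitor.\<close>

lemma limit_le_segment:
  assumes "s \<le> t" "0 < \<tau>" "norm (\<gamma> t - \<gamma> s) < r"
    and above: "\<And>z. z \<in> ball (\<gamma> s) r \<Longrightarrow> c \<le> V z"
    and B: "\<And>z. z \<in> ball (\<gamma> s) r \<Longrightarrow> V z - c \<le> B"
    and X: "\<And>n. X n \<le> integral {s..t} (lagr (q n) (p n))" "X \<longlonglongrightarrow> X0"
  shows "X0 \<le> \<tau> * (\<Phi> (norm (\<gamma> t - \<gamma> s) / \<tau>) + B)"
proof -
  have "r > 0" using assms(3) norm_ge_zero[of "\<gamma> t - \<gamma> s"] by linarith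
  have "\<forall>\<^sub>F n in sequentially. q n s \<in> ball (\<gamma> s) r" "\<forall>\<^sub>F n in sequentially. q n t \<in> ball (\<gamma> s) r"
    using topological_tendstoD[OF conv[of s] open_ball[of "\<gamma> s" r]]
      topological_tendstoD[OF conv[of t] open_ball[of "\<gamma> s" r]] assms(3) \<open>r > 0\<close>
    by (auto simp: dist_norm norm_minus_commute)
  then have "\<forall>\<^sub>F n in sequentially. X n \<le> \<tau> * (\<Phi> (norm (q n t - q n s) / \<tau>) + B) + \<epsilon> n"
  proof eventually_elim
    case (elim n)
    then have "closed_segment (q n s) (q n t) \<subseteq> ball (\<gamma> s) r"
      by (intro closed_segment_subset) auto
    then have "integral {s..t} (lagr (q n) (p n)) \<le> \<tau> * (\<Phi> (norm (q n t - q n s) / \<tau>) + B) + \<epsilon> n"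
      using above B by (intro near_min_segment[OF nm assms(1,2)]) auto
    then show ?case using X(1)[of n] by linarith
  qed
  moreover have "(\<lambda>n. \<tau> * (\<Phi> (norm (q n t - q n s) / \<tau>) + B) + \<epsilon> n) \<longlonglongrightarrow> \<tau> * (\<Phi> (norm (\<gamma> t - \<gamma> s) / \<tau>) + B) + 0"
  proof (intro tendsto_intros eps(1))
    show "(\<lambda>n. \<Phi> (norm (q n t - q n s) / \<tau>)) \<longlonglongrightarrow> \<Phi> (norm (\<gamma> t - \<gamma> s) / \<tau>)"
      by (rule continuous_on_tendsto_compose[OF Phi_cont]) (use assms in \<open>auto intro!: tendsto_intros conv\<close>)
  qed
  ultimately show ?thesis
    using tendsto_le[OF sequentially_bot _ X(2)] by fastforce
qed

end

lemma prim_add: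
  assumes "prim I q p" "prim I q' p'"
  shows "prim I (\<lambda>t. q t + q' t) (\<lambda>t. p t + p' t)"
  unfolding prim_def
proof (intro allI impI)
  fix a b assume ab: "a \<le> b \<and> {a..b} \<subseteq> I"
  note 1 = primD[OF assms(1), of a b] and 2 = primD[OF assms(2), of a b]
  show "(\<lambda>t. p t + p' t) absolutely_integrable_on {a..b} \<and>
      integral {a..b} (\<lambda>t. p t + p' t) = q b + q' b - (q a + q' a)"
    using 1 2 ab by (simp add: integral_add set_integral_add(1))
qed

lemma difference_quotient_tendsto:
  assumes "(f has_vector_derivative D) (at t)"
  shows "((\<lambda>h. (1 / h) *\<^sub>R (f (t + h) - f t)) \<longlongrightarrow> D) (at 0)"
proof -
  have "((\<lambda>h. norm (f (t + h) - f t - h *\<^sub>R D) / norm h) \<longlongrightarrow> 0) (at 0)"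
    using assms by (simp add: has_vector_derivative_def has_derivative_at)
  moreover have "norm (f (t + h) - f t - h *\<^sub>R D) / norm h = norm ((1 / h) *\<^sub>R (f (t + h) - f t) - D)"
    if "h \<noteq> 0" for h
  proof -
    have eq: "(1 / h) *\<^sub>R (f (t + h) - f t) - D = (1 / h) *\<^sub>R (f (t + h) - f t - h *\<^sub>R D)"
      using that by (simp add: scaleR_diff_right)
    show ?thesis unfolding eq norm_scaleR by simp
  qed
  then have "\<forall>\<^sub>F h in at 0. norm (f (t + h) - f t - h *\<^sub>R D) / norm h = norm ((1 / h) *\<^sub>R (f (t + h) - f t) - D)"
    by (simp add: eventually_at_filter)
  ultimately have "((\<lambda>h. norm ((1 / h) *\<^sub>R (f (t + h) - f t) - D)) \<longlongrightarrow> 0) (at 0)"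
    by (rule Lim_transform_eventually)
  then show ?thesis by (simp add: tendsto_norm_zero_iff LIM_zero_iff)
qed

context limit_curve
begin

lemma tube:
  fixes \<sigma> :: "real \<Rightarrow> 'a"
  assumes "continuous_on {a..b} \<sigma>" "\<And>t. t \<in> {a..b} \<Longrightarrow> c < V (\<sigma> t)"
  obtains r where "0 < r" "r \<le> 1" "\<And>t z. t \<in> {a..b} \<Longrightarrow> z \<in> ball (\<sigma> t) r \<Longrightarrow> c < V z"
proof -
  have "compact (\<sigma> ` {a..b})" by (rule compact_continuous_image[OF assms(1)]) simp
  moreover have "open {z. c < V z}" by (intro open_Collect_less continuous_intros V_cont)
  moreover have "\<sigma> ` {a..b} \<subseteq> {z. c < V z}" using assms(2) by auto
  ultimately obtain r where r: "0 < r" "(\<Union>x\<in>\<sigma> ` {a..b}. ball x r) \<subseteq> {z. c < V z}"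
    using compact_subset_open_imp_ball_epsilon_subset by metis
  show ?thesis
  proof (rule that[of "min r 1"])
    fix t z assume "t \<in> {a..b}" "z \<in> ball (\<sigma> t) (min r 1)"
    then have "z \<in> (\<Union>x\<in>\<sigma> ` {a..b}. ball x r)" by auto
    then show "c < V z" using r(2) by blast
  qed (use r in auto)
qed

text \<open>The last clause says that, asymptotically, the near-minimizers do no worse between \<open>s\<close> and \<open>t\<close>
  than a straight segment traversed in any time \<open>\<tau>\<close>.\<close>

definition tame :: "real \<Rightarrow> real \<Rightarrow> real \<Rightarrow> real \<Rightarrow> real \<Rightarrow> real \<Rightarrow> bool" where
  "tame a b h0 c0 S L \<longleftrightarrow> 0 < h0 \<and> 0 < c0 \<and> c0 \<le> S \<and> 0 < L \<and>
    (\<forall>s t. a \<le> s \<longrightarrow> s < t \<longrightarrow> t \<le> b \<longrightarrow> t - s < h0 \<longrightarrow>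
      c0 * (t - s) \<le> norm (\<gamma> t - \<gamma> s) \<and> norm (\<gamma> t - \<gamma> s) \<le> S * (t - s) \<and>
      (t - s) * (V (\<gamma> s) - c - L * (t - s)) \<le> integral {s..t} (\<lambda>r. V (\<gamma> r) - c) \<and>
      (\<forall>\<tau> X X0. 0 < \<tau> \<longrightarrow> (\<forall>n. X n \<le> integral {s..t} (lagr (q n) (p n))) \<longrightarrow> X \<longlonglongrightarrow> X0 \<longrightarrow>
        X0 \<le> \<tau> * (\<Phi> (norm (\<gamma> t - \<gamma> s) / \<tau>) + (V (\<gamma> s) - c + L * (t - s)))))"

lemma tameD:
  assumes "tame a b h0 c0 S L"
  shows "0 < h0" "0 < c0" "c0 \<le> S" "0 < L"
    "a \<le> s \<Longrightarrow> s < t \<Longrightarrow> t \<le> b \<Longrightarrow> t - s < h0 \<Longrightarrow> c0 * (t - s) \<le> norm (\<gamma> t - \<gamma> s)"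
    "a \<le> s \<Longrightarrow> s < t \<Longrightarrow> t \<le> b \<Longrightarrow> t - s < h0 \<Longrightarrow> norm (\<gamma> t - \<gamma> s) \<le> S * (t - s)"
    "a \<le> s \<Longrightarrow> s < t \<Longrightarrow> t \<le> b \<Longrightarrow> t - s < h0 \<Longrightarrow>
       (t - s) * (V (\<gamma> s) - c - L * (t - s)) \<le> integral {s..t} (\<lambda>r. V (\<gamma> r) - c)"
    "a \<le> s \<Longrightarrow> s < t \<Longrightarrow> t \<le> b \<Longrightarrow> t - s < h0 \<Longrightarrow> 0 < \<tau> \<Longrightarrow>
       (\<And>n. X n \<le> integral {s..t} (lagr (q n) (p n))) \<Longrightarrow> X \<longlonglongrightarrow> X0 \<Longrightarrow>
       X0 \<le> \<tau> * (\<Phi> (norm (\<gamma> t - \<gamma> s) / \<tau>) + (V (\<gamma> s) - c + L * (t - s)))"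
proof -
  show "0 < h0" "0 < c0" "c0 \<le> S" "0 < L"
    "a \<le> s \<Longrightarrow> s < t \<Longrightarrow> t \<le> b \<Longrightarrow> t - s < h0 \<Longrightarrow> c0 * (t - s) \<le> norm (\<gamma> t - \<gamma> s)"
    "a \<le> s \<Longrightarrow> s < t \<Longrightarrow> t \<le> b \<Longrightarrow> t - s < h0 \<Longrightarrow> norm (\<gamma> t - \<gamma> s) \<le> S * (t - s)"
    "a \<le> s \<Longrightarrow> s < t \<Longrightarrow> t \<le> b \<Longrightarrow> t - s < h0 \<Longrightarrow>
       (t - s) * (V (\<gamma> s) - c - L * (t - s)) \<le> integral {s..t} (\<lambda>r. V (\<gamma> r) - c)"
    using assms unfolding tame_def by auto
  assume "a \<le> s" "s < t" "t \<le> b" "t - s < h0" "0 < \<tau>"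
    "\<And>n. X n \<le> integral {s..t} (lagr (q n) (p n))" "X \<longlonglongrightarrow> X0"
  then show "X0 \<le> \<tau> * (\<Phi> (norm (\<gamma> t - \<gamma> s) / \<tau>) + (V (\<gamma> s) - c + L * (t - s)))"
    using assms unfolding tame_def by blast
qed

text \<open>Both speed bounds come from the segment traversed at unit speed. Its cost is
  proportional to the displacement, while the time spent where \<open>V - c \<ge> \<eta>\<close>
  costs at least \<open>(t - s) * \<eta>\<close>, so the displacement cannot be too small;
  superlinearity of \<open>\<Phi>\<close> prevents it from being too large.\<close>

lemma tame_exists:
  assumes pos: "\<And>t. t \<in> {a..b} \<Longrightarrow> c < V (\<gamma> t)"
  obtains h0 c0 S L where "tame a b h0 c0 S L"
proof (cases "a \<le> b")
  case False
  then show ?thesis by (intro that[of 1 1 1 1]) (auto simp: tame_def)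
next
  case True
  obtain r where r: "0 < r" "r \<le> 1" "\<And>t z. t \<in> {a..b} \<Longrightarrow> z \<in> ball (\<gamma> t) r \<Longrightarrow> c < V z"
    using tube[OF gamma_cont pos] by metis
  obtain t0 where t0: "t0 \<in> {a..b}" "\<And>t. t \<in> {a..b} \<Longrightarrow> V (\<gamma> t0) \<le> V (\<gamma> t)"
    using continuous_attains_inf[OF compact_Icc _ V_gamma_cont, of a b] True by auto
  define \<eta> where "\<eta> = V (\<gamma> t0) - c"
  have \<eta>: "0 < \<eta>" "\<And>t. t \<in> {a..b} \<Longrightarrow> \<eta> \<le> V (\<gamma> t) - c" using pos t0 by (auto simp: \<eta>_def)
  obtain M where M: "0 < M" "\<And>x. norm x \<le> R + 1 \<Longrightarrow> \<bar>V x - c\<bar> \<le> M" using V_bounded by blast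
  obtain L where L: "0 < L" "\<And>x y. norm x \<le> R + 1 \<Longrightarrow> norm y \<le> R + 1 \<Longrightarrow> \<bar>V x - V y\<bar> \<le> L * norm (x - y)"
    using V_Lipschitz[of "R + 1"] by blast
  have in_ball: "norm z \<le> R + 1" if "z \<in> ball (\<gamma> s) r'" "r' \<le> 1" for z s r'
  proof -
    have "norm z \<le> norm (\<gamma> s) + norm (z - \<gamma> s)" using norm_triangle_sub[of z "\<gamma> s"] .
    then show ?thesis using gamma_bound[of s] that by (simp add: dist_norm norm_minus_commute)
  qed
  \<comment> \<open>\<open>C\<close> bounds the cost per unit length of a segment run at unit
    speed.\<close>
  define C where "C = \<Phi> 1 + M"
  have C: "0 < C" using M Phi_nonneg[of 1] unfolding C_def by linarith
  obtain S0 where S0: "0 < S0" "\<And>s. 0 \<le> s \<Longrightarrow> \<Phi> s \<le> C * s \<Longrightarrow> s \<le> S0"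
    using Phi_superlinear[of C] by blast
  define c0 where "c0 = \<eta> / C"
  define S where "S = max S0 c0"
  have c0: "0 < c0" "c0 \<le> S" using \<eta>(1) C by (auto simp: c0_def S_def)
  have "0 < S" using c0 by linarith
  note c0 = c0 this
  obtain h1 where h1: "0 < h1" "\<And>s t. \<bar>s - t\<bar> < h1 \<Longrightarrow> norm (\<gamma> t - \<gamma> s) < r"
    using gamma_uniformly_continuous[OF r(1)] by blast
  \<comment> \<open>The first bound keeps \<open>\<gamma> t\<close> in the tube around
    \<open>\<gamma> s\<close>; the second keeps the radius \<open>2 * S * (t - s)\<close> used at
    the end below \<open>r\<close>.\<close>
  define h0 where "h0 = min h1 (r / (2 * S))"
  have h0: "0 < h0" using h1 r c0 by (simp add: h0_def)
  have bi: "c0 * (t - s) \<le> norm (\<gamma> t - \<gamma> s) \<and> norm (\<gamma> t - \<gamma> s) \<le> S * (t - s)"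
    if st: "a \<le> s" "s < t" "t \<le> b" "t - s < h0" for s t
  proof -
    define \<Delta> where "\<Delta> = norm (\<gamma> t - \<gamma> s)"
    have int: "(t - s) * \<eta> \<le> integral {s..t} (\<lambda>r. V (\<gamma> r) - c)"
    proof -
      have "integral {s..t} (\<lambda>_. \<eta>) \<le> integral {s..t} (\<lambda>r. V (\<gamma> r) - c)"
        by (intro integral_le integrable_continuous_interval continuous_intros V_gamma_cont) (use \<eta>(2) st in auto)
      then show ?thesis using st by simp
    qed
    have le: "(t - s) * \<Phi> (\<Delta> / (t - s)) + (t - s) * \<eta> \<le> \<tau> * (\<Phi> (\<Delta> / \<tau>) + M)" if "0 < \<tau>" for \<tau>
    proof -
      have "(t - s) * \<Phi> (norm (\<gamma> t - \<gamma> s) / (t - s)) + integral {s..t} (\<lambda>r. V (\<gamma> r) - c)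
          \<le> \<tau> * (\<Phi> (norm (\<gamma> t - \<gamma> s) / \<tau>) + M)"
      proof (rule limit_le_segment[OF _ that, where r = r, OF _ _ _ _ Jensen_le Jensen_tendsto])
        show "norm (\<gamma> t - \<gamma> s) < r" by (rule h1(2)) (use st in \<open>auto simp: h0_def\<close>)
        show "c \<le> V z" if "z \<in> ball (\<gamma> s) r" for z using r(3)[OF _ that] st by force
        show "V z - c \<le> M" if "z \<in> ball (\<gamma> s) r" for z
          using M(2)[OF in_ball[OF that r(2)]] by simp
      qed (use st in auto)
      then show ?thesis using int by (simp add: \<Delta>_def)
    qed
    \<comment> \<open>With equal end points, a pause of length
      \<open>(t - s) * \<eta> / (2 * M)\<close> would cost at most half of the guaranteed
      \<open>(t - s) * \<eta>\<close>.\<close>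
    have "\<Delta> \<noteq> 0"
    proof
      assume "\<Delta> = 0"
      have "(t - s) * \<eta> / (2 * M) * M < (t - s) * \<eta>" using M(1) st \<eta>(1) by (simp add: field_simps)
      moreover have "(t - s) * \<eta> \<le> (t - s) * \<eta> / (2 * M) * M"
        using le[of "(t - s) * \<eta> / (2 * M)"] M(1) st \<eta>(1) \<open>\<Delta> = 0\<close> by simp
      ultimately show False by simp
    qed
    then have \<Delta>: "0 < \<Delta>" by (simp add: \<Delta>_def)
    \<comment> \<open>The duration is taken to be the displacement \<open>\<Delta>\<close>, that is,
      unit speed.\<close>
    have main: "(t - s) * (\<Phi> (\<Delta> / (t - s)) + \<eta>) \<le> \<Delta> * C"
      using le[OF \<Delta>] \<Delta> by (simp add: C_def distrib_left)
    have "(t - s) * \<eta> \<le> \<Delta> * C"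
    proof -
      have "0 \<le> (t - s) * \<Phi> (\<Delta> / (t - s))" using st by simp
      then show ?thesis using main unfolding distrib_left by linarith
    qed
    then have "c0 * (t - s) \<le> \<Delta>" using C by (simp add: c0_def field_simps)
    moreover have "\<Phi> (\<Delta> / (t - s)) \<le> C * (\<Delta> / (t - s))"
    proof -
      have "(t - s) * \<Phi> (\<Delta> / (t - s)) \<le> \<Delta> * C"
      proof -
        have "0 \<le> (t - s) * \<eta>" using st \<eta>(1) by simp
        then show ?thesis using main unfolding distrib_left by linarith
      qed
      then show ?thesis using st by (simp add: field_simps)
    qed
    then have "\<Delta> / (t - s) \<le> S0" using S0(2) \<Delta> st by simp
    then have "\<Delta> / (t - s) \<le> S" by (simp add: S_def)
    then have "\<Delta> \<le> S * (t - s)" using st by (simp add: field_simps)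
    ultimately show ?thesis by (simp add: \<Delta>_def)
  qed
  define L2 where "L2 = 2 * L * S"
  have "tame a b h0 c0 S L2"
    unfolding tame_def
  proof (intro conjI allI impI h0 c0(1,2))
    show "0 < L2" using L c0 by (simp add: L2_def)
    fix s t assume st: "a \<le> s" "s < t" "t \<le> b" "t - s < h0"
    show "c0 * (t - s) \<le> norm (\<gamma> t - \<gamma> s)" "norm (\<gamma> t - \<gamma> s) \<le> S * (t - s)"
      using bi[OF st] by auto
    show "(t - s) * (V (\<gamma> s) - c - L2 * (t - s)) \<le> integral {s..t} (\<lambda>r. V (\<gamma> r) - c)"
    proof -
      have "V (\<gamma> s) - c - L2 * (t - s) \<le> V (\<gamma> x) - c" if x: "x \<in> {s..t}" for x
      proof -
        have "norm (\<gamma> x - \<gamma> s) \<le> S * (t - s)"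
        proof (cases "x = s")
          case False
          then have "norm (\<gamma> x - \<gamma> s) \<le> S * (x - s)" using bi[of s x] x st by auto
          also have "\<dots> \<le> S * (t - s)" using x c0 by (intro mult_left_mono) auto
          finally show ?thesis .
        qed (use c0 st in auto)
        then have "L * norm (\<gamma> s - \<gamma> x) \<le> L * (S * (t - s))"
          using L(1) by (intro mult_left_mono) (auto simp: norm_minus_commute)
        moreover have "\<bar>V (\<gamma> s) - V (\<gamma> x)\<bar> \<le> L * norm (\<gamma> s - \<gamma> x)"
          by (rule L(2)) (use gamma_bound[of s] gamma_bound[of x] in auto)
        moreover have "L * (S * (t - s)) \<le> L2 * (t - s)" using L c0 st by (simp add: L2_def)
        ultimately show ?thesis by linarith
      qed
      then have "integral {s..t} (\<lambda>_. V (\<gamma> s) - c - L2 * (t - s)) \<le> integral {s..t} (\<lambda>r. V (\<gamma> r) - c)"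
        by (intro integral_le integrable_continuous_interval continuous_intros V_gamma_cont) auto
      then show ?thesis using st by simp
    qed
    fix \<tau> :: real and X X0
    assume \<tau>: "0 < \<tau>" and "\<forall>n. X n \<le> integral {s..t} (lagr (q n) (p n))" "X \<longlonglongrightarrow> X0"
    then have X: "\<And>n. X n \<le> integral {s..t} (lagr (q n) (p n))" "X \<longlonglongrightarrow> X0" by auto
    \<comment> \<open>Twice the speed bound puts \<open>\<gamma> t\<close> strictly inside the ball,
      and a radius proportional to \<open>t - s\<close> makes \<open>V\<close> exceed
      \<open>V (\<gamma> s)\<close> there by at most \<open>L2 * (t - s)\<close>.\<close>
    define r' where "r' = 2 * S * (t - s)"
    have r': "0 < r'" "r' < r" using c0 st by (auto simp: r'_def h0_def field_simps)
    show "X0 \<le> \<tau> * (\<Phi> (norm (\<gamma> t - \<gamma> s) / \<tau>) + (V (\<gamma> s) - c + L2 * (t - s)))"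
    proof (rule limit_le_segment[OF _ \<tau> _ _ _ X])
      have "norm (\<gamma> t - \<gamma> s) \<le> S * (t - s)" using bi[OF st] by simp
      also have "\<dots> < r'" using c0 st by (simp add: r'_def)
      finally show "norm (\<gamma> t - \<gamma> s) < r'" .
      show "c \<le> V z" if "z \<in> ball (\<gamma> s) r'" for z
        using r(3)[of s z] that r' st by force
      show "V z - c \<le> V (\<gamma> s) - c + L2 * (t - s)" if z: "z \<in> ball (\<gamma> s) r'" for z
      proof -
        have "L * norm (z - \<gamma> s) \<le> L * r'"
          using z L(1) by (intro mult_left_mono) (auto simp: dist_norm norm_minus_commute)
        moreover have "\<bar>V z - V (\<gamma> s)\<bar> \<le> L * norm (z - \<gamma> s)"
          by (rule L(2)) (use in_ball[OF z] r' r gamma_bound[of s] in auto)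
        moreover have "L * r' = L2 * (t - s)" by (simp add: L2_def r'_def)
        ultimately show ?thesis by linarith
      qed
    qed (use st in auto)
  qed
  then show ?thesis by (rule that)
qed

text \<open>Let \<open>u\<close>, \<open>v\<close> be the mean velocities of the two halves and
  \<open>w\<close> their average. Uniform convexity makes
  \<open>\<Phi> (norm u) + \<Phi> (norm v)\<close> exceed \<open>2 * \<Phi> (norm w)\<close> by at
  least \<open>\<kappa> / 2\<close> times the square of \<open>norm (u - v)\<close>, whereas
  comparison with one segment of the same duration allows an excess of \<open>4 * L * h\<close>.
  Their quotient explains \<open>K\<close>.\<close>

lemma second_difference:
  assumes pos: "\<And>t. t \<in> {a..b} \<Longrightarrow> c < V (\<gamma> t)"
  obtains h0 K where "0 < h0" "0 \<le> K"
    "\<And>s h. a \<le> s \<Longrightarrow> s + h \<le> b \<Longrightarrow> 0 < h \<Longrightarrow> h < h0 \<Longrightarrow>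
      norm (\<gamma> (s + h) - 2 *\<^sub>R \<gamma> (s + h / 2) + \<gamma> s) \<le> K * h * sqrt h"
proof -
  obtain h0 c0 S L where tame: "tame a b h0 c0 S L"
    using tame_exists[OF pos] by blast
  note h0 = tameD(1)[OF tame] and c0 = tameD(2,3)[OF tame] and L = tameD(4)[OF tame]
    and bi = tameD(5,6)[OF tame] and Vlow = tameD(7)[OF tame] and up = tameD(8)[OF tame]
  obtain \<kappa> where \<kappa>: "0 < \<kappa>"
    "\<And>v w :: 'a. norm v \<in> {c0..S} \<Longrightarrow> norm w \<in> {c0..S} \<Longrightarrow>
       \<Phi> (norm w) + momentum w \<bullet> (v - w) + \<kappa> * (norm (v - w))\<^sup>2 \<le> \<Phi> (norm v)"
    using Phi_uniformly_convex[OF c0] by blast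
  define K where "K = sqrt (8 * L / \<kappa>)"
  show ?thesis
  proof (rule that[OF h0])
    show "0 \<le> K" using L \<kappa> by (simp add: K_def)
    fix s h :: real assume s: "a \<le> s" "s + h \<le> b" "0 < h" "h < h0"
    define m t where "m = s + h / 2" and "t = s + h"
    have st: "s < m" "m < t" "s < t" "m - s = h / 2" "t - m = h / 2" "t - s = h" "a \<le> m" "m \<le> b" "t \<le> b"
      using s by (auto simp: m_def t_def)
    define u v w where "u = (2 / h) *\<^sub>R (\<gamma> m - \<gamma> s)" and "v = (2 / h) *\<^sub>R (\<gamma> t - \<gamma> m)"
      and "w = (1 / h) *\<^sub>R (\<gamma> t - \<gamma> s)"
    have n: "norm u = norm (\<gamma> m - \<gamma> s) / (m - s)" "norm v = norm (\<gamma> t - \<gamma> m) / (t - m)"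
      "norm w = norm (\<gamma> t - \<gamma> s) / h"
      unfolding st(4,5) using s(3) by (simp_all add: u_def v_def w_def)
    have range: "norm u \<in> {c0..S}" "norm v \<in> {c0..S}" "norm w \<in> {c0..S}"
    proof -
      have div: "X / e \<in> {c0..S}" if "c0 * e \<le> X" "X \<le> S * e" "0 < e" for X e
        using that by (simp add: field_simps)
      have lt: "m - s < h0" "t - m < h0" "t - s < h0" unfolding st(4-6) using s by auto
      note sm = s(1) st(1,8) lt(1) and mt = st(7,2,9) lt(2) and ss = s(1) st(3,9) lt(3)
      show "norm u \<in> {c0..S}" unfolding n by (rule div[OF bi(1)[OF sm] bi(2)[OF sm]]) (use st(1) in simp)
      show "norm v \<in> {c0..S}" unfolding n by (rule div[OF bi(1)[OF mt] bi(2)[OF mt]]) (use st(2) in simp)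
      show "norm w \<in> {c0..S}"
        unfolding n st(6)[symmetric] by (rule div[OF bi(1)[OF ss] bi(2)[OF ss]]) (use st(3) in simp)
    qed
    \<comment> \<open>Jensen on each half from below, one straight segment of duration
      \<open>h\<close> from above.\<close>
    have "(m - s) * \<Phi> (norm u) + integral {s..m} (\<lambda>r. V (\<gamma> r) - c)
        + ((t - m) * \<Phi> (norm v) + integral {m..t} (\<lambda>r. V (\<gamma> r) - c))
        \<le> h * (\<Phi> (norm (\<gamma> t - \<gamma> s) / h) + (V (\<gamma> s) - c + L * (t - s)))"
    proof (rule up)
      show "(\<lambda>n. Jensen n s m + Jensen n m t) \<longlonglongrightarrow> (m - s) * \<Phi> (norm u) + integral {s..m} (\<lambda>r. V (\<gamma> r) - c)
          + ((t - m) * \<Phi> (norm v) + integral {m..t} (\<lambda>r. V (\<gamma> r) - c))"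
        unfolding n by (intro tendsto_add Jensen_tendsto st)
      fix n
      have "integral {s..m} (lagr (q n) (p n)) + integral {m..t} (lagr (q n) (p n)) = integral {s..t} (lagr (q n) (p n))"
        by (rule Henstock_Kurzweil_Integration.integral_combine) (use st near_min_basic(3)[OF nm] in auto)
      then show "Jensen n s m + Jensen n m t \<le> integral {s..t} (lagr (q n) (p n))"
        using Jensen_le[OF st(1), of n] Jensen_le[OF st(2), of n] by linarith
    qed (use s st in auto)
    moreover have "integral {s..m} (\<lambda>r. V (\<gamma> r) - c) + integral {m..t} (\<lambda>r. V (\<gamma> r) - c)
        = integral {s..t} (\<lambda>r. V (\<gamma> r) - c)"
      by (intro Henstock_Kurzweil_Integration.integral_combine integrable_continuous_interval
          continuous_intros V_gamma_cont) (use st in auto)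
    moreover have "(t - s) * (V (\<gamma> s) - c - L * (t - s)) \<le> integral {s..t} (\<lambda>r. V (\<gamma> r) - c)"
      by (rule Vlow) (use s st in auto)
    ultimately have "h * (\<Phi> (norm u) + \<Phi> (norm v)) \<le> h * (2 * \<Phi> (norm w) + 4 * L * h)"
      unfolding st(4-6) n(3)[symmetric] by (simp add: algebra_simps)
    then have upper: "\<Phi> (norm u) + \<Phi> (norm v) \<le> 2 * \<Phi> (norm w) + 4 * L * h"
      using s by simp
    have uw: "u - w = (1 / 2) *\<^sub>R (u - v)" "v - w = - ((1 / 2) *\<^sub>R (u - v))"
    proof -
      have "w = (1 / 2) *\<^sub>R (u + v)" by (simp add: u_def v_def w_def flip: scaleR_add_right)
      then have e: "2 *\<^sub>R (u - w) = u - v" "2 *\<^sub>R (v - w) = - (u - v)"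
        by (simp_all add: scaleR_diff_right scaleR_2)
      have half: "(1 / 2) *\<^sub>R (2 *\<^sub>R z) = z" for z :: 'a by simp
      show "u - w = (1 / 2) *\<^sub>R (u - v)" using half[of "u - w"] e(1) by simp
      show "v - w = - ((1 / 2) *\<^sub>R (u - v))"
        using half[of "v - w"] unfolding e(2) scaleR_minus_right by (rule sym)
    qed
    have "2 * \<Phi> (norm w) + 2 * (\<kappa> * (norm (u - v) / 2)\<^sup>2) \<le> \<Phi> (norm u) + \<Phi> (norm v)"
    proof -
      \<comment> \<open>The deviations from \<open>w\<close> are opposite, so the linear terms of
        the two convexity inequalities cancel.\<close>
      have "momentum w \<bullet> (u - w) + momentum w \<bullet> (v - w) = 0"
        unfolding uw by simp
      moreover have nw: "norm (u - w) = norm (u - v) / 2" "norm (v - w) = norm (u - v) / 2"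
        unfolding uw by simp_all
      ultimately show ?thesis
        using \<kappa>(2)[OF range(1,3)] \<kappa>(2)[OF range(2,3)] unfolding nw by linarith
    qed
    then have "\<kappa> * (norm (u - v))\<^sup>2 \<le> 8 * L * h" using upper by (simp add: power_divide)
    then have "(norm (u - v))\<^sup>2 \<le> (8 * L / \<kappa>) * h" using \<kappa>(1) by (simp add: field_simps)
    then have uv: "norm (u - v) \<le> K * sqrt h"
      unfolding K_def real_sqrt_mult[symmetric] by (rule real_le_rsqrt)
    have "\<gamma> (s + h) - 2 *\<^sub>R \<gamma> (s + h / 2) + \<gamma> s = (- (h / 2)) *\<^sub>R (u - v)"
      using s by (simp add: u_def v_def m_def t_def scaleR_2 scaleR_diff_right)
    then have "norm (\<gamma> (s + h) - 2 *\<^sub>R \<gamma> (s + h / 2) + \<gamma> s) = (h / 2) * norm (u - v)" using s by simp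
    also have "\<dots> \<le> h * norm (u - v)" using s by (intro mult_right_mono) auto
    also have "\<dots> \<le> h * (K * sqrt h)" using uv s by (intro mult_left_mono) auto
    finally show "norm (\<gamma> (s + h) - 2 *\<^sub>R \<gamma> (s + h / 2) + \<gamma> s) \<le> K * h * sqrt h"
      by (simp only: mult.assoc mult.left_commute)
  qed
qed

section \<open>Velocity of the limit curve and the energy identity\<close>

definition d\<gamma> :: "real \<Rightarrow> 'a" where "d\<gamma> t = vector_derivative \<gamma> (at t)"

lemma above_nhd:
  assumes "c < V (\<gamma> t)"
  obtains d where "0 < d" "\<And>s. s \<in> {t - d..t + d} \<Longrightarrow> c < V (\<gamma> s)"
proof -
  have "open {s. c < V (\<gamma> s)}" by (intro open_Collect_less continuous_intros V_gamma_cont)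
  then obtain d where d: "d > 0" "cball t d \<subseteq> {s. c < V (\<gamma> s)}"
    using assms open_contains_cball by (metis mem_Collect_eq)
  show ?thesis
    by (rule that[OF d(1)]) (use d(2) in \<open>auto simp: dist_real_def subset_iff\<close>)
qed

lemma gamma_derivative:
  assumes "c < V (\<gamma> t)"
  shows "(\<gamma> has_vector_derivative d\<gamma> t) (at t)" "isCont d\<gamma> t"
proof -
  obtain d where d: "0 < d" "\<And>s. s \<in> {t - d..t + d} \<Longrightarrow> c < V (\<gamma> s)" using above_nhd[OF assms] by blast
  obtain h0 K where hK: "0 < h0" "0 \<le> K"
    "\<And>s h. t - d \<le> s \<Longrightarrow> s + h \<le> t + d \<Longrightarrow> 0 < h \<Longrightarrow> h < h0 \<Longrightarrow>
      norm (\<gamma> (s + h) - 2 *\<^sub>R \<gamma> (s + h / 2) + \<gamma> s) \<le> K * h * sqrt h"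
    using second_difference[of "t - d" "t + d"] d(2) by blast
  have "t - d < t + d / 2" "t + d / 2 < t + d" using d(1) by auto
  then obtain D where D: "continuous_on {t - d..t + d / 2} D"
    "\<And>s. s \<in> {t - d<..<t + d / 2} \<Longrightarrow> (\<gamma> has_vector_derivative D s) (at s)"
    using second_difference_imp_C1[OF gamma_cont _ _ hK] by blast
  have eq: "d\<gamma> s = D s" if "s \<in> {t - d<..<t + d / 2}" for s
    unfolding d\<gamma>_def by (rule vector_derivative_at[OF D(2)[OF that]])
  show "(\<gamma> has_vector_derivative d\<gamma> t) (at t)" using D(2)[of t] eq[of t] d(1) by simp
  have "continuous_on {t - d<..<t + d / 2} d\<gamma>"
    using continuous_on_subset[OF D(1), of "{t - d<..<t + d / 2}"]
    by (rule continuous_on_eq) (auto simp: eq)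
  then show "isCont d\<gamma> t"
    using d(1) by (simp add: continuous_on_eq_continuous_at)
qed

lemma
  assumes "c < V (\<gamma> t)"
  shows speed_pos: "0 < norm (d\<gamma> t)" and energy: "G (norm (d\<gamma> t)) = V (\<gamma> t) - c"
proof -
  obtain d where d: "0 < d" "\<And>s. s \<in> {t - d..t + d} \<Longrightarrow> c < V (\<gamma> s)" using above_nhd[OF assms] by blast
  obtain h0 c0 S L where tame: "tame (t - d) (t + d) h0 c0 S L"
    using tame_exists[OF d(2)] by blast
  note h0 = tameD(1)[OF tame] and c0 = tameD(2,3)[OF tame] and L = tameD(4)[OF tame]
    and bi = tameD(5,6)[OF tame] and Vlow = tameD(7)[OF tame] and up = tameD(8)[OF tame]
  define v where "v = norm (d\<gamma> t)"
  define H where "H = V (\<gamma> t) - c"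
  define \<rho> where "\<rho> h = norm ((1 / h) *\<^sub>R (\<gamma> (t + h) - \<gamma> t))" for h
  have \<rho>_lim: "(\<rho> \<longlongrightarrow> v) (at_right 0)"
    unfolding \<rho>_def[abs_def] v_def
    by (rule tendsto_norm, rule filterlim_mono[OF difference_quotient_tendsto[OF gamma_derivative(1)[OF assms]] order_refl])
       (simp add: at_within_le_at)
  have small: "\<forall>\<^sub>F h in at_right 0. 0 < h \<and> h < h0 \<and> h \<le> d"
    using h0 d(1) unfolding eventually_at_right_field by (intro exI[of _ "min h0 d"]) auto
  \<comment> \<open>The lower speed bound of \<open>tame\<close> survives in the limit. Positivity
    allows \<open>\<Phi>\<close> to be differentiated at \<open>v\<close> below and keeps the motion
    away from the degenerate velocity 0.\<close>
  have "c0 \<le> v"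
  proof (rule tendsto_lowerbound[OF \<rho>_lim])
    show "\<forall>\<^sub>F h in at_right 0. c0 \<le> \<rho> h"
      using small
    proof eventually_elim
      case (elim h)
      have "norm (\<gamma> (t + h) - \<gamma> t) = h * \<rho> h" using elim by (simp add: \<rho>_def)
      then have "h * c0 \<le> h * \<rho> h" using bi(1)[of t "t + h"] elim d(1) by (simp add: mult.commute)
      then show ?case using elim by simp
    qed
  qed simp
  then have v: "0 < v" using c0 by simp
  then show "0 < norm (d\<gamma> t)" by (simp add: v_def)
  have ineq: "\<Phi> v + H \<le> \<mu> * (\<Phi> (v / \<mu>) + H)" if \<mu>: "0 < \<mu>" for \<mu>
  proof (rule tendsto_le[OF trivial_limit_at_right_real])
    show "((\<lambda>h. \<mu> * (\<Phi> (\<rho> h / \<mu>) + (H + L * h))) \<longlongrightarrow> \<mu> * (\<Phi> (v / \<mu>) + H)) (at_right 0)"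
    proof -
      have "((\<lambda>h. \<mu> * (\<Phi> (\<rho> h / \<mu>) + (H + L * h))) \<longlongrightarrow> \<mu> * (\<Phi> (v / \<mu>) + (H + L * 0))) (at_right 0)"
        by (intro tendsto_intros continuous_on_tendsto_compose[OF Phi_cont] \<rho>_lim) (use \<mu> in auto)
      then show ?thesis by simp
    qed
    show "((\<lambda>h. \<Phi> (\<rho> h) + (H - L * h)) \<longlongrightarrow> \<Phi> v + H) (at_right 0)"
    proof -
      have "((\<lambda>h. \<Phi> (\<rho> h) + (H - L * h)) \<longlongrightarrow> \<Phi> v + (H - L * 0)) (at_right 0)"
        by (intro tendsto_intros continuous_on_tendsto_compose[OF Phi_cont] \<rho>_lim) auto
      then show ?thesis by simp
    qed
    show "\<forall>\<^sub>F h in at_right 0. \<Phi> (\<rho> h) + (H - L * h) \<le> \<mu> * (\<Phi> (\<rho> h / \<mu>) + (H + L * h))"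
      using small
    proof eventually_elim
      case (elim h)
      then have h: "0 < h" "h < h0" "h \<le> d" by auto
      have \<rho>: "norm (\<gamma> (t + h) - \<gamma> t) = h * \<rho> h" using h by (simp add: \<rho>_def)
      have "(t + h - t) * \<Phi> (norm (\<gamma> (t + h) - \<gamma> t) / (t + h - t)) + integral {t..t + h} (\<lambda>r. V (\<gamma> r) - c)
          \<le> (\<mu> * h) * (\<Phi> (norm (\<gamma> (t + h) - \<gamma> t) / (\<mu> * h)) + (V (\<gamma> t) - c + L * (t + h - t)))"
        by (rule up[OF _ _ _ _ _ Jensen_le Jensen_tendsto]) (use h \<mu> d(1) in auto)
      moreover have "(t + h - t) * (V (\<gamma> t) - c - L * (t + h - t)) \<le> integral {t..t + h} (\<lambda>r. V (\<gamma> r) - c)"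
        by (rule Vlow) (use h d(1) in auto)
      moreover have "norm (\<gamma> (t + h) - \<gamma> t) / (\<mu> * h) = \<rho> h / \<mu>" "norm (\<gamma> (t + h) - \<gamma> t) / (t + h - t) = \<rho> h"
        using h \<mu> by (simp_all add: \<rho>)
      ultimately have "h * (\<Phi> (\<rho> h) + (H - L * h)) \<le> h * (\<mu> * (\<Phi> (\<rho> h / \<mu>) + (H + L * h)))"
        by (simp add: H_def algebra_simps)
      then show ?case using h by simp
    qed
  qed
  \<comment> \<open>Equality holds in \<open>ineq\<close> at \<open>\<mu> = 1\<close>, so this is an
    interior minimum and the derivative vanishes; its value is \<open>H - G v\<close>.\<close>
  have "((\<lambda>\<mu>. \<mu> * (\<Phi> (v / \<mu>) + H)) has_real_derivative (\<Phi> v + H - v * A v)) (at 1)"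
  proof -
    have "((\<lambda>\<mu>. \<Phi> (v / \<mu>)) has_real_derivative A (v / 1) * (- v)) (at 1)"
      by (rule DERIV_chain2[OF Phi_deriv]) (use v in \<open>auto intro!: derivative_eq_intros\<close>)
    then show ?thesis
      by (auto intro!: derivative_eq_intros simp: algebra_simps)
  qed
  moreover have "\<forall>\<mu>. \<bar>1 - \<mu>\<bar> < 1 \<longrightarrow> 1 * (\<Phi> (v / 1) + H) \<le> \<mu> * (\<Phi> (v / \<mu>) + H)"
    using ineq by auto
  ultimately have "\<Phi> v + H - v * A v = 0" by (rule DERIV_local_min[where d = 1, OF _ zero_less_one])
  then show "G (norm (d\<gamma> t)) = V (\<gamma> t) - c" by (simp add: G_eq v_def H_def algebra_simps)
qed

end

section \<open>The Euler--Lagrange equation\<close>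

text \<open>Differentiates \<open>\<sigma>\<close> through the relation
  \<open>g \<circ> \<sigma> = h\<close> without constructing an inverse of \<open>g\<close>:
  Caratheodory's factor \<open>\<psi>\<close> is continuous and nonzero at
  \<open>\<sigma> t\<close>, so one may divide by it. It is applied with \<open>g = G\<close> and
  \<open>\<sigma>\<close> the speed.\<close>

lemma DERIV_of_composition:
  fixes g h \<sigma> :: "real \<Rightarrow> real"
  assumes g: "(g has_real_derivative g') (at (\<sigma> t))" "g' \<noteq> 0"
    and h: "(h has_real_derivative h') (at t)"
    and \<sigma>: "isCont \<sigma> t" and eq: "\<forall>\<^sub>F s in at t. g (\<sigma> s) = h s" "g (\<sigma> t) = h t"
  shows "(\<sigma> has_real_derivative h' / g') (at t)"
proof -
  obtain \<psi> where \<psi>: "\<And>y. g y - g (\<sigma> t) = \<psi> y * (y - \<sigma> t)" "isCont \<psi> (\<sigma> t)" "\<psi> (\<sigma> t) = g'"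
    using g(1) unfolding CARAT_DERIV by blast
  have lim: "((\<lambda>s. \<psi> (\<sigma> s)) \<longlongrightarrow> g') (at t)"
    using isCont_o2[OF \<sigma> \<psi>(2)] \<psi>(3) by (simp add: isCont_def)
  have hl: "((\<lambda>s. (h s - h t) / (s - t)) \<longlongrightarrow> h') (at t)"
    using h by (simp add: has_field_derivative_iff)
  have "\<forall>\<^sub>F s in at t. \<psi> (\<sigma> s) \<noteq> 0"
    by (rule tendsto_imp_eventually_ne[OF lim g(2)])
  with eq(1) have "\<forall>\<^sub>F s in at t. (h s - h t) / (s - t) / \<psi> (\<sigma> s) = (\<sigma> s - \<sigma> t) / (s - t)"
  proof eventually_elim
    case (elim s)
    have "h s - h t = \<psi> (\<sigma> s) * (\<sigma> s - \<sigma> t)" using \<psi>(1)[of "\<sigma> s"] elim(1) eq(2) by simp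
    then show ?case using elim(2) by simp
  qed
  then have "((\<lambda>s. (\<sigma> s - \<sigma> t) / (s - t)) \<longlongrightarrow> h' / g') (at t)"
    using tendsto_divide[OF hl lim g(2)] by (rule Lim_transform_eventually[rotated])
  then show ?thesis by (simp add: has_field_derivative_iff)
qed

text \<open>Because the interval contains \<open>x\<close>, differentiability at the single point
  \<open>x\<close> already controls its whole increment.\<close>

lemma straddle:
  fixes f :: "real \<Rightarrow> 'a::real_normed_vector"
  assumes "(f has_vector_derivative D) (at x)" "0 < e"
  obtains d where "0 < d"
    "\<And>u v. u \<le> x \<Longrightarrow> x \<le> v \<Longrightarrow> v - u < d \<Longrightarrow> norm (f v - f u - (v - u) *\<^sub>R D) \<le> e * (v - u)"
proof -
  obtain d where d: "0 < d" "\<And>y. norm (y - x) < d \<Longrightarrow> norm (f y - f x - (y - x) *\<^sub>R D) \<le> e * norm (y - x)"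
    using assms unfolding has_vector_derivative_def has_derivative_at_alt by blast
  show ?thesis
  proof (rule that[OF d(1)])
    fix u v assume uv: "u \<le> x" "x \<le> v" "v - u < d"
    have "f v - f u - (v - u) *\<^sub>R D = (f v - f x - (v - x) *\<^sub>R D) - (f u - f x - (u - x) *\<^sub>R D)"
      by (simp add: algebra_simps)
    then have "norm (f v - f u - (v - u) *\<^sub>R D)
        \<le> norm (f v - f x - (v - x) *\<^sub>R D) + norm (f u - f x - (u - x) *\<^sub>R D)"
      by (metis norm_triangle_ineq4)
    also have "\<dots> \<le> e * (v - x) + e * (x - u)"
      using d(2)[of v] d(2)[of u] uv by simp
    finally show "norm (f v - f u - (v - u) *\<^sub>R D) \<le> e * (v - u)" by (simp add: algebra_simps)
  qed
qed

context limit_curve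
begin

lemma d\<gamma>_cont: "(\<And>t. t \<in> S \<Longrightarrow> c < V (\<gamma> t)) \<Longrightarrow> continuous_on S d\<gamma>"
  using gamma_derivative(2) continuous_at_imp_continuous_on by blast

lemma prim_gamma: "(\<And>t. t \<in> S \<Longrightarrow> c < V (\<gamma> t)) \<Longrightarrow> prim S \<gamma> d\<gamma>"
  using gamma_derivative(1) d\<gamma>_cont has_vector_derivative_at_within by (intro prim_of_C1) blast+

lemma lagr_gamma_integrable:
  assumes "\<And>t. t \<in> {a..b} \<Longrightarrow> c < V (\<gamma> t)" shows "lagr \<gamma> d\<gamma> integrable_on {a..b}"
proof (cases "a \<le> b")
  case True
  show ?thesis
    by (intro integrable_continuous_interval lagr_continuous prim_gamma d\<gamma>_cont assms True)
qed (simp add: integrable_on_empty)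

text \<open>On a short interval the continuous velocity of \<open>\<gamma>\<close> is almost
  constant, so the limit of Jensen's bounds falls short of the action of \<open>\<gamma>\<close> by
  at most \<open>e\<close> times the length. Bisection assembles these local bounds.\<close>

lemma action_lsc:
  assumes ab: "a \<le> b" and pos: "\<And>t. t \<in> {a..b} \<Longrightarrow> c < V (\<gamma> t)"
    and y: "\<And>n. integral {a..b} (lagr (q n) (p n)) \<le> y n" "y \<longlonglongrightarrow> Y"
  shows "integral {a..b} (lagr \<gamma> d\<gamma>) \<le> Y"
proof -
  \<comment> \<open>Requiring a convergent lower bound, rather than an inequality for a lower limit,
    makes the property additive: the sequences and their limits simply add.\<close>
  define Low where "Low e u v \<longleftrightarrow> (a \<le> u \<and> v \<le> b \<longrightarrow>
    (\<exists>X X0. (\<forall>n. X n \<le> integral {u..v} (lagr (q n) (p n))) \<and> X \<longlonglongrightarrow> X0 \<and>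
       integral {u..v} (lagr \<gamma> d\<gamma>) - e * (v - u) \<le> X0))" for e u v
  have Low: "Low e a b" if "0 < e" for e
  proof (rule Bolzano[OF ab, where P = "Low e"])
    fix u v w assume uvw: "Low e u v" "Low e v w" "u \<le> v" "v \<le> w"
    show "Low e u w"
      unfolding Low_def
    proof
      assume uw: "a \<le> u \<and> w \<le> b"
      obtain X X0 where X: "\<And>n. X n \<le> integral {u..v} (lagr (q n) (p n))" "X \<longlonglongrightarrow> X0"
        "integral {u..v} (lagr \<gamma> d\<gamma>) - e * (v - u) \<le> X0"
        using uvw uw unfolding Low_def by force
      obtain Z Z0 where Z: "\<And>n. Z n \<le> integral {v..w} (lagr (q n) (p n))" "Z \<longlonglongrightarrow> Z0"
        "integral {v..w} (lagr \<gamma> d\<gamma>) - e * (w - v) \<le> Z0"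
        using uvw uw unfolding Low_def by force
      have "integral {u..v} (lagr (q n) (p n)) + integral {v..w} (lagr (q n) (p n)) = integral {u..w} (lagr (q n) (p n))" for n
        by (intro Henstock_Kurzweil_Integration.integral_combine uvw near_min_basic(3)[OF nm])
      then have "X n + Z n \<le> integral {u..w} (lagr (q n) (p n))" for n
        using X(1)[of n] Z(1)[of n] by (metis add_mono)
      moreover have "(\<lambda>n. X n + Z n) \<longlonglongrightarrow> X0 + Z0" by (intro tendsto_add X Z)
      moreover have "integral {u..v} (lagr \<gamma> d\<gamma>) + integral {v..w} (lagr \<gamma> d\<gamma>) = integral {u..w} (lagr \<gamma> d\<gamma>)"
        by (intro Henstock_Kurzweil_Integration.integral_combine uvw lagr_gamma_integrable pos) (use uw in auto)
      then have "integral {u..w} (lagr \<gamma> d\<gamma>) - e * (w - u) \<le> X0 + Z0"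
        using X(3) Z(3) by (simp add: algebra_simps)
      ultimately show "\<exists>X X0. (\<forall>n. X n \<le> integral {u..w} (lagr (q n) (p n))) \<and> X \<longlonglongrightarrow> X0 \<and>
          integral {u..w} (lagr \<gamma> d\<gamma>) - e * (w - u) \<le> X0"
        by (intro exI[of _ "\<lambda>n. X n + Z n"] exI[of _ "X0 + Z0"]) simp
    qed
  next
    fix x assume x: "a \<le> x" "x \<le> b"
    have posx: "c < V (\<gamma> x)" using pos x by simp
    define D where "D = d\<gamma> x"
    have "isCont (\<lambda>z::'a. \<Phi> (norm z)) D"
      by (rule has_derivative_continuous[OF Phi_norm_derivative])
    then obtain e1 where e1: "0 < e1" "\<And>z. dist z D < e1 \<Longrightarrow> dist (\<Phi> (norm z)) (\<Phi> (norm D)) < e / 2"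
      unfolding continuous_at_eps_delta using \<open>0 < e\<close> by (metis half_gt_zero)
    obtain d1 where d1: "0 < d1" "\<And>r. dist r x < d1 \<Longrightarrow> dist (d\<gamma> r) D < e1"
      using gamma_derivative(2)[OF posx] e1(1) unfolding continuous_at_eps_delta D_def by metis
    obtain d2 where d2: "0 < d2"
      "\<And>u v. u \<le> x \<Longrightarrow> x \<le> v \<Longrightarrow> v - u < d2 \<Longrightarrow> norm (\<gamma> v - \<gamma> u - (v - u) *\<^sub>R D) \<le> e1 / 2 * (v - u)"
      using straddle[OF gamma_derivative(1)[OF posx], of "e1 / 2"] e1(1) unfolding D_def by (metis half_gt_zero)
    show "\<exists>d>0. \<forall>u v. u \<le> x \<and> x \<le> v \<and> v - u < d \<longrightarrow> Low e u v"
    proof (intro exI[of _ "min d1 d2"] conjI allI impI)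
      fix u v assume uv: "u \<le> x \<and> x \<le> v \<and> v - u < min d1 d2"
      show "Low e u v"
        unfolding Low_def
      proof
        assume uv': "a \<le> u \<and> v \<le> b"
        show "\<exists>X X0. (\<forall>n. X n \<le> integral {u..v} (lagr (q n) (p n))) \<and> X \<longlonglongrightarrow> X0 \<and>
            integral {u..v} (lagr \<gamma> d\<gamma>) - e * (v - u) \<le> X0"
        proof (cases "u = v")
          case True
          then show ?thesis by (intro exI[of _ "\<lambda>_. 0"] exI[of _ 0]) simp
        next
          case False
          then have lt: "u < v" using uv by auto
          define X0 where "X0 = (v - u) * \<Phi> (norm (\<gamma> v - \<gamma> u) / (v - u)) + integral {u..v} (\<lambda>r. V (\<gamma> r) - c)"
          have "dist ((1 / (v - u)) *\<^sub>R (\<gamma> v - \<gamma> u)) D < e1"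
          proof -
            have "(1 / (v - u)) *\<^sub>R (\<gamma> v - \<gamma> u) - D = (1 / (v - u)) *\<^sub>R (\<gamma> v - \<gamma> u - (v - u) *\<^sub>R D)"
              using lt by (simp add: scaleR_diff_right)
            then have "dist ((1 / (v - u)) *\<^sub>R (\<gamma> v - \<gamma> u)) D = (1 / (v - u)) * norm (\<gamma> v - \<gamma> u - (v - u) *\<^sub>R D)"
              unfolding dist_norm using lt by (metis abs_of_pos divide_pos_pos norm_scaleR zero_less_one diff_gt_0_iff_gt)
            also have "\<dots> \<le> (1 / (v - u)) * (e1 / 2 * (v - u))"
              using d2(2)[of u v] uv lt by (intro mult_left_mono) auto
            also have "\<dots> < e1" using lt e1(1) by simp
            finally show ?thesis .
          qed
          from e1(2)[OF this] have "\<bar>\<Phi> (norm (\<gamma> v - \<gamma> u) / (v - u)) - \<Phi> (norm D)\<bar> < e / 2"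
            using lt unfolding dist_real_def by simp
          then have \<Phi>: "\<Phi> (norm D) - e / 2 \<le> \<Phi> (norm (\<gamma> v - \<gamma> u) / (v - u))" by linarith
          have posuv: "c < V (\<gamma> r)" if "r \<in> {u..v}" for r using pos that uv' by auto
          have "integral {u..v} (lagr \<gamma> d\<gamma>) \<le> integral {u..v} (\<lambda>r. (\<Phi> (norm D) + e / 2) + (V (\<gamma> r) - c))"
          proof (rule integral_le[OF lagr_gamma_integrable])
            show "(\<lambda>r. (\<Phi> (norm D) + e / 2) + (V (\<gamma> r) - c)) integrable_on {u..v}"
              by (intro integrable_continuous_interval continuous_intros V_gamma_cont)
            fix r assume r: "r \<in> {u..v}"
            then have "dist r x < d1" using uv by (auto simp: dist_real_def)
            from e1(2)[OF d1(2)[OF this]] have "\<Phi> (norm (d\<gamma> r)) \<le> \<Phi> (norm D) + e / 2"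
              unfolding dist_real_def by linarith
            then show "lagr \<gamma> d\<gamma> r \<le> (\<Phi> (norm D) + e / 2) + (V (\<gamma> r) - c)"
              by (simp add: lagr_def)
          qed (use posuv in auto)
          also have "\<dots> = (v - u) * (\<Phi> (norm D) + e / 2) + integral {u..v} (\<lambda>r. V (\<gamma> r) - c)"
          proof -
            have "(\<lambda>r. V (\<gamma> r) - c) integrable_on {u..v}"
              by (intro integrable_continuous_interval continuous_intros V_gamma_cont)
            from integral_add[OF integrable_const_ivl this] show ?thesis using lt by simp
          qed
          also have "\<dots> \<le> X0 + e * (v - u)"
          proof -
            have "(v - u) * (\<Phi> (norm D) + e / 2) \<le> (v - u) * (\<Phi> (norm (\<gamma> v - \<gamma> u) / (v - u)) + e)"
              using \<Phi> lt by (intro mult_left_mono) auto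
            then show ?thesis by (simp only: X0_def distrib_left mult.commute[of e])
          qed
          finally have "integral {u..v} (lagr \<gamma> d\<gamma>) - e * (v - u) \<le> X0" by simp
          moreover have "(\<lambda>n. Jensen n u v) \<longlonglongrightarrow> X0" unfolding X0_def by (rule Jensen_tendsto[OF lt])
          ultimately show ?thesis
            using Jensen_le[OF lt] by (intro exI[of _ "\<lambda>n. Jensen n u v"] exI[of _ X0]) auto
        qed
      qed
    qed (use d1 d2 in auto)
  qed
  have "integral {a..b} (lagr \<gamma> d\<gamma>) \<le> Y + e" if "0 < e" for e
  proof -
    define e' where "e' = e / (b - a + 1)"
    have e': "0 < e'" "e' * (b - a) \<le> e" using that ab by (auto simp: e'_def field_simps)
    obtain X X0 where X: "\<And>n. X n \<le> integral {a..b} (lagr (q n) (p n))" "X \<longlonglongrightarrow> X0"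
      "integral {a..b} (lagr \<gamma> d\<gamma>) - e' * (b - a) \<le> X0"
      using Low[OF e'(1)] unfolding Low_def by auto
    have "X0 \<le> Y"
      by (rule LIMSEQ_le[OF X(2) y(2)]) (use X(1) y(1) order_trans in blast)
    then show ?thesis using X(3) e'(2) by linarith
  qed
  then show ?thesis by (rule field_le_epsilon)
qed

text \<open>The end points of \<open>q n\<close> differ from those of \<open>\<gamma>\<close> by
  \<open>e n\<close> and \<open>f n\<close>. Adding an affine function with these end values turns
  \<open>\<sigma>\<close> into a competitor for \<open>q n\<close>; both the correction and its
  derivative tend to 0, so the actions converge to that of \<open>\<sigma>\<close>.\<close>

lemma gamma_minimal:
  assumes ab: "a < b" and pos: "\<And>t. t \<in> {a..b} \<Longrightarrow> c < V (\<gamma> t)"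
    and \<sigma>: "\<And>t. t \<in> {a..b} \<Longrightarrow> (\<sigma> has_vector_derivative \<sigma>' t) (at t within {a..b})"
      "continuous_on {a..b} \<sigma>'" "\<And>t. t \<in> {a..b} \<Longrightarrow> c < V (\<sigma> t)" "\<sigma> a = \<gamma> a" "\<sigma> b = \<gamma> b"
  shows "integral {a..b} (lagr \<gamma> d\<gamma>) \<le> integral {a..b} (lagr \<sigma> \<sigma>')"
proof -
  define \<tau> where "\<tau> = b - a"
  have \<tau>: "0 < \<tau>" using ab by (simp add: \<tau>_def)
  define e f where "e n = q n a - \<gamma> a" and "f n = q n b - \<gamma> b" for n
  have ef_lim: "e \<longlonglongrightarrow> 0" "f \<longlonglongrightarrow> 0"
    unfolding e_def[abs_def] f_def[abs_def] using conv[of a] conv[of b] by (auto simp: LIM_zero_iff)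
  have ef_bound: "norm (e n) \<le> 2 * R" "norm (f n) \<le> 2 * R" for n
    using norm_triangle_ineq4[of "q n a" "\<gamma> a"] norm_triangle_ineq4[of "q n b" "\<gamma> b"]
      q_bound[of n a] q_bound[of n b] gamma_bound[of a] gamma_bound[of b] by (auto simp: e_def f_def)
  define s s' where "s n r = seg (e n) (f n) \<tau> r" and "s' n r = seg' (e n) (f n) \<tau> r" for n r
  have s_small: "norm (s n r) \<le> norm (e n) + norm (f n)" if "r \<in> {0..\<tau>}" for n r
  proof -
    have "s n r \<in> closed_segment (e n) (f n)" unfolding s_def by (rule seg_in_segment[OF \<tau> that])
    moreover have "closed_segment (e n) (f n) \<subseteq> cball 0 (norm (e n) + norm (f n))"
      by (intro closed_segment_subset) auto
    ultimately show ?thesis by auto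
  qed
  have s'_small: "norm (s' n r) \<le> (norm (e n) + norm (f n)) / \<tau>" for n r
    using norm_triangle_ineq4[of "f n" "e n"] \<tau> by (simp add: s'_def seg'_def divide_right_mono)
  have sum_lim: "(\<lambda>n. norm (e n) + norm (f n)) \<longlonglongrightarrow> 0"
    using tendsto_add[OF tendsto_norm[OF ef_lim(1)] tendsto_norm[OF ef_lim(2)]] by simp
  have s_lim: "(\<lambda>n. s n r) \<longlonglongrightarrow> 0" if "r \<in> {0..\<tau>}" for r
    by (rule Lim_null_comparison[OF _ sum_lim]) (use s_small[OF that] in auto)
  have s'_lim: "(\<lambda>n. s' n r) \<longlonglongrightarrow> 0" for r
  proof (rule Lim_null_comparison)
    show "\<forall>\<^sub>F n in sequentially. norm (s' n r) \<le> (norm (e n) + norm (f n)) / \<tau>"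
      using s'_small by simp
    show "(\<lambda>n. (norm (e n) + norm (f n)) / \<tau>) \<longlonglongrightarrow> 0"
      using tendsto_divide[OF sum_lim tendsto_const, of \<tau>] \<tau> by simp
  qed
  have \<sigma>c: "continuous_on {a..b} \<sigma>"
    using \<sigma>(1) by (meson continuous_on_eq_continuous_within has_vector_derivative_continuous)
  have pr\<sigma>: "prim {a..b} \<sigma> \<sigma>'" by (rule prim_of_C1[OF \<sigma>(1,2)])
  define \<Sigma> \<Sigma>' where "\<Sigma> n r = \<sigma> (r + a) + s n r" and "\<Sigma>' n r = \<sigma>' (r + a) + s' n r" for n r
  have pr\<Sigma>: "prim {0..\<tau>} (\<Sigma> n) (\<Sigma>' n)" for n
    unfolding \<Sigma>_def[abs_def] \<Sigma>'_def[abs_def] s_def s'_def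
    by (intro prim_add prim_seg prim_shift[OF pr\<sigma>]) (auto simp: \<tau>_def)
  have \<sigma>'_shift: "continuous_on {0..\<tau>} (\<lambda>r. \<sigma>' (r + a))"
    by (rule continuous_on_compose2[OF \<sigma>(2)]) (auto intro!: continuous_intros simp: \<tau>_def)
  have \<Sigma>'_cont: "continuous_on {0..\<tau>} (\<Sigma>' n)" for n
    unfolding \<Sigma>'_def[abs_def] s'_def
    by (intro continuous_on_add seg'_continuous \<sigma>'_shift)
  have sh: "r + a \<in> {a..b}" if "r \<in> {0..\<tau>}" for r using that by (auto simp: \<tau>_def)
  obtain r0 where r0: "0 < r0" "r0 \<le> 1" "\<And>t z. t \<in> {a..b} \<Longrightarrow> z \<in> ball (\<sigma> t) r0 \<Longrightarrow> c < V z"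
    using tube[OF \<sigma>c \<sigma>(3)] by blast
  have "\<forall>\<^sub>F n in sequentially. norm (e n) + norm (f n) < r0"
    using sum_lim r0(1) by (rule order_tendstoD(2))
  then have upper: "\<forall>\<^sub>F n in sequentially. integral {a..b} (lagr (q n) (p n))
      \<le> integral {0..\<tau>} (lagr (\<Sigma> n) (\<Sigma>' n)) + \<epsilon> n"
  proof eventually_elim
    case (elim n)
    show ?case
    proof (rule near_min_competitor[OF nm less_imp_le[OF ab] pr\<Sigma> \<Sigma>'_cont less_imp_le[OF \<tau>]])
      fix r assume r: "r \<in> {0..\<tau>}"
      have "\<Sigma> n r \<in> ball (\<sigma> (r + a)) r0"
        using s_small[OF r, of n] elim by (simp add: \<Sigma>_def dist_norm)
      then show "c \<le> V (\<Sigma> n r)" using r0(3)[OF sh[OF r]] by force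
    next
      have "\<tau> + a = b" by (simp add: \<tau>_def)
      then show "\<Sigma> n \<tau> = q n b \<or> \<Sigma> n \<tau> \<in> Vp \<and> V (\<Sigma> n \<tau>) = c"
        using \<tau> \<sigma>(5) by (simp add: \<Sigma>_def s_def f_def)
    qed (use \<sigma>(4) in \<open>simp add: \<Sigma>_def s_def e_def\<close>)
  qed
  have lim: "(\<lambda>n. integral {0..\<tau>} (lagr (\<Sigma> n) (\<Sigma>' n))) \<longlonglongrightarrow> integral {0..\<tau>} (\<lambda>r. lagr \<sigma> \<sigma>' (r + a))"
  proof -
    obtain B where B: "\<And>t. t \<in> {a..b} \<Longrightarrow> norm (\<sigma> t) \<le> B"
      using compact_imp_bounded[OF compact_continuous_image[OF \<sigma>c compact_Icc]] unfolding bounded_iff by blast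
    obtain B' where B': "\<And>t. t \<in> {a..b} \<Longrightarrow> norm (\<sigma>' t) \<le> B'"
      using compact_imp_bounded[OF compact_continuous_image[OF \<sigma>(2) compact_Icc]] unfolding bounded_iff by blast
    have "compact ((\<lambda>x. V x - c) ` cball 0 (B + 4 * R))"
      by (intro compact_continuous_image continuous_intros V_cont compact_cball)
    from compact_imp_bounded[OF this]
    obtain M where M: "\<And>x. x \<in> cball 0 (B + 4 * R) \<Longrightarrow> norm (V x - c) \<le> M"
      unfolding bounded_iff by blast
    show ?thesis
    proof (rule dominated_convergence(2)[where h = "\<lambda>_. \<Phi> (B' + 4 * R / \<tau>) + M"])
      show "lagr (\<Sigma> n) (\<Sigma>' n) integrable_on {0..\<tau>}" for n
        by (intro integrable_continuous_interval lagr_continuous pr\<Sigma> \<Sigma>'_cont less_imp_le[OF \<tau>])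
      show "norm (lagr (\<Sigma> n) (\<Sigma>' n) r) \<le> \<Phi> (B' + 4 * R / \<tau>) + M" if r: "r \<in> {0..\<tau>}" for n r
      proof -
        have "norm (\<Sigma> n r) \<le> B + 4 * R"
          using norm_triangle_ineq[of "\<sigma> (r + a)" "s n r"] B[OF sh[OF r]] s_small[OF r, of n] ef_bound[of n]
          by (simp add: \<Sigma>_def)
        then have "norm (V (\<Sigma> n r) - c) \<le> M" by (intro M) simp
        moreover have "norm (\<Sigma>' n r) \<le> B' + 4 * R / \<tau>"
        proof -
          have "(norm (e n) + norm (f n)) / \<tau> \<le> 4 * R / \<tau>"
            using ef_bound[of n] \<tau> by (intro divide_right_mono) auto
          then show ?thesis
            using norm_triangle_ineq[of "\<sigma>' (r + a)" "s' n r"] B'[OF sh[OF r]] s'_small[of n r]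
            by (simp add: \<Sigma>'_def)
        qed
        then have "\<Phi> (norm (\<Sigma>' n r)) \<le> \<Phi> (B' + 4 * R / \<tau>)" by (intro Phi_mono) auto
        ultimately show ?thesis unfolding lagr_def real_norm_def
          using Phi_nonneg[of "norm (\<Sigma>' n r)"] by linarith
      qed
      show "(\<lambda>n. lagr (\<Sigma> n) (\<Sigma>' n) r) \<longlonglongrightarrow> lagr \<sigma> \<sigma>' (r + a)" if r: "r \<in> {0..\<tau>}" for r
      proof -
        have "(\<lambda>n. \<Sigma> n r) \<longlonglongrightarrow> \<sigma> (r + a) + 0" "(\<lambda>n. \<Sigma>' n r) \<longlonglongrightarrow> \<sigma>' (r + a) + 0"
          unfolding \<Sigma>_def \<Sigma>'_def by (intro tendsto_intros s_lim[OF r] s'_lim)+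
        then have l: "(\<lambda>n. \<Sigma> n r) \<longlonglongrightarrow> \<sigma> (r + a)" "(\<lambda>n. \<Sigma>' n r) \<longlonglongrightarrow> \<sigma>' (r + a)" by simp_all
        have "(\<lambda>n. V (\<Sigma> n r)) \<longlonglongrightarrow> V (\<sigma> (r + a))"
          by (rule continuous_on_tendsto_compose[OF V_cont[of UNIV] l(1)]) auto
        moreover have "(\<lambda>n. \<Phi> (norm (\<Sigma>' n r))) \<longlonglongrightarrow> \<Phi> (norm (\<sigma>' (r + a)))"
          by (rule continuous_on_tendsto_compose[OF Phi_cont tendsto_norm[OF l(2)]]) auto
        ultimately show ?thesis unfolding lagr_def by (intro tendsto_intros)
      qed
    qed auto
  qed
  have shift: "integral {0..\<tau>} (\<lambda>r. lagr \<sigma> \<sigma>' (r + a)) = integral {a..b} (lagr \<sigma> \<sigma>')"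
  proof -
    have "(lagr \<sigma> \<sigma>' has_integral integral {a..b} (lagr \<sigma> \<sigma>')) {0 + a..\<tau> + a}"
      unfolding \<tau>_def using ab
      by (simp add: integrable_integral integrable_continuous_interval lagr_continuous pr\<sigma> \<sigma>(2))
    then show ?thesis by (intro integral_unique has_integral_shift_real)
  qed
  \<comment> \<open>The competitor estimate holds only for large \<open>n\<close>, while
    \<open>action_lsc\<close> wants a bound for all \<open>n\<close>; taking the maximum repairs
    this without affecting the limit.\<close>
  define y where "y n = max (integral {a..b} (lagr (q n) (p n))) (integral {0..\<tau>} (lagr (\<Sigma> n) (\<Sigma>' n)) + \<epsilon> n)" for n
  have "y \<longlonglongrightarrow> integral {a..b} (lagr \<sigma> \<sigma>') + 0"
  proof (rule Lim_transform_eventually)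
    show "(\<lambda>n. integral {0..\<tau>} (lagr (\<Sigma> n) (\<Sigma>' n)) + \<epsilon> n) \<longlonglongrightarrow> integral {a..b} (lagr \<sigma> \<sigma>') + 0"
      using tendsto_add[OF lim eps(1)] by (simp add: shift)
    show "\<forall>\<^sub>F n in sequentially. integral {0..\<tau>} (lagr (\<Sigma> n) (\<Sigma>' n)) + \<epsilon> n = y n"
      using upper by eventually_elim (simp add: y_def)
  qed
  then show ?thesis
    using action_lsc[OF less_imp_le[OF ab] pos, of y] by (simp add: y_def)
qed

text \<open>Du Bois-Reymond: the variation is chosen so that the first variation becomes the
  integral of \<open>norm (\<zeta> t)\<^sup>2\<close>.\<close>

lemma euler_lagrange_integrated:
  assumes ab: "a < b" and pos: "\<And>t. t \<in> {a..b} \<Longrightarrow> c < V (\<gamma> t)"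
  obtains k where "\<And>t. t \<in> {a..b} \<Longrightarrow> momentum (d\<gamma> t) = k + integral {a..t} (\<lambda>s. gradient V (\<gamma> s))"
proof -
  define g where "g s = gradient V (\<gamma> s)" for s
  have g: "continuous_on {a..b} g"
    unfolding g_def[abs_def] by (rule continuous_on_compose2[OF gradient_cont gamma_cont]) simp
  define W where "W t = integral {a..t} g" for t
  have W: "(W has_vector_derivative g t) (at t within {a..b})" if "t \<in> {a..b}" for t
    unfolding W_def[abs_def] by (rule integral_has_vector_derivative[OF g that])
  have Wc: "continuous_on {a..b} W"
    using W by (meson continuous_on_eq_continuous_within has_vector_derivative_continuous)
  have dc: "continuous_on {a..b} d\<gamma>" by (rule d\<gamma>_cont[OF pos])
  have mc: "continuous_on {a..b} (\<lambda>t. momentum (d\<gamma> t))"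
    by (rule continuous_on_compose2[OF momentum_cont dc]) simp
  define w where "w t = momentum (d\<gamma> t) - W t" for t
  have wc: "continuous_on {a..b} w" unfolding w_def[abs_def] by (intro continuous_intros mc Wc)
  \<comment> \<open>Subtracting the mean makes the primitive \<open>\<eta>\<close> of
    \<open>\<zeta>\<close> vanish at both ends, as a variation with fixed end points must.\<close>
  define k where "k = (1 / (b - a)) *\<^sub>R integral {a..b} w"
  define \<zeta> where "\<zeta> t = w t - k" for t
  have \<zeta>c: "continuous_on {a..b} \<zeta>" unfolding \<zeta>_def[abs_def] by (intro continuous_intros wc)
  have "integral {a..b} \<zeta> = integral {a..b} w - (b - a) *\<^sub>R k"
    unfolding \<zeta>_def[abs_def] using integral_diff[OF integrable_continuous_interval[OF wc] integrable_const_ivl[of k]] ab by simp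
  then have \<zeta>0: "integral {a..b} \<zeta> = 0" using ab by (simp add: k_def)
  define \<eta> where "\<eta> t = integral {a..t} \<zeta>" for t
  have \<eta>: "(\<eta> has_vector_derivative \<zeta> t) (at t within {a..b})" if "t \<in> {a..b}" for t
    unfolding \<eta>_def[abs_def] by (rule integral_has_vector_derivative[OF \<zeta>c that])
  have \<eta>c: "continuous_on {a..b} \<eta>"
    using \<eta> by (meson continuous_on_eq_continuous_within has_vector_derivative_continuous)
  have \<eta>0: "\<eta> a = 0" "\<eta> b = 0" using \<zeta>0 by (simp_all add: \<eta>_def)
  define \<sigma> \<sigma>' where "\<sigma> x t = \<gamma> t + x *\<^sub>R \<eta> t" and "\<sigma>' x t = d\<gamma> t + x *\<^sub>R \<zeta> t" for x t
  define F where "F x = integral {a..b} (\<lambda>t. lagr (\<sigma> x) (\<sigma>' x) t)" for x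
  define Fx where "Fx x t = momentum (\<sigma>' x t) \<bullet> \<zeta> t + gradient V (\<sigma> x t) \<bullet> \<eta> t" for x t
  have \<sigma>d: "(\<sigma> x has_vector_derivative \<sigma>' x t) (at t within {a..b})" if "t \<in> {a..b}" for x t
    unfolding \<sigma>_def[abs_def] \<sigma>'_def
    using gamma_derivative(1)[OF pos[OF that]] \<eta>[OF that]
    by (auto intro!: derivative_eq_intros intro: has_vector_derivative_at_within)
  have \<sigma>'c: "continuous_on {a..b} (\<sigma>' x)" for x
    unfolding \<sigma>'_def[abs_def] by (intro continuous_intros dc \<zeta>c)
  have F_deriv: "(F has_real_derivative integral {a..b} (Fx 0)) (at 0)"
  proof -
    have "((\<lambda>x. integral (cbox a b) (lagr (\<sigma> x) (\<sigma>' x))) has_real_derivative integral (cbox a b) (Fx 0)) (at 0 within UNIV)"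
    proof (rule leibniz_rule_field_derivative)
      show "((\<lambda>x. lagr (\<sigma> x) (\<sigma>' x) t) has_real_derivative Fx x t) (at x within UNIV)" for x t
      proof -
        have "((\<lambda>x. \<Phi> (norm (\<sigma>' x t))) has_derivative (\<lambda>h. momentum (\<sigma>' x t) \<bullet> (h *\<^sub>R \<zeta> t))) (at x)"
          unfolding \<sigma>'_def
          by (rule has_derivative_compose[OF _ Phi_norm_derivative]) (auto intro!: derivative_eq_intros)
        moreover have "((\<lambda>x. V (\<sigma> x t)) has_derivative (\<lambda>h. gradient V (\<sigma> x t) \<bullet> (h *\<^sub>R \<eta> t))) (at x)"
          unfolding \<sigma>_def
          by (rule has_derivative_compose[OF _ V_derivative]) (auto intro!: derivative_eq_intros)
        ultimately have "((\<lambda>x. \<Phi> (norm (\<sigma>' x t)) + V (\<sigma> x t) - c) has_derivative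
            (\<lambda>h. momentum (\<sigma>' x t) \<bullet> (h *\<^sub>R \<zeta> t) + gradient V (\<sigma> x t) \<bullet> (h *\<^sub>R \<eta> t) - 0)) (at x)"
          by (intro has_derivative_add has_derivative_diff has_derivative_const)
        moreover have "(\<lambda>h. momentum (\<sigma>' x t) \<bullet> (h *\<^sub>R \<zeta> t) + gradient V (\<sigma> x t) \<bullet> (h *\<^sub>R \<eta> t) - 0) = (*) (Fx x t)"
          by (auto simp: Fx_def algebra_simps)
        ultimately show ?thesis
          by (simp add: lagr_def has_field_derivative_def)
      qed
      show "lagr (\<sigma> x) (\<sigma>' x) integrable_on cbox a b" for x
        unfolding cbox_interval
        by (intro integrable_continuous_interval lagr_continuous prim_of_C1[OF \<sigma>d \<sigma>'c] \<sigma>'c less_imp_le[OF ab])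
      have snd: "continuous_on (UNIV \<times> cbox a b) (\<lambda>z. f (snd z))" if "continuous_on {a..b} f" for f :: "real \<Rightarrow> 'a"
        by (rule continuous_on_compose2[OF that]) (auto intro!: continuous_intros)
      show "continuous_on (UNIV \<times> cbox a b) (\<lambda>(x, t). Fx x t)"
        unfolding Fx_def \<sigma>_def \<sigma>'_def split_beta
        by (intro continuous_intros snd \<zeta>c \<eta>c dc gamma_cont continuous_on_compose2[OF momentum_cont]
            continuous_on_compose2[OF gradient_cont]) auto
    qed auto
    then show ?thesis by (simp add: F_def[abs_def])
  qed
  obtain r0 where r0: "0 < r0" "r0 \<le> 1" "\<And>t z. t \<in> {a..b} \<Longrightarrow> z \<in> ball (\<gamma> t) r0 \<Longrightarrow> c < V z"
    using tube[OF gamma_cont pos] by metis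
  obtain B where B: "0 < B" "\<And>t. t \<in> {a..b} \<Longrightarrow> norm (\<eta> t) \<le> B"
    using compact_imp_bounded[OF compact_continuous_image[OF \<eta>c compact_Icc]] unfolding bounded_pos by blast
  have "F 0 \<le> F x" if x: "\<bar>0 - x\<bar> < r0 / B" for x
  proof -
    have "integral {a..b} (lagr \<gamma> d\<gamma>) \<le> integral {a..b} (lagr (\<sigma> x) (\<sigma>' x))"
    proof (rule gamma_minimal[OF ab pos \<sigma>d \<sigma>'c])
      fix t assume t: "t \<in> {a..b}"
      have "\<bar>x\<bar> * norm (\<eta> t) \<le> \<bar>x\<bar> * B" using B(2)[OF t] by (intro mult_left_mono) auto
      also have "\<dots> < r0" using x B(1) by (simp add: field_simps)
      finally have "\<sigma> x t \<in> ball (\<gamma> t) r0" by (simp add: \<sigma>_def dist_norm)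
      then show "c < V (\<sigma> x t)" by (rule r0(3)[OF t])
    qed (auto simp: \<sigma>_def \<eta>0)
    moreover have "lagr (\<sigma> 0) (\<sigma>' 0) = lagr \<gamma> d\<gamma>" by (simp add: lagr_def[abs_def] \<sigma>_def \<sigma>'_def)
    ultimately show ?thesis by (simp add: F_def)
  qed
  then have Fx0: "integral {a..b} (Fx 0) = 0"
    using r0(1) B(1) by (intro DERIV_local_min[OF F_deriv, of "r0 / B"]) auto
  have parts: "((\<lambda>t. W t \<bullet> \<zeta> t + g t \<bullet> \<eta> t) has_integral W b \<bullet> \<eta> b - W a \<bullet> \<eta> a) {a..b}"
    using bounded_bilinear.has_vector_derivative[OF bounded_bilinear_inner W \<eta>]
    by (intro fundamental_theorem_of_calculus) (use ab in auto)
  \<comment> \<open>Three vanishing integrals are combined: the first variation, the product rule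
    for \<open>W \<bullet> \<eta>\<close> with zero boundary values, and
    \<open>k \<bullet> \<zeta>\<close> with \<open>\<zeta>\<close> of mean zero. Pointwise the
    combination is \<open>\<zeta> t \<bullet> \<zeta> t\<close>.\<close>
  have "((\<lambda>t. Fx 0 t - (W t \<bullet> \<zeta> t + g t \<bullet> \<eta> t) - k \<bullet> \<zeta> t) has_integral 0 - 0 - 0) {a..b}"
  proof (intro has_integral_diff)
    have "Fx 0 integrable_on {a..b}"
      unfolding Fx_def[abs_def] \<sigma>_def \<sigma>'_def
      by (intro integrable_continuous_interval continuous_intros \<zeta>c \<eta>c dc gamma_cont
          continuous_on_compose2[OF momentum_cont] continuous_on_compose2[OF gradient_cont]) auto
    then show "(Fx 0 has_integral 0) {a..b}" using Fx0 by (simp add: has_integral_iff)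
    show "((\<lambda>t. W t \<bullet> \<zeta> t + g t \<bullet> \<eta> t) has_integral 0) {a..b}" using parts \<eta>0 by simp
    have "(\<zeta> has_integral 0) {a..b}"
      using integrable_continuous_interval[OF \<zeta>c] \<zeta>0 by (simp add: has_integral_iff)
    from has_integral_linear[OF this bounded_linear_inner_right[of k]]
    show "((\<lambda>t. k \<bullet> \<zeta> t) has_integral 0) {a..b}" by (simp add: o_def)
  qed
  moreover have "Fx 0 t - (W t \<bullet> \<zeta> t + g t \<bullet> \<eta> t) - k \<bullet> \<zeta> t = \<zeta> t \<bullet> \<zeta> t" for t
    by (simp add: Fx_def \<sigma>_def \<sigma>'_def g_def \<zeta>_def w_def inner_diff_left)
  ultimately have "((\<lambda>t. \<zeta> t \<bullet> \<zeta> t) has_integral 0) (cbox a b)" by simp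
  then have "\<zeta> t \<bullet> \<zeta> t = 0" if "t \<in> {a..b}" for t
    using has_integral_0_cbox_imp_0[of a b "\<lambda>t. \<zeta> t \<bullet> \<zeta> t" t] that ab
    by (auto intro!: continuous_intros \<zeta>c)
  then have "momentum (d\<gamma> t) - W t - k = 0" if "t \<in> {a..b}" for t
    using that unfolding inner_eq_zero_iff by (simp add: \<zeta>_def w_def)
  then have "momentum (d\<gamma> t) = k + W t" if "t \<in> {a..b}" for t
    using that by (simp add: algebra_simps)
  then show ?thesis by (intro that[of k]) (simp add: W_def g_def[abs_def])
qed

lemma euler_lagrange:
  assumes "c < V (\<gamma> t)"
  shows "((\<lambda>s. momentum (d\<gamma> s)) has_vector_derivative gradient V (\<gamma> t)) (at t)"
proof -
  obtain d where d: "0 < d" "\<And>s. s \<in> {t - d..t + d} \<Longrightarrow> c < V (\<gamma> s)" using above_nhd[OF assms] by blast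
  have lt: "t - d < t + d" using d(1) by simp
  obtain k where k: "\<And>s. s \<in> {t - d..t + d} \<Longrightarrow>
      momentum (d\<gamma> s) = k + integral {t - d..s} (\<lambda>s. gradient V (\<gamma> s))"
    using euler_lagrange_integrated[OF lt d(2)] by blast
  have g: "continuous_on {t - d..t + d} (\<lambda>s. gradient V (\<gamma> s))"
    by (rule continuous_on_compose2[OF gradient_cont gamma_cont]) simp
  have "((\<lambda>s. k + integral {t - d..s} (\<lambda>s. gradient V (\<gamma> s))) has_vector_derivative 0 + gradient V (\<gamma> t))
      (at t within {t - d..t + d})"
    using d(1) by (intro has_vector_derivative_add has_vector_derivative_const integral_has_vector_derivative g) auto
  then have "((\<lambda>s. k + integral {t - d..s} (\<lambda>s. gradient V (\<gamma> s))) has_vector_derivative gradient V (\<gamma> t)) (at t)"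
    using at_within_interior[of t "{t - d..t + d}"] d(1) by simp
  then show ?thesis
    by (rule has_vector_derivative_transform_within_open[where S = "{t - d<..<t + d}"])
       (use d(1) k in auto)
qed

text \<open>The energy identity gives a continuous derivative of the speed, since \<open>G\<close>
  has nonzero derivative at positive speeds. The velocity is the momentum divided by
  \<open>\<phi>\<close> of the speed, so the product rule and the Euler--Lagrange equation yield
  \<open>D\<close>.\<close>

lemma d\<gamma>_derivative:
  obtains D where "\<And>t. c < V (\<gamma> t) \<Longrightarrow> (d\<gamma> has_vector_derivative D t) (at t)"
    "continuous_on {t. c < V (\<gamma> t)} D"
proof -
  define U where "U = {t. c < V (\<gamma> t)}"
  have U: "open U" unfolding U_def by (intro open_Collect_less continuous_intros V_gamma_cont)
  define s where "s t = norm (d\<gamma> t)" for t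
  define g where "g t = gradient V (\<gamma> t)" for t
  obtain f where f: "\<And>s. s > 0 \<Longrightarrow> (\<phi> has_real_derivative f s) (at s)" "continuous_on {0<..} f"
    using phi_derivative by blast
  have spos: "0 < s t" if "t \<in> U" for t using speed_pos that by (simp add: s_def U_def)
  have dc: "continuous_on U d\<gamma>" by (rule d\<gamma>_cont) (simp add: U_def)
  have sc: "continuous_on U s" unfolding s_def[abs_def] by (intro continuous_intros dc)
  have gc: "continuous_on U g"
    unfolding g_def[abs_def] by (rule continuous_on_compose2[OF gradient_cont gamma_cont]) simp
  define s' where "s' t = (g t \<bullet> d\<gamma> t) / (deriv A (s t) * s t)" for t
  have s': "(s has_real_derivative s' t) (at t)" if t: "t \<in> U" for t
    unfolding s'_def
  proof (rule DERIV_of_composition[OF G_deriv])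
    show "0 < s t" "deriv A (s t) * s t \<noteq> 0" using spos[OF t] deriv_A_pos[OF spos[OF t]] by auto
    have "((\<lambda>t. V (\<gamma> t) - c) has_derivative (\<lambda>h. gradient V (\<gamma> t) \<bullet> (h *\<^sub>R d\<gamma> t) - 0)) (at t)"
      using gamma_derivative(1)[of t] t unfolding U_def has_vector_derivative_def
      by (intro has_derivative_diff has_derivative_const has_derivative_compose[OF _ V_derivative]) auto
    moreover have "(\<lambda>h. gradient V (\<gamma> t) \<bullet> (h *\<^sub>R d\<gamma> t) - 0) = (*) (g t \<bullet> d\<gamma> t)"
      by (auto simp: g_def)
    ultimately show "((\<lambda>t. V (\<gamma> t) - c) has_real_derivative g t \<bullet> d\<gamma> t) (at t)"
      by (simp add: has_field_derivative_def)
    show "isCont s t" using sc t U by (simp add: continuous_on_eq_continuous_at)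
    have en: "G (s x) = V (\<gamma> x) - c" if "x \<in> U" for x using energy that by (simp add: s_def U_def)
    then show "G (s t) = V (\<gamma> t) - c" using t by blast
    show "\<forall>\<^sub>F x in at t. G (s x) = V (\<gamma> x) - c"
      by (rule eventually_mono[OF eventually_at_in_open'[OF U t] en])
  qed
  define D where "D t = inverse (\<phi> (s t)) *\<^sub>R g t
      + (- (inverse (\<phi> (s t)) * (f (s t) * s' t) * inverse (\<phi> (s t)))) *\<^sub>R momentum (d\<gamma> t)" for t
  have "(d\<gamma> has_vector_derivative D t) (at t)" if t: "t \<in> U" for t
  proof -
    have ne: "\<phi> (s t) \<noteq> 0" using phi_pos[OF spos[OF t]] by simp
    have "((\<lambda>t. \<phi> (s t)) has_real_derivative f (s t) * s' t) (at t)"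
      by (rule DERIV_chain2[OF f(1) s'[OF t]]) (rule spos[OF t])
    then have "((\<lambda>t. inverse (\<phi> (s t))) has_real_derivative
        - (inverse (\<phi> (s t)) * (f (s t) * s' t) * inverse (\<phi> (s t)))) (at t)"
      by (rule DERIV_inverse') (rule ne)
    moreover have "((\<lambda>t. momentum (d\<gamma> t)) has_vector_derivative g t) (at t)"
      unfolding g_def by (rule euler_lagrange) (use t in \<open>simp add: U_def\<close>)
    ultimately have "((\<lambda>t. inverse (\<phi> (s t)) *\<^sub>R momentum (d\<gamma> t)) has_vector_derivative D t) (at t)"
      unfolding D_def by (rule has_vector_derivative_scaleR)
    then show ?thesis
    proof (rule has_vector_derivative_transform_within_open[OF _ U t])
      show "inverse (\<phi> (s x)) *\<^sub>R momentum (d\<gamma> x) = d\<gamma> x" if "x \<in> U" for x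
        using phi_pos[OF spos[OF that]] by (simp add: momentum_def s_def)
    qed
  qed
  moreover have "continuous_on U D"
  proof -
    have "continuous_on U (\<lambda>t. \<phi> (s t))" "continuous_on U (\<lambda>t. f (s t))" "continuous_on U (\<lambda>t. deriv A (s t))"
      by (rule continuous_on_compose2[OF phi_cont sc] continuous_on_compose2[OF f(2) sc]
          continuous_on_compose2[OF deriv_A_cont sc], use spos in auto)+
    note cs = this
    have ne: "\<phi> (s t) \<noteq> 0" "deriv A (s t) * s t \<noteq> 0" if "t \<in> U" for t
      using spos[OF that] phi_pos[OF spos[OF that]] deriv_A_pos[OF spos[OF that]] by auto
    have "continuous_on U s'"
      unfolding s'_def[abs_def] by (intro continuous_intros gc dc cs sc) (use ne in auto)
    moreover have "continuous_on U (\<lambda>t. momentum (d\<gamma> t))"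
      by (rule continuous_on_compose2[OF momentum_cont dc]) simp
    ultimately show ?thesis
      unfolding D_def[abs_def] by (intro continuous_intros gc cs) (use ne in auto)
  qed
  ultimately show ?thesis by (intro that[of D]) (auto simp: U_def)
qed

end

section \<open>Behaviour at the ends\<close>

text \<open>Barbalat's lemma. A late value \<open>f t \<ge> e\<close> would keep \<open>f\<close>
  above \<open>e / 2\<close> on the whole grid cell containing \<open>t\<close>, contradicting the
  Cauchy property of the increasing, bounded integrals.\<close>

lemma integrable_nonneg_tendsto_0:
  fixes f :: "real \<Rightarrow> real"
  assumes f: "continuous_on UNIV f" "\<And>t. 0 \<le> f t"
    and uc: "\<And>e. 0 < e \<Longrightarrow> \<exists>d>0. \<forall>s t. \<bar>s - t\<bar> < d \<longrightarrow> \<bar>f s - f t\<bar> < e"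
    and M: "\<And>T. 0 \<le> T \<Longrightarrow> integral {0..T} f \<le> M"
  shows "(f \<longlongrightarrow> 0) at_top"
proof -
  have fi: "f integrable_on {s..t}" for s t
    by (intro integrable_continuous_interval continuous_on_subset[OF f(1)]) simp
  have "\<forall>\<^sub>F t in at_top. \<bar>f t\<bar> < e" if e: "0 < e" for e
  proof -
    obtain d where d: "0 < d" "\<And>s t. \<bar>s - t\<bar> < d \<Longrightarrow> \<bar>f s - f t\<bar> < e / 2"
      using uc[of "e / 2"] e by auto
    \<comment> \<open>Every point of a cell of this length containing \<open>t\<close> is closer
      than \<open>d\<close> to \<open>t\<close>.\<close>
    define h where "h = d / 4"
    have h: "0 < h" using d by (simp add: h_def)
    define F where "F n = integral {0..real n * h} f" for n
    have F_Suc: "F (Suc n) = F n + integral {real n * h..real (Suc n) * h} f" for n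
      unfolding F_def using h
      by (intro Henstock_Kurzweil_Integration.integral_combine[symmetric] fi) (auto simp: algebra_simps)
    have "incseq F"
      by (rule incseq_SucI) (simp add: F_Suc integral_nonneg[OF fi] f)
    moreover have "F n \<le> M" for n unfolding F_def using h by (intro M) simp
    ultimately obtain F0 where "F \<longlonglongrightarrow> F0" using incseq_convergent[of F M] by blast
    then have "Cauchy F" by (rule LIMSEQ_imp_Cauchy)
    then obtain n0 where n0: "\<And>m n. m \<ge> n0 \<Longrightarrow> n \<ge> n0 \<Longrightarrow> norm (F m - F n) < h * (e / 2)"
      using CauchyD[of F "h * (e / 2)"] h e by auto
    have "\<bar>f t\<bar> < e" if t: "t \<ge> real n0 * h" for t
    proof (rule ccontr)
      assume "\<not> \<bar>f t\<bar> < e"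
      then have ft: "e \<le> f t" using f(2)[of t] by simp
      define n where "n = nat \<lfloor>t / h\<rfloor>"
      have t0: "0 \<le> t" using t h by (meson mult_nonneg_nonneg of_nat_0_le_iff order_less_imp_le order_trans)
      have n: "real n \<le> t / h" "t / h < real n + 1"
        using t0 h unfolding n_def by (auto simp: floor_less_iff)
      have n': "real n * h \<le> t" "t < real (Suc n) * h" using n h by (auto simp: field_simps)
      have "real n0 \<le> t / h" using t h by (simp add: field_simps)
      then have "n \<ge> n0" using n(2) by linarith
      have "h * (e / 2) = integral {real n * h..real (Suc n) * h} (\<lambda>_. e / 2)"
        using h by (simp add: algebra_simps)
      also have "\<dots> \<le> integral {real n * h..real (Suc n) * h} f"
      proof (rule integral_le[OF _ fi])
        fix s assume s: "s \<in> {real n * h..real (Suc n) * h}"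
        have "real (Suc n) * h = real n * h + h" by (simp add: algebra_simps)
        then have "\<bar>s - t\<bar> < d" using s n' d(1) unfolding h_def by auto
        then show "e / 2 \<le> f s" using d(2)[of s t] ft by linarith
      qed (rule integrable_const_ivl)
      also have "\<dots> = F (Suc n) - F n" by (simp add: F_Suc)
      also have "\<dots> < h * (e / 2)"
      proof -
        have "norm (F (Suc n) - F n) < h * (e / 2)" by (rule n0) (use \<open>n \<ge> n0\<close> in auto)
        then show ?thesis unfolding real_norm_def by linarith
      qed
      finally show False by simp
    qed
    then show ?thesis unfolding eventually_at_top_linorder by blast
  qed
  then show ?thesis by (intro tendstoI) (simp add: dist_real_def)
qed

context connection_problem
begin

text \<open>Points of the ball at distance at least \<open>e\<close> from both sets form a compact
  set on which \<open>V > c\<close>, so \<open>V\<close> exceeds \<open>c\<close> there by a fixed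
  amount.\<close>

lemma sublevel_compactness:
  assumes "0 < e"
  obtains \<theta> where "0 < \<theta>" "\<And>x. norm x \<le> B \<Longrightarrow> V x < c + \<theta> \<Longrightarrow> infdist x Vm < e \<or> infdist x Vp < e"
proof -
  define K where "K = cball 0 B \<inter> ({x. e \<le> infdist x Vm} \<inter> {x. e \<le> infdist x Vp})"
  have "compact K" unfolding K_def
    by (intro compact_Int_closed compact_cball closed_Int closed_Collect_le continuous_intros)
  show ?thesis
  proof (cases "K = {}")
    case True
    show ?thesis
    proof (rule that[of 1])
      fix x :: 'a assume "norm x \<le> B"
      then have "x \<notin> K" "x \<in> cball 0 B" using True by auto
      then show "infdist x Vm < e \<or> infdist x Vp < e" by (auto simp: K_def)
    qed simp
  next
    case False
    obtain x0 where x0: "x0 \<in> K" "\<And>x. x \<in> K \<Longrightarrow> V x0 \<le> V x"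
      using continuous_attains_inf[OF \<open>compact K\<close> False V_cont] by blast
    have "x0 \<notin> Vm" "x0 \<notin> Vp" using x0(1) assms by (auto simp: K_def)
    then have "c < V x0" using sublevel by (metis Un_iff mem_Collect_eq not_le)
    show ?thesis
    proof (rule that[of "V x0 - c"])
      fix x assume "norm x \<le> B" "V x < c + (V x0 - c)"
      then have "x \<notin> K" "x \<in> cball 0 B" using x0(2)[of x] by auto
      then show "infdist x Vm < e \<or> infdist x Vp < e" by (auto simp: K_def)
    qed (use \<open>c < V x0\<close> in simp)
  qed
qed

end

context limit_curve
begin

lemma gamma_0_above: "c < V (\<gamma> 0)"
proof -
  have "(\<lambda>n. infdist (q n 0) Vm) \<longlonglongrightarrow> infdist (\<gamma> 0) Vm" by (intro tendsto_intros conv)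
  then have "infdist (\<gamma> 0) Vm = \<delta> / 2"
    using middle LIMSEQ_unique[OF _ tendsto_const] by (simp add: LIMSEQ_const_iff)
  then have "\<gamma> 0 \<notin> Vm" "\<gamma> 0 \<notin> Vp" using delta_pos delta_le_infdist_Vm[of "\<gamma> 0"] by auto
  then show ?thesis using sublevel by (metis Un_iff mem_Collect_eq not_le)
qed

lemma V_integral_bound:
  assumes "s \<le> t" shows "integral {s..t} (\<lambda>r. V (\<gamma> r) - c) \<le> enn2real m\<^sub>c + 1"
proof (rule LIMSEQ_le_const2[OF V_integral_tendsto], intro exI allI impI)
  fix n
  have "integral {s..t} (\<lambda>r. V (q n r) - c) \<le> integral {s..t} (lagr (q n) (p n))"
    by (intro integral_le near_min_basic(3)[OF nm] integrable_continuous_interval continuous_intros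
        continuous_on_compose2[OF V_cont[of UNIV] q_cont]) (auto simp: lagr_def)
  then show "integral {s..t} (\<lambda>r. V (q n r) - c) \<le> enn2real m\<^sub>c + 1"
    using near_min_total[OF nm[of n], of s t] eps(2)[of n] by linarith
qed

lemma V_gamma_uniformly_continuous:
  assumes "0 < e" shows "\<exists>d>0. \<forall>s t. \<bar>s - t\<bar> < d \<longrightarrow> \<bar>(V (\<gamma> s) - c) - (V (\<gamma> t) - c)\<bar> < e"
proof -
  obtain L where L: "0 < L" "\<And>x y. norm x \<le> R \<Longrightarrow> norm y \<le> R \<Longrightarrow> \<bar>V x - V y\<bar> \<le> L * norm (x - y)"
    using V_Lipschitz[of R] by blast
  have "0 < e / L" using assms L by simp
  then obtain d where d: "0 < d" "\<And>s t. \<bar>s - t\<bar> < d \<Longrightarrow> norm (\<gamma> t - \<gamma> s) < e / L"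
    using gamma_uniformly_continuous by blast
  have "\<bar>(V (\<gamma> s) - c) - (V (\<gamma> t) - c)\<bar> < e" if "\<bar>s - t\<bar> < d" for s t
  proof -
    have "\<bar>V (\<gamma> t) - V (\<gamma> s)\<bar> \<le> L * norm (\<gamma> t - \<gamma> s)" by (rule L(2)) (rule gamma_bound)+
    also have "\<dots> < e" using d(2)[OF that] L(1) by (simp add: field_simps)
    finally show ?thesis by simp
  qed
  then show ?thesis using d(1) by blast
qed

lemma V_gamma_at_top: "((\<lambda>t. V (\<gamma> t) - c) \<longlongrightarrow> 0) at_top"
  by (rule integrable_nonneg_tendsto_0[OF _ _ V_gamma_uniformly_continuous V_integral_bound])
     (auto intro!: continuous_intros V_gamma_cont simp: gamma_above)

lemma V_gamma_at_bot: "((\<lambda>t. V (\<gamma> t) - c) \<longlongrightarrow> 0) at_bot"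
proof -
  have "((\<lambda>t. V (\<gamma> (- t)) - c) \<longlongrightarrow> 0) at_top"
  proof (rule integrable_nonneg_tendsto_0)
    show "continuous_on UNIV (\<lambda>t. V (\<gamma> (- t)) - c)"
      by (intro continuous_intros continuous_on_compose2[OF V_gamma_cont[of UNIV]]) auto
    show "0 \<le> V (\<gamma> (- t)) - c" for t using gamma_above by simp
    show "\<exists>d>0. \<forall>s t. \<bar>s - t\<bar> < d \<longrightarrow> \<bar>V (\<gamma> (- s)) - c - (V (\<gamma> (- t)) - c)\<bar> < e" if e: "0 < e" for e
    proof -
      obtain d where "0 < d" "\<And>s t. \<bar>s - t\<bar> < d \<Longrightarrow> \<bar>(V (\<gamma> s) - c) - (V (\<gamma> t) - c)\<bar> < e"
        using V_gamma_uniformly_continuous[OF e] by blast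
      then show ?thesis by (intro exI[of _ d]) (auto simp: abs_minus_commute)
    qed
    show "integral {0..T} (\<lambda>t. V (\<gamma> (- t)) - c) \<le> enn2real m\<^sub>c + 1" if "0 \<le> T" for T
      using V_integral_bound[of "- T" 0] Henstock_Kurzweil_Integration.integral_reflect_real[where a = "- T" and b = 0 and f = "\<lambda>t. V (\<gamma> t) - c"] that by simp
  qed
  then show ?thesis by (simp add: filterlim_at_bot_mirror)
qed

text \<open>A near-minimizer that visits a neighbourhood of \<open>V\<^sub>p\<close> before time \<open>0\<close> could be stopped
  there, saving the action spent around time \<open>0\<close>; likewise for \<open>V\<^sub>m\<close> and the future.\<close>

lemma separated_ends:
  obtains e0 where "0 < e0" "\<And>t. t < 0 \<Longrightarrow> e0 \<le> infdist (\<gamma> t) Vp" "\<And>t. 0 < t \<Longrightarrow> e0 \<le> infdist (\<gamma> t) Vm"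
proof -
  obtain d where d: "0 < d" "\<And>s. s \<in> {0 - d..0 + d} \<Longrightarrow> c < V (\<gamma> s)"
    using above_nhd[OF gamma_0_above] by blast
  obtain t0 where t0: "t0 \<in> {- d..d}" "\<And>t. t \<in> {- d..d} \<Longrightarrow> V (\<gamma> t0) \<le> V (\<gamma> t)"
    using continuous_attains_inf[OF compact_Icc _ V_gamma_cont, of "- d" d] d(1) by auto
  define \<eta> where "\<eta> = V (\<gamma> t0) - c"
  have \<eta>: "0 < \<eta>" "\<And>t. t \<in> {- d..d} \<Longrightarrow> \<eta> \<le> V (\<gamma> t) - c" using d(2)[of t0] t0 by (auto simp: \<eta>_def)
  obtain M where M: "0 < M" "\<And>x. norm x \<le> R + 1 \<Longrightarrow> \<bar>V x - c\<bar> \<le> M" using V_bounded by blast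
  define C where "C = \<Phi> 1 + M"
  have C: "0 < C" using M Phi_nonneg[of 1] unfolding C_def by linarith
  \<comment> \<open>The bound \<open>\<delta>\<close> is required by the tail estimates, and 1 keeps
    balls around \<open>q n t\<close> inside the radius \<open>R + 1\<close> where \<open>M\<close>
    is valid. The last term makes the cost \<open>e0 * C\<close> of stopping early smaller than
    \<open>d * \<eta>\<close>, a lower bound for the potential part of the limit action on either
    side of 0.\<close>
  define e0 where "e0 = min (min \<delta> 1) (d * \<eta> / (2 * C))"
  have e0: "0 < e0" "e0 \<le> \<delta>" "e0 \<le> 1" "e0 * C < d * \<eta>"
  proof -
    show "0 < e0" using delta_pos d \<eta> C by (simp add: e0_def)
    show "e0 \<le> \<delta>" "e0 \<le> 1" by (auto simp: e0_def)
    have "e0 * C \<le> d * \<eta> / (2 * C) * C" using C by (intro mult_right_mono) (auto simp: e0_def)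
    also have "\<dots> = d * \<eta> / 2" using C by simp
    also have "\<dots> < d * \<eta>" using d \<eta> by simp
    finally show "e0 * C < d * \<eta>" .
  qed
  have B: "V z - c \<le> M" if "z \<in> ball (q n t) e0" for z n t
  proof -
    have "norm z \<le> norm (q n t) + norm (z - q n t)" using norm_triangle_sub[of z "q n t"] .
    then have "norm z \<le> R + 1" using q_bound[of n t] that e0(3) by (simp add: dist_norm norm_minus_commute)
    then show ?thesis using M(2)[of z] by simp
  qed
  have lower: "integral {u..v} (\<lambda>r. V (q n r) - c) \<le> integral {s..t} (lagr (q n) (p n))"
    if "s \<le> u" "v \<le> t" for s u v t n
  proof -
    have "integral {u..v} (\<lambda>r. V (q n r) - c) \<le> integral {u..v} (lagr (q n) (p n))"
      by (intro integral_le near_min_basic(3)[OF nm] integrable_continuous_interval continuous_intros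
          continuous_on_compose2[OF V_cont[of UNIV] q_cont]) (auto simp: lagr_def)
    also have "\<dots> \<le> integral {s..t} (lagr (q n) (p n))"
      by (rule integral_subset_le) (use that near_min_basic[OF nm] lagr_nonneg in auto)
    finally show ?thesis .
  qed
  have contra: False
    if ev: "\<forall>\<^sub>F n in sequentially. integral {u..v} (\<lambda>r. V (q n r) - c) \<le> e0 * C + \<epsilon> n"
      and uv: "v - u = d" "- d \<le> u" "v \<le> d" for u v
  proof -
    have "integral {u..v} (\<lambda>r. V (\<gamma> r) - c) \<le> e0 * C + 0"
      by (rule tendsto_le[OF sequentially_bot _ V_integral_tendsto ev]) (intro tendsto_intros eps)
    moreover have "integral {u..v} (\<lambda>_. \<eta>) \<le> integral {u..v} (\<lambda>r. V (\<gamma> r) - c)"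
      by (intro integral_le integrable_continuous_interval continuous_intros V_gamma_cont) (use \<eta>(2) uv in auto)
    moreover have "integral {u..v} (\<lambda>_. \<eta>) = d * \<eta>" using uv d(1) by simp
    ultimately show False using e0(4) by simp
  qed
  show ?thesis
  proof (rule that[OF e0(1)])
    fix t :: real assume t: "t < 0"
    show "e0 \<le> infdist (\<gamma> t) Vp"
    proof (rule ccontr)
      assume "\<not> e0 \<le> infdist (\<gamma> t) Vp"
      moreover have "(\<lambda>n. infdist (q n t) Vp) \<longlonglongrightarrow> infdist (\<gamma> t) Vp" by (intro tendsto_intros conv)
      ultimately have "\<forall>\<^sub>F n in sequentially. infdist (q n t) Vp < e0"
        by (intro order_tendstoD(2)) (auto simp: not_le)
      then have "\<forall>\<^sub>F n in sequentially. integral {0..d} (\<lambda>r. V (q n r) - c) \<le> e0 * C + \<epsilon> n"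
      proof eventually_elim
        case (elim n)
        have "integral {t..d} (lagr (q n) (p n)) \<le> e0 * (\<Phi> 1 + M) + \<epsilon> n"
          by (rule near_min_right_tail[OF nm _ e0(1,2) B elim]) (use t d(1) in auto)
        then show ?case using lower[of t 0 d d n] t by (simp add: C_def)
      qed
      then show False by (rule contra) (use d(1) in auto)
    qed
  next
    fix t :: real assume t: "0 < t"
    show "e0 \<le> infdist (\<gamma> t) Vm"
    proof (rule ccontr)
      assume "\<not> e0 \<le> infdist (\<gamma> t) Vm"
      moreover have "(\<lambda>n. infdist (q n t) Vm) \<longlonglongrightarrow> infdist (\<gamma> t) Vm" by (intro tendsto_intros conv)
      ultimately have "\<forall>\<^sub>F n in sequentially. infdist (q n t) Vm < e0"
        by (intro order_tendstoD(2)) (auto simp: not_le)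
      then have "\<forall>\<^sub>F n in sequentially. integral {- d..0} (\<lambda>r. V (q n r) - c) \<le> e0 * C + \<epsilon> n"
      proof eventually_elim
        case (elim n)
        have "integral {- d..t} (lagr (q n) (p n)) \<le> e0 * (\<Phi> 1 + M) + \<epsilon> n"
          by (rule near_min_left_tail[OF nm _ e0(1,2) B elim]) (use t d(1) in auto)
        then show ?case using lower[of "- d" "- d" 0 t n] t by (simp add: C_def)
      qed
      then show False by (rule contra) (use d(1) in auto)
    qed
  qed
qed

lemma
  shows infdist_Vm_at_bot: "((\<lambda>t. infdist (\<gamma> t) Vm) \<longlongrightarrow> 0) at_bot"
    and infdist_Vp_at_top: "((\<lambda>t. infdist (\<gamma> t) Vp) \<longlongrightarrow> 0) at_top"
proof -
  obtain e0 where e0: "0 < e0" "\<And>t. t < 0 \<Longrightarrow> e0 \<le> infdist (\<gamma> t) Vp" "\<And>t. 0 < t \<Longrightarrow> e0 \<le> infdist (\<gamma> t) Vm"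
    using separated_ends by blast
  have *: "\<exists>\<theta>>0. \<forall>t. V (\<gamma> t) - c < \<theta> \<longrightarrow> (t < 0 \<longrightarrow> infdist (\<gamma> t) Vm < e) \<and> (0 < t \<longrightarrow> infdist (\<gamma> t) Vp < e)"
    if e: "0 < e" for e
  proof -
    \<comment> \<open>A tolerance of at most \<open>e0\<close> makes nearness to the wrong set
      contradict \<open>separated_ends\<close>.\<close>
    obtain \<theta> where \<theta>: "0 < \<theta>"
      "\<And>x. norm x \<le> R \<Longrightarrow> V x < c + \<theta> \<Longrightarrow> infdist x Vm < min e e0 \<or> infdist x Vp < min e e0"
      using sublevel_compactness[of "min e e0" R] e e0(1) by (metis min_less_iff_conj)
    show ?thesis
    proof (intro exI[of _ \<theta>] conjI allI impI \<theta>(1))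
      fix t assume "V (\<gamma> t) - c < \<theta>"
      then have or: "infdist (\<gamma> t) Vm < min e e0 \<or> infdist (\<gamma> t) Vp < min e e0"
        using \<theta>(2)[OF gamma_bound] by simp
      show "infdist (\<gamma> t) Vm < e" if "t < 0" using or e0(2)[OF that] by auto
      show "infdist (\<gamma> t) Vp < e" if "0 < t" using or e0(3)[OF that] by auto
    qed
  qed
  show "((\<lambda>t. infdist (\<gamma> t) Vm) \<longlongrightarrow> 0) at_bot"
  proof (rule tendstoI)
    fix e :: real assume "0 < e"
    from *[OF this] obtain \<theta> where \<theta>: "0 < \<theta>" "\<forall>t. V (\<gamma> t) - c < \<theta> \<longrightarrow>
        (t < 0 \<longrightarrow> infdist (\<gamma> t) Vm < e) \<and> (0 < t \<longrightarrow> infdist (\<gamma> t) Vp < e)"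
      by (elim exE conjE)
    have "\<forall>\<^sub>F t in at_bot. V (\<gamma> t) - c < \<theta>" by (rule order_tendstoD(2)[OF V_gamma_at_bot \<theta>(1)])
    then show "\<forall>\<^sub>F t in at_bot. dist (infdist (\<gamma> t) Vm) 0 < e"
      using eventually_gt_at_bot[of 0]
    proof eventually_elim
      case (elim t)
      then have "infdist (\<gamma> t) Vm < e" using \<theta>(2) by simp
      then show ?case by (simp add: dist_real_def infdist_nonneg)
    qed
  qed
  show "((\<lambda>t. infdist (\<gamma> t) Vp) \<longlongrightarrow> 0) at_top"
  proof (rule tendstoI)
    fix e :: real assume "0 < e"
    from *[OF this] obtain \<theta> where \<theta>: "0 < \<theta>" "\<forall>t. V (\<gamma> t) - c < \<theta> \<longrightarrow>
        (t < 0 \<longrightarrow> infdist (\<gamma> t) Vm < e) \<and> (0 < t \<longrightarrow> infdist (\<gamma> t) Vp < e)"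
      by (elim exE conjE)
    have "\<forall>\<^sub>F t in at_top. V (\<gamma> t) - c < \<theta>" by (rule order_tendstoD(2)[OF V_gamma_at_top \<theta>(1)])
    then show "\<forall>\<^sub>F t in at_top. dist (infdist (\<gamma> t) Vp) 0 < e"
      using eventually_gt_at_top[of 0]
    proof eventually_elim
      case (elim t)
      then have "infdist (\<gamma> t) Vp < e" using \<theta>(2) by simp
      then show ?case by (simp add: dist_real_def infdist_nonneg)
    qed
  qed
qed

text \<open>If there is no contact, the supremum and infimum of the empty set are the infinite
  contact times, so no case distinction is made here.\<close>

definition \<alpha> :: ereal where "\<alpha> = Sup (ereal ` {t. t \<le> 0 \<and> V (\<gamma> t) = c})"

definition \<omega> :: ereal where "\<omega> = Inf (ereal ` {t. 0 \<le> t \<and> V (\<gamma> t) = c})"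

lemma alpha_omega: "\<alpha> < 0" "0 < \<omega>" "\<alpha> < \<omega>"
proof -
  obtain d where d: "0 < d" "\<And>s. s \<in> {0 - d..0 + d} \<Longrightarrow> c < V (\<gamma> s)"
    using above_nhd[OF gamma_0_above] by blast
  have "\<alpha> \<le> ereal (- d)"
    unfolding \<alpha>_def
  proof (rule Sup_least)
    fix x assume "x \<in> ereal ` {t. t \<le> 0 \<and> V (\<gamma> t) = c}"
    then obtain t where t: "x = ereal t" "t \<le> 0" "V (\<gamma> t) = c" by auto
    then have "t \<le> - d" using d(2)[of t] d(1) by force
    then show "x \<le> ereal (- d)" using t by simp
  qed
  also have "ereal (- d) < 0" using d(1) by simp
  finally show 1: "\<alpha> < 0" .
  have "0 < ereal d" using d(1) by simp
  also have "ereal d \<le> \<omega>"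
    unfolding \<omega>_def
  proof (rule Inf_greatest)
    fix x assume "x \<in> ereal ` {t. 0 \<le> t \<and> V (\<gamma> t) = c}"
    then obtain t where t: "x = ereal t" "0 \<le> t" "V (\<gamma> t) = c" by auto
    then have "d \<le> t" using d(2)[of t] d(1) by force
    then show "ereal d \<le> x" using t by simp
  qed
  finally show 2: "0 < \<omega>" .
  show "\<alpha> < \<omega>" using 1 2 by (rule less_trans)
qed

lemma above_on_I: "t \<in> einterval \<alpha> \<omega> \<Longrightarrow> c < V (\<gamma> t)"
proof -
  assume t: "t \<in> einterval \<alpha> \<omega>"
  have "V (\<gamma> t) \<noteq> c"
  proof
    assume "V (\<gamma> t) = c"
    then have "t \<le> 0 \<Longrightarrow> ereal t \<le> \<alpha>" "0 \<le> t \<Longrightarrow> \<omega> \<le> ereal t"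
      unfolding \<alpha>_def \<omega>_def by (auto intro: Sup_upper Inf_lower)
    then show False using t by (cases "t \<le> 0") (auto simp: einterval_iff)
  qed
  then show ?thesis using gamma_above[of t] by simp
qed

lemma at_alpha:
  assumes "\<alpha> = ereal a" shows "V (\<gamma> a) = c"
proof (rule ccontr)
  assume "V (\<gamma> a) \<noteq> c"
  then have "c < V (\<gamma> a)" using gamma_above[of a] by simp
  then obtain d where d: "0 < d" "\<And>s. s \<in> {a - d..a + d} \<Longrightarrow> c < V (\<gamma> s)" using above_nhd by blast
  have "\<alpha> \<le> ereal (a - d)"
    unfolding \<alpha>_def
  proof (rule Sup_least)
    fix x assume x: "x \<in> ereal ` {t. t \<le> 0 \<and> V (\<gamma> t) = c}"
    then obtain t where t: "x = ereal t" "t \<le> 0" "V (\<gamma> t) = c" by auto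
    have "x \<le> \<alpha>" unfolding \<alpha>_def using x by (rule Sup_upper)
    then have "t \<le> a" using t assms by simp
    then have "t \<le> a - d" using d(2)[of t] d(1) t(3) by force
    then show "x \<le> ereal (a - d)" using t by simp
  qed
  then show False using assms d(1) by simp
qed

lemma at_omega:
  assumes "\<omega> = ereal b" shows "V (\<gamma> b) = c"
proof (rule ccontr)
  assume "V (\<gamma> b) \<noteq> c"
  then have "c < V (\<gamma> b)" using gamma_above[of b] by simp
  then obtain d where d: "0 < d" "\<And>s. s \<in> {b - d..b + d} \<Longrightarrow> c < V (\<gamma> s)" using above_nhd by blast
  have "ereal (b + d) \<le> \<omega>"
    unfolding \<omega>_def
  proof (rule Inf_greatest)
    fix x assume x: "x \<in> ereal ` {t. 0 \<le> t \<and> V (\<gamma> t) = c}"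
    then obtain t where t: "x = ereal t" "0 \<le> t" "V (\<gamma> t) = c" by auto
    have "\<omega> \<le> x" unfolding \<omega>_def using x by (rule Inf_lower)
    then have "b \<le> t" using t assms by simp
    then have "b + d \<le> t" using d(2)[of t] d(1) t(3) by force
    then show "ereal (b + d) \<le> x" using t by simp
  qed
  then show False using assms d(1) by simp
qed

lemma gamma_alpha_in_Vm: "\<alpha> = ereal a \<Longrightarrow> \<gamma> a \<in> Vm"
proof -
  assume a: "\<alpha> = ereal a"
  then have "a < 0" using alpha_omega(1) by (simp add: zero_ereal_def)
  then have "\<gamma> a \<notin> Vp" using separated_ends by (metis infdist_zero not_le)
  then show ?thesis using at_alpha[OF a] sublevel by auto
qed

lemma gamma_omega_in_Vp: "\<omega> = ereal b \<Longrightarrow> \<gamma> b \<in> Vp"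
proof -
  assume b: "\<omega> = ereal b"
  then have "0 < b" using alpha_omega(2) by (simp add: zero_ereal_def)
  then have "\<gamma> b \<notin> Vm" using separated_ends by (metis infdist_zero not_le)
  then show ?thesis using at_omega[OF b] sublevel by auto
qed

section \<open>The minimal connection\<close>

lemma alpha_cases: obtains "\<alpha> = -\<infinity>" | a where "\<alpha> = ereal a" "a < 0"
  using alpha_omega(1) by (cases \<alpha>) (auto simp: zero_ereal_def)

lemma omega_cases: obtains "\<omega> = \<infinity>" | b where "\<omega> = ereal b" "0 < b"
  using alpha_omega(2) by (cases \<omega>) (auto simp: zero_ereal_def)

text \<open>Clamps time to the closure of the interval, so that the composed curve rests at its
  contact points. The infinite cases are separated because \<open>real_of_ereal\<close> maps both
  infinities to 0.\<close>

definition proj :: "real \<Rightarrow> real" where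
  "proj t = (let u = (if \<omega> = \<infinity> then t else min (real_of_ereal \<omega>) t)
     in if \<alpha> = -\<infinity> then u else max (real_of_ereal \<alpha>) u)"

lemma proj_cont: "continuous_on S proj"
  unfolding proj_def[abs_def] Let_def
  by (cases "\<alpha> = -\<infinity>"; cases "\<omega> = \<infinity>") (auto intro!: continuous_intros)

lemma proj_I: "t \<in> einterval \<alpha> \<omega> \<Longrightarrow> proj t = t"
  by (cases rule: alpha_cases; cases rule: omega_cases) (auto simp: proj_def einterval_iff)

lemma proj_le_alpha: "ereal t \<le> \<alpha> \<Longrightarrow> ereal (proj t) = \<alpha>"
  by (cases rule: alpha_cases; cases rule: omega_cases) (auto simp: proj_def)

lemma proj_ge_omega: "\<omega> \<le> ereal t \<Longrightarrow> ereal (proj t) = \<omega>"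
  by (cases rule: alpha_cases; cases rule: omega_cases) (auto simp: proj_def)

definition ext :: "real \<Rightarrow> 'a" where "ext t = \<gamma> (proj t)"

definition dext :: "real \<Rightarrow> 'a" where "dext t = (if t \<in> einterval \<alpha> \<omega> then d\<gamma> t else 0)"

lemma ext_I: "t \<in> einterval \<alpha> \<omega> \<Longrightarrow> ext t = \<gamma> t"
  by (simp add: ext_def proj_I)

lemma ext_cont: "continuous_on S ext"
  unfolding ext_def[abs_def] by (rule continuous_on_compose2[OF gamma_cont[of UNIV] proj_cont]) simp

lemma ext_le_alpha: "ereal t \<le> \<alpha> \<Longrightarrow> ext t \<in> Vm \<and> V (ext t) = c"
  unfolding ext_def using gamma_alpha_in_Vm[of "proj t"] at_alpha[of "proj t"] proj_le_alpha by auto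

lemma ext_ge_omega: "\<omega> \<le> ereal t \<Longrightarrow> ext t \<in> Vp \<and> V (ext t) = c"
  unfolding ext_def using gamma_omega_in_Vp[of "proj t"] at_omega[of "proj t"] proj_ge_omega by auto

lemma ext_not_I: "t \<notin> einterval \<alpha> \<omega> \<Longrightarrow> V (ext t) = c"
  using ext_le_alpha[of t] ext_ge_omega[of t] by (auto simp: einterval_iff not_less)

text \<open>Off the interval both sides are zero. As the identity now holds at all times, continuity
  of \<open>V\<close> along the curve transfers to the velocity, also at finite contact
  times.\<close>

lemma ext_energy: "G (norm (dext t)) = V (ext t) - c"
  using energy[OF above_on_I] ext_not_I by (cases "t \<in> einterval \<alpha> \<omega>") (auto simp: dext_def ext_I)

lemma dext_cont: "continuous_on S dext"
proof (intro continuous_at_imp_continuous_on ballI)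
  fix t
  show "isCont dext t"
  proof (cases "t \<in> einterval \<alpha> \<omega>")
    case True
    have "continuous_on (einterval \<alpha> \<omega>) d\<gamma>" by (rule d\<gamma>_cont[OF above_on_I])
    then have "continuous_on (einterval \<alpha> \<omega>) dext"
      by (rule continuous_on_eq) (simp add: dext_def)
    then show ?thesis using True by (simp add: continuous_on_eq_continuous_at)
  next
    case False
    have "(dext \<longlongrightarrow> 0) (at t)"
    proof (rule tendstoI)
      fix e :: real assume e: "0 < e"
      have "((\<lambda>s. V (ext s) - c) \<longlongrightarrow> V (ext t) - c) (at t)"
        using continuous_on_compose2[OF V_cont[of UNIV] ext_cont[of UNIV]]
        by (intro tendsto_intros) (auto simp: continuous_on_def)
      then have "\<forall>\<^sub>F s in at t. V (ext s) - c < G e"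
        using G_pos[OF e] ext_not_I[OF False] by (intro order_tendstoD(2)) auto
      then show "\<forall>\<^sub>F s in at t. dist (dext s) 0 < e"
      proof eventually_elim
        case (elim s)
        then have "G (norm (dext s)) < G e" by (simp add: ext_energy)
        then show ?case using G_less_iff[of "norm (dext s)" e] e by simp
      qed
    qed
    then show ?thesis using False by (simp add: isCont_def dext_def)
  qed
qed

lemma ext_derivative: "(ext has_vector_derivative dext t) (at t)"
proof -
  \<comment> \<open>For an infinite contact time \<open>real_of_ereal\<close> gives 0; excluding
    this extra point is harmless, since the fundamental theorem used below tolerates finitely many
    exceptions.\<close>
  have away: "(ext has_vector_derivative dext s) (at s)"
    if s: "s \<notin> {real_of_ereal \<alpha>, real_of_ereal \<omega>}" for s
  proof -
    have const: ?thesis if "open U" "s \<in> U" "\<And>u. u \<in> U \<Longrightarrow> ext u = x" "s \<notin> einterval \<alpha> \<omega>" for U x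
    proof -
      have "((\<lambda>_. x) has_vector_derivative 0) (at s)" by simp
      then have "(ext has_vector_derivative 0) (at s)"
        by (rule has_vector_derivative_transform_within_open[OF _ that(1,2)]) (simp add: that(3))
      then show ?thesis using that(4) by (simp add: dext_def)
    qed
    consider "s \<in> einterval \<alpha> \<omega>" | "ereal s \<le> \<alpha>" | "\<omega> \<le> ereal s"
      unfolding einterval_iff using not_le by blast
    then show ?thesis
    proof cases
      case 1
      have "(ext has_vector_derivative d\<gamma> s) (at s)"
        by (rule has_vector_derivative_transform_within_open[OF gamma_derivative(1)[OF above_on_I[OF 1]] _ 1])
           (auto simp: ext_I)
      then show ?thesis using 1 by (simp add: dext_def)
    next
      case 2
      then obtain a where a: "\<alpha> = ereal a" by (cases rule: alpha_cases) auto
      show ?thesis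
      proof (rule const[of "{..<a}" "\<gamma> a"])
        show "s \<in> {..<a}" using 2 s a by simp
        show "ext u = \<gamma> a" if "u \<in> {..<a}" for u
          using proj_le_alpha[of u] that a by (simp add: ext_def)
      qed (use 2 in \<open>auto simp: einterval_iff not_less\<close>)
    next
      case 3
      then obtain b where b: "\<omega> = ereal b" by (cases rule: omega_cases) auto
      show ?thesis
      proof (rule const[of "{b<..}" "\<gamma> b"])
        show "s \<in> {b<..}" using 3 s b by simp
        show "ext u = \<gamma> b" if "u \<in> {b<..}" for u
          using proj_ge_omega[of u] that b by (simp add: ext_def)
      qed (use 3 in \<open>auto simp: einterval_iff not_less\<close>)
    qed
  qed
  \<comment> \<open>Integrating across the excluded times and differentiating again, with
    \<open>dext\<close> continuous, recovers the derivative at those times.\<close>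
  have int: "ext u = ext (t - 1) + integral {t - 1..u} dext" if "t - 1 \<le> u" for u
    using fundamental_theorem_of_calculus_strong[of "{real_of_ereal \<alpha>, real_of_ereal \<omega>}" "t - 1" u ext dext]
      away ext_cont that by (simp add: integral_unique)
  have "((\<lambda>u. ext (t - 1) + integral {t - 1..u} dext) has_vector_derivative 0 + dext t) (at t within {t - 1..t + 1})"
    by (intro has_vector_derivative_add has_vector_derivative_const integral_has_vector_derivative dext_cont) auto
  then have "((\<lambda>u. ext (t - 1) + integral {t - 1..u} dext) has_vector_derivative dext t) (at t)"
    using at_within_interior[of t "{t - 1..t + 1}"] by simp
  then show ?thesis
    by (rule has_vector_derivative_transform_within_open[where S = "{t - 1<..<t + 1}"])
       (auto intro!: int[symmetric])
qed

lemma prim_ext: "prim S ext dext"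
  by (rule prim_of_C1[OF has_vector_derivative_at_within[OF ext_derivative] dext_cont])

lemma ext_tendsto_Vm: "(((\<lambda>t. infdist (ext t) Vm) \<circ> real_of_ereal) \<longlongrightarrow> 0) (at_right \<alpha>)"
proof (cases rule: alpha_cases)
  case 1
  have "((\<lambda>t. infdist (ext t) Vm) \<longlongrightarrow> 0) at_bot"
  proof (rule Lim_transform_eventually[OF infdist_Vm_at_bot])
    have "0 \<in> einterval \<alpha> \<omega>" using alpha_omega by (simp add: einterval_iff zero_ereal_def)
    then have "infdist (\<gamma> t) Vm = infdist (ext t) Vm" if "t < 0" for t
      using that 1 unfolding einterval_iff by (intro arg_cong[where f = "\<lambda>x. infdist x Vm"] ext_I[symmetric])
        (auto simp: einterval_iff intro: less_trans[of "ereal t" "ereal 0"])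
    then show "\<forall>\<^sub>F t in at_bot. infdist (\<gamma> t) Vm = infdist (ext t) Vm"
      by (rule eventually_mono[OF eventually_gt_at_bot[of 0]])
  qed
  then show ?thesis by (simp add: 1 ereal_tendsto_simps)
next
  case (2 a)
  have "ext a \<in> Vm" using ext_le_alpha[of a] 2 by simp
  moreover have "((\<lambda>t. infdist (ext t) Vm) \<longlongrightarrow> infdist (ext a) Vm) (at a)"
    using ext_cont[of UNIV] by (intro tendsto_intros) (auto simp: continuous_on_def)
  ultimately have "((\<lambda>t. infdist (ext t) Vm) \<longlongrightarrow> 0) (at_right a)"
    by (auto intro: tendsto_within_subset)
  then show ?thesis by (simp add: 2 ereal_tendsto_simps)
qed

lemma ext_tendsto_Vp: "(((\<lambda>t. infdist (ext t) Vp) \<circ> real_of_ereal) \<longlongrightarrow> 0) (at_left \<omega>)"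
proof (cases rule: omega_cases)
  case 1
  have "((\<lambda>t. infdist (ext t) Vp) \<longlongrightarrow> 0) at_top"
  proof (rule Lim_transform_eventually[OF infdist_Vp_at_top])
    have "0 \<in> einterval \<alpha> \<omega>" using alpha_omega by (simp add: einterval_iff zero_ereal_def)
    then have "infdist (\<gamma> t) Vp = infdist (ext t) Vp" if "0 < t" for t
      using that 1 unfolding einterval_iff by (intro arg_cong[where f = "\<lambda>x. infdist x Vp"] ext_I[symmetric])
        (auto simp: einterval_iff intro: less_trans[of _ "ereal 0" "ereal t"])
    then show "\<forall>\<^sub>F t in at_top. infdist (\<gamma> t) Vp = infdist (ext t) Vp"
      by (rule eventually_mono[OF eventually_gt_at_top[of 0]])
  qed
  then show ?thesis by (simp add: 1 ereal_tendsto_simps)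
next
  case (2 b)
  have "ext b \<in> Vp" using ext_ge_omega[of b] 2 by simp
  moreover have "((\<lambda>t. infdist (ext t) Vp) \<longlongrightarrow> infdist (ext b) Vp) (at b)"
    using ext_cont[of UNIV] by (intro tendsto_intros) (auto simp: continuous_on_def)
  ultimately have "((\<lambda>t. infdist (ext t) Vp) \<longlongrightarrow> 0) (at_left b)"
    by (auto intro: tendsto_within_subset)
  then show ?thesis by (simp add: 2 ereal_tendsto_simps)
qed

lemma starts_ext: "starts ext"
  unfolding starts_def
proof (intro allI impI)
  fix e T :: real assume e: "0 < e"
  show "\<exists>t\<le>T. infdist (ext t) Vm < e"
  proof (cases rule: alpha_cases)
    case 1
    have "((\<lambda>t. infdist (ext t) Vm) \<longlongrightarrow> 0) at_bot"
      using ext_tendsto_Vm by (simp add: 1 ereal_tendsto_simps)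
    then have "\<forall>\<^sub>F t in at_bot. infdist (ext t) Vm < e" using e by (rule order_tendstoD(2))
    then obtain N where "\<And>t. t \<le> N \<Longrightarrow> infdist (ext t) Vm < e"
      unfolding eventually_at_bot_linorder by blast
    then show ?thesis by (intro exI[of _ "min N T"]) simp
  next
    case (2 a)
    then show ?thesis using ext_le_alpha[of "min a T"] e by (intro exI[of _ "min a T"]) simp
  qed
qed

lemma ends_ext: "ends ext"
  unfolding ends_def
proof (intro allI impI)
  fix e T :: real assume e: "0 < e"
  show "\<exists>t\<ge>T. infdist (ext t) Vp < e"
  proof (cases rule: omega_cases)
    case 1
    have "((\<lambda>t. infdist (ext t) Vp) \<longlongrightarrow> 0) at_top"
      using ext_tendsto_Vp by (simp add: 1 ereal_tendsto_simps)
    then have "\<forall>\<^sub>F t in at_top. infdist (ext t) Vp < e" using e by (rule order_tendstoD(2))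
    then obtain N where "\<And>t. N \<le> t \<Longrightarrow> infdist (ext t) Vp < e"
      unfolding eventually_at_top_linorder by blast
    then show ?thesis by (intro exI[of _ "max N T"]) simp
  next
    case (2 b)
    then show ?thesis using ext_ge_omega[of "max b T"] e by (intro exI[of _ "max b T"]) simp
  qed
qed

text \<open>The resting curve is itself a competitor, and the Lagrangian vanishes where it rests;
  this gives one inequality. For the other, lower semicontinuity bounds the action on compact
  subintervals, and monotone convergence exhausts the interval.\<close>

lemma act_ext: "act (einterval \<alpha> \<omega>) ext dext = m\<^sub>c"
proof (rule antisym)
  have "m\<^sub>c \<le> act UNIV ext dext"
  proof (rule m_le_act[OF _ starts_ext ends_ext])
    have "c \<le> V (ext t)" for t unfolding ext_def by (rule gamma_above)
    then show "curve ext dext" by (simp add: curve_def prim_ext)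
  qed
  also have "act UNIV ext dext = act (einterval \<alpha> \<omega>) ext dext"
    unfolding act_def
  proof (rule nn_integral_cong)
    fix t
    show "ennreal (lagr ext dext t) * indicator UNIV t = ennreal (lagr ext dext t) * indicator (einterval \<alpha> \<omega>) t"
      using ext_not_I[of t] by (cases "t \<in> einterval \<alpha> \<omega>") (auto simp: lagr_def dext_def)
  qed
  finally show "m\<^sub>c \<le> act (einterval \<alpha> \<omega>) ext dext" .
next
  obtain u l :: "nat \<Rightarrow> real" where ul: "einterval \<alpha> \<omega> = (\<Union>i. {l i..u i})" "incseq u" "decseq l"
    "\<And>i. l i < u i"
    by (rule einterval_Icc_approximation[OF alpha_omega(3)]) blast
  define f where "f i t = ennreal (lagr ext dext t) * indicator {l i..u i} t" for i t
  have sup: "(SUP i. f i t) = ennreal (lagr ext dext t) * indicator (einterval \<alpha> \<omega>) t" for t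
  proof (cases "t \<in> einterval \<alpha> \<omega>")
    case True
    then obtain i where i: "t \<in> {l i..u i}" using ul(1) by auto
    have "f j t \<le> f i t" for j using i by (auto simp: f_def indicator_def)
    then have "(SUP i. f i t) = f i t" by (intro antisym SUP_least SUP_upper) auto
    then show ?thesis using i True by (simp add: f_def)
  next
    case False
    then have "f i t = 0" for i using ul(1) by (auto simp: f_def indicator_def)
    then show ?thesis using False by simp
  qed
  have "act (einterval \<alpha> \<omega>) ext dext = (\<integral>\<^sup>+t. (SUP i. f i t) \<partial>lebesgue)"
    unfolding act_def sup ..
  also have "\<dots> = (SUP i. (\<integral>\<^sup>+t. f i t \<partial>lebesgue))"
  proof (rule nn_integral_monotone_convergence_SUP)
    show "incseq f"
    proof (rule incseq_SucI, rule le_funI)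
      fix i t
      have "{l i..u i} \<subseteq> {l (Suc i)..u (Suc i)}"
        using incseq_SucD[OF ul(2), of i] decseq_SucD[OF ul(3), of i] by auto
      then show "f i t \<le> f (Suc i) t" by (auto simp: f_def indicator_def)
    qed
    show "f i \<in> borel_measurable lebesgue" for i
      unfolding f_def[abs_def] using lagr_measurable[OF prim_ext]
      by (intro borel_measurable_times_ennreal borel_measurable_indicator measurable_compose[OF _ measurable_ennreal]) auto
  qed
  also have "\<dots> \<le> m\<^sub>c"
  proof (rule SUP_least)
    fix i
    have sub: "{l i..u i} \<subseteq> einterval \<alpha> \<omega>" using ul(1) by auto
    have pos: "c < V (\<gamma> t)" if "t \<in> {l i..u i}" for t using above_on_I sub that by blast
    have "(\<integral>\<^sup>+t. f i t \<partial>lebesgue) = act {l i..u i} ext dext" by (simp add: f_def act_def)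
    also have "\<dots> = act {l i..u i} \<gamma> d\<gamma>"
      by (rule act_cong) (use sub in \<open>auto simp: ext_I dext_def\<close>)
    also have "\<dots> = ennreal (integral {l i..u i} (lagr \<gamma> d\<gamma>))"
      by (rule act_eq_integral[OF lagr_gamma_integrable[OF pos] gamma_above])
    also have "\<dots> \<le> ennreal (enn2real m\<^sub>c + 0)"
    proof (rule ennreal_leI, rule action_lsc[OF less_imp_le[OF ul(4)] pos])
      show "integral {l i..u i} (lagr (q n) (p n)) \<le> enn2real m\<^sub>c + \<epsilon> n" for n
        by (rule near_min_total[OF nm])
      show "(\<lambda>n. enn2real m\<^sub>c + \<epsilon> n) \<longlonglongrightarrow> enn2real m\<^sub>c + 0" by (intro tendsto_intros eps)
    qed
    also have "\<dots> = m\<^sub>c" using m_finite by (simp add: ennreal_enn2real_if)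
    finally show "(\<integral>\<^sup>+t. f i t \<partial>lebesgue) \<le> m\<^sub>c" .
  qed
  finally show "act (einterval \<alpha> \<omega>) ext dext \<le> m\<^sub>c" .
qed

lemma minimal_connection: "minimal_c_connection \<phi> V c Vm Vp \<alpha> \<omega> ext"
  unfolding minimal_c_connection_def c_connection_def
proof (intro conjI ballI alpha_omega(3) ext_tendsto_Vm ext_tendsto_Vp)
  let ?I = "einterval \<alpha> \<omega>"
  have vd: "vector_derivative ext (at t) = dext t" for t by (rule vector_derivative_at[OF ext_derivative])
  have bound: "norm (ext t) \<le> R" for t unfolding ext_def by (rule gamma_bound)
  show "L_inf ?I ext"
  proof -
    have m: "ext \<in> borel_measurable (lebesgue_on ?I)"
      by (rule continuous_imp_measurable_on_sets_lebesgue[OF ext_cont]) simp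
    then have "esssup (lebesgue_on ?I) (\<lambda>t. ereal (norm (ext t))) \<le> ereal R"
      using bound by (intro esssup_I) auto
    then show ?thesis using m by (auto simp: L_inf_def Linf_norm_def intro: le_less_trans)
  qed
  show "C1_on (closure ?I) ext"
    unfolding C1_on_def
    by (intro exI[of _ dext] conjI ballI dext_cont has_vector_derivative_at_within[OF ext_derivative])
  show "C2_on_open ?I ext"
  proof -
    obtain D where D: "\<And>t. c < V (\<gamma> t) \<Longrightarrow> (d\<gamma> has_vector_derivative D t) (at t)"
      "continuous_on {t. c < V (\<gamma> t)} D"
      using d\<gamma>_derivative by blast
    have "(dext has_vector_derivative D t) (at t)" if t: "t \<in> ?I" for t
      by (rule has_vector_derivative_transform_within_open[OF D(1)[OF above_on_I[OF t]] _ t])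
         (auto simp: dext_def)
    moreover have "continuous_on ?I D" by (rule continuous_on_subset[OF D(2)]) (auto simp: above_on_I)
    ultimately show ?thesis
      unfolding C2_on_open_def C1_differentiable_on_def vd using ext_derivative dext_cont by blast
  qed
  fix t assume t: "t \<in> ?I"
  show "((\<lambda>s. \<phi> (norm (vector_derivative ext (at s))) *\<^sub>R vector_derivative ext (at s))
      has_vector_derivative gradient V (ext t)) (at t)"
  proof -
    have "((\<lambda>s. momentum (dext s)) has_vector_derivative gradient V (\<gamma> t)) (at t)"
      by (rule has_vector_derivative_transform_within_open[OF euler_lagrange[OF above_on_I[OF t]] _ t])
         (auto simp: dext_def)
    then show ?thesis using t by (simp add: vd momentum_def ext_I)
  qed
  show "c < V (ext t)" using above_on_I[OF t] by (simp add: ext_I[OF t])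
  show "G (norm (vector_derivative ext (at t))) - V (ext t) = - c"
    using ext_energy[of t] by (simp add: vd)
next
  have int: "is_interval (einterval \<alpha> \<omega>)"
    unfolding is_interval_1 Ball_def einterval_iff by (meson ereal_less_eq(3) le_less_trans less_le_trans)
  show "J_fun \<phi> V c (einterval \<alpha> \<omega>) ext = m\<^sub>c"
    using J_fun_eq_act[OF prim_ext ext_cont open_einterval int] act_ext by simp
qed

end

context connection_problem
begin

section \<open>Construction of the converging near-minimizers\<close>

lemma near_min_shift:
  assumes "near_min \<epsilon> q p" shows "near_min \<epsilon> (\<lambda>t. q (t + r)) (\<lambda>t. p (t + r))"
proof -
  have *: "prim UNIV q p" "\<And>t. c \<le> V (q t)" "starts q" "ends q" "act UNIV q p \<le> m\<^sub>c + ennreal \<epsilon>"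
    "m\<^sub>c < \<infinity>" "0 \<le> \<epsilon>"
    using assms by (auto simp: near_min_def curve_def)
  have "starts (\<lambda>t. q (t + r))"
    unfolding starts_def
  proof (intro allI impI)
    fix e T :: real assume "0 < e"
    then obtain t where "t \<le> T + r" "infdist (q t) Vm < e" using *(3) unfolding starts_def by blast
    then show "\<exists>t\<le>T. infdist (q (t + r)) Vm < e" by (intro exI[of _ "t - r"]) simp
  qed
  moreover have "ends (\<lambda>t. q (t + r))"
    unfolding ends_def
  proof (intro allI impI)
    fix e T :: real assume "0 < e"
    then obtain t where "T + r \<le> t" "infdist (q t) Vp < e" using *(4) unfolding ends_def by blast
    then show "\<exists>t\<ge>T. infdist (q (t + r)) Vp < e" by (intro exI[of _ "t - r"]) simp
  qed
  moreover have "prim UNIV (\<lambda>t. q (t + r)) (\<lambda>t. p (t + r))" by (rule prim_shift[OF *(1)]) simp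
  moreover have "act UNIV (\<lambda>t. q (t + r)) (\<lambda>t. p (t + r)) = act UNIV q p"
    using act_shift[OF *(1), of UNIV r] by simp
  ultimately show ?thesis using * by (simp add: near_min_def curve_def)
qed

text \<open>A diagonal subsequence converges at the rational times; the common modulus of continuity
  carries the Cauchy property to every time by comparison with a nearby rational one.\<close>

lemma near_min_convergent_subsequence:
  fixes q :: "nat \<Rightarrow> real \<Rightarrow> 'a"
  assumes nm: "\<And>n. near_min (\<epsilon> n) (q n) (p n)" "\<And>n. \<epsilon> n \<le> 1" and R: "\<And>n t. norm (q n t) \<le> R"
  shows "\<exists>k \<gamma>. strict_mono k \<and> (\<forall>t. (\<lambda>n. q (k n) t) \<longlonglongrightarrow> \<gamma> t)"
proof -
  obtain k where k: "strict_mono (k :: nat \<Rightarrow> nat)" "\<And>x. x \<in> \<rat> \<Longrightarrow> \<exists>l. (\<lambda>n. q (k n) x) \<longlonglongrightarrow> l"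
    using function_convergent_subsequence[OF countable_rat, of q R] R by metis
  have "Cauchy (\<lambda>n. q (k n) t)" for t
  proof (rule CauchyI)
    fix e :: real assume "0 < e"
    then have "0 < e / 3" by simp
    have "0 \<le> enn2real m\<^sub>c + 1" by (simp add: add_nonneg_nonneg)
    from modulus_small[OF \<open>0 < e / 3\<close> this] obtain d where d: "0 < d"
      "\<And>r h. 0 \<le> h \<Longrightarrow> h < d \<Longrightarrow> (\<And>a. 0 \<le> a \<Longrightarrow> A a * r \<le> enn2real m\<^sub>c + 1 + G a * h) \<Longrightarrow> r < e / 3"
      by blast
    obtain s where s: "s \<in> \<rat>" "t < s" "s < t + d" using Rats_dense_in_real[of t "t + d"] d(1) by auto
    have close: "norm (q n s - q n t) < e / 3" for n
    proof (rule d(2))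
      show "0 \<le> s - t" "s - t < d" using s by auto
      show "A a * norm (q n s - q n t) \<le> enn2real m\<^sub>c + 1 + G a * (s - t)" if "0 \<le> a" for a
        using near_min_modulus[OF nm(1)[of n] _ that, of t s] nm(2)[of n] s by simp
    qed
    have "Cauchy (\<lambda>n. q (k n) s)" using k(2)[OF s(1)] LIMSEQ_imp_Cauchy by blast
    then obtain M where M: "\<And>m n. m \<ge> M \<Longrightarrow> n \<ge> M \<Longrightarrow> norm (q (k m) s - q (k n) s) < e / 3"
      using CauchyD \<open>0 < e / 3\<close> by metis
    show "\<exists>M. \<forall>m\<ge>M. \<forall>n\<ge>M. norm (q (k m) t - q (k n) t) < e"
    proof (intro exI allI impI)
      fix m n assume mn: "M \<le> m" "M \<le> n"
      have "q (k m) t - q (k n) t = (q (k m) s - q (k n) s) - (q (k m) s - q (k m) t) + (q (k n) s - q (k n) t)"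
        by simp
      also have "norm \<dots> \<le> norm (q (k m) s - q (k n) s) + norm (q (k m) s - q (k m) t) + norm (q (k n) s - q (k n) t)"
        by (meson add_right_mono norm_triangle_ineq norm_triangle_ineq4 order_trans)
      also have "\<dots> < e" using M[OF mn] close[of "k m"] close[of "k n"] by simp
      finally show "norm (q (k m) t - q (k n) t) < e" .
    qed
  qed
  then have "\<exists>l. (\<lambda>n. q (k n) t) \<longlonglongrightarrow> l" for t
    by (simp add: Cauchy_convergent_iff convergent_def)
  then obtain \<gamma> where "\<And>t. (\<lambda>n. q (k n) t) \<longlonglongrightarrow> \<gamma> t" by metis
  then show ?thesis using k(1) by blast
qed

text \<open>By continuity, exceeding \<open>R\<close> somewhere means exceeding it on a nonempty
  open set, which is not negligible.\<close>

lemma norm_le_if_Linf_norm_le: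
  fixes q :: "real \<Rightarrow> 'a"
  assumes "Linf_norm UNIV q \<le> ereal R" "continuous_on UNIV q"
  shows "norm (q t) \<le> R"
proof (rule ccontr)
  assume "\<not> norm (q t) \<le> R"
  define U where "U = {s. R < norm (q s)}"
  have U: "open U" "t \<in> U"
    using \<open>\<not> norm (q t) \<le> R\<close> assms(2) by (auto simp: U_def intro!: open_Collect_less continuous_intros)
  have "AE s in lebesgue. ereal (norm (q s)) \<le> Linf_norm UNIV q"
    unfolding Linf_norm_def lebesgue_on_UNIV_eq by (rule esssup_AE)
  then have "AE s in lebesgue. s \<notin> U"
  proof eventually_elim
    case (elim s)
    then have "ereal (norm (q s)) \<le> ereal R" using assms(1) by (rule order_trans)
    then show ?case by (simp add: U_def)
  qed
  then have "U \<in> null_sets lebesgue" using U(1) by (simp add: AE_iff_null_sets)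
  then have "negligible U" by (simp add: negligible_iff_null_sets)
  then show False using open_not_negligible[OF U(1)] U(2) by blast
qed

lemma crossing_time:
  assumes "continuous_on UNIV q" "starts q" "ends q"
  obtains t where "infdist (q t) Vm = \<delta> / 2"
proof -
  have d: "0 < \<delta> / 2" using delta_pos by simp
  obtain a b where ab: "infdist (q a) Vm < \<delta> / 2" "infdist (q b) Vp < \<delta> / 2"
    using assms(2,3) d unfolding starts_def ends_def by blast
  \<comment> \<open>Near \<open>Vp\<close> the distance to \<open>Vm\<close> is above
    \<open>\<delta> / 2\<close>, so the intermediate value theorem finds the level in
    between.\<close>
  have "\<delta> / 2 < infdist (q b) Vm" using delta_le_infdist_sum[of "q b"] ab(2) by simp
  have "connected (range (\<lambda>t. infdist (q t) Vm))"
    by (intro connected_continuous_image continuous_intros assms(1) connected_UNIV)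
  from connectedD_interval[OF this rangeI rangeI less_imp_le[OF ab(1)] less_imp_le[OF \<open>\<delta> / 2 < infdist (q b) Vm\<close>]]
  obtain t where "\<delta> / 2 = infdist (q t) Vm" by (rule rangeE)
  then show ?thesis by (intro that[of t]) simp
qed

theorem minimal_connection_exists:
  assumes R: "m\<^sub>c = (INF q\<in>{q \<in> admissible \<phi> V c Vm Vp. Linf_norm UNIV q \<le> ereal R}. J_fun \<phi> V c UNIV q)"
  shows "\<exists>\<alpha> \<omega> q. minimal_c_connection \<phi> V c Vm Vp \<alpha> \<omega> q"
proof -
  define e where "e n = 1 / real (Suc n)" for n
  have e: "0 < e n" "e n \<le> 1" for n by (auto simp: e_def)
  have e_lim: "e \<longlonglongrightarrow> 0" unfolding e_def[abs_def] by real_asymp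
  have "\<exists>q p. near_min (e n) q p \<and> (\<forall>t. norm (q t) \<le> R) \<and> infdist (q 0) Vm = \<delta> / 2" for n
  proof -
    \<comment> \<open>Finiteness of \<open>m\<^sub>c\<close> makes the inequality strict, so that
      the restricted infimum supplies an actual curve bounded by \<open>R\<close>.\<close>
    have "(INF q\<in>{q \<in> admissible \<phi> V c Vm Vp. Linf_norm UNIV q \<le> ereal R}. J_fun \<phi> V c UNIV q) < m\<^sub>c + ennreal (e n)"
      unfolding R[symmetric] using m_finite e(1)[of n] ennreal_add_left_cancel_less[of "m\<^sub>c" 0 "ennreal (e n)"] by simp
    then obtain q where q: "q \<in> admissible \<phi> V c Vm Vp" "Linf_norm UNIV q \<le> ereal R"
      "J_fun \<phi> V c UNIV q < m\<^sub>c + ennreal (e n)"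
      unfolding INF_less_iff by auto
    obtain p where p: "curve q p" "starts q" "ends q" "J_fun \<phi> V c UNIV q = act UNIV q p"
      using admissible_curve[OF q(1)] by blast
    have nm: "near_min (e n) q p"
      using p q(3) m_finite e(1)[of n] by (simp add: near_min_def)
    have cont: "continuous_on UNIV q" by (rule prim_continuous_on_UNIV[OF near_min_basic(1)[OF nm]])
    obtain r where r: "infdist (q r) Vm = \<delta> / 2" using crossing_time[OF cont p(2,3)] by blast
    show ?thesis
      using near_min_shift[OF nm, of r] norm_le_if_Linf_norm_le[OF q(2) cont] r
      by (intro exI[of _ "\<lambda>t. q (t + r)"] exI[of _ "\<lambda>t. p (t + r)"]) simp
  qed
  then obtain q p where qp: "\<And>n. near_min (e n) (q n) (p n)" "\<And>n t. norm (q n t) \<le> R"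
    "\<And>n. infdist (q n 0) Vm = \<delta> / 2" by metis
  obtain k \<gamma> where k: "strict_mono k" "\<And>t. (\<lambda>n. q (k n) t) \<longlonglongrightarrow> \<gamma> t"
    using near_min_convergent_subsequence[where q = q and p = p and \<epsilon> = e and R = R, OF qp(1) e(2) qp(2)]
    by (elim exE conjE) auto
  interpret limit_curve \<phi> l V c Vm Vp "\<lambda>n. q (k n)" "\<lambda>n. p (k n)" "\<lambda>n. e (k n)" \<gamma> R
  proof
    show "(\<lambda>n. e (k n)) \<longlonglongrightarrow> 0" using LIMSEQ_subseq_LIMSEQ[OF e_lim k(1)] by (simp add: o_def)
  qed (rule qp e(2) k(2))+
  show ?thesis using minimal_connection by (intro exI)
qed

end

theorem theorem1p1:
  fixes \<phi> :: "real \<Rightarrow> real" and l m c R :: real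
    and V :: "real ^ 'n \<Rightarrow> real" and Vm Vp :: "(real ^ 'n) set"
  assumes "1 < l" and "l \<le> m"
    and "\<And>s. s > 0 \<Longrightarrow> \<phi> s > 0"
    and "\<phi> C1_differentiable_on {0<..}"
    and "\<And>s. s > 0 \<Longrightarrow> deriv (\<lambda>r. \<phi> r * r) s > 0"
    and "\<And>s. s > 0 \<Longrightarrow> l - 1 \<le> deriv (\<lambda>r. \<phi> r * r) s / \<phi> s"
    and "\<And>s. s > 0 \<Longrightarrow> deriv (\<lambda>r. \<phi> r * r) s / \<phi> s \<le> m - 1"
    and "C1_potential V"
    and "{x. V x \<le> c} = Vm \<union> Vp"
    and "Vm \<noteq> {}" and "Vp \<noteq> {}" and "setdist Vm Vp > 0"
    and "R > 0"
    and "(INF q\<in>admissible \<phi> V c Vm Vp. J_fun \<phi> V c UNIV q) =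
         (INF q\<in>{q \<in> admissible \<phi> V c Vm Vp. Linf_norm UNIV q \<le> ereal R}. J_fun \<phi> V c UNIV q)"
  shows "\<exists>\<alpha> \<omega> q. minimal_c_connection \<phi> V c Vm Vp \<alpha> \<omega> q"
proof -
  interpret connection_problem \<phi> l V c Vm Vp
    by unfold_locales (fact assms)+
  show ?thesis
    using minimal_connection_exists[of R] assms(14) by (simp add: m_inf_def)
qed

end
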